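(* For every $k\ge 6$ the space $\mathcal{H}(A_6,C_{2\times 2}^k)^{abs}$ has exactly two connected components, $\mathcal{H}_+(A_6,C_{2\times 2}^k)^{abs}$ and $\mathcal{H}_-(A_6,C_{2\times 2}^k)^{abs}$. The space $\mathcal{H}(A_6,C_{2\times 2}^5)^{abs}$ is connected. That is, the Hurwitz scheme (of degree $6$ coverings $X\to\mathbb{P}^1$ with monodromy group $A_6$ and all local monodromies in $C_{2\times 2}$) has exactly one irreducible component if the genus of $X$ is equal to zero and exactly two irreducible components if the genus of $X$ is greater than zero.
   Context: All varieties are over $\mathbb{C}$. $A_6\subset S_6$ is the alternating group, and $C_{2\times 2}$ is the conjugacy class of $A_6$ consisting of the $45$ products of two disjoint transpositions. Nielsen class: $\mathrm{Ni}(A_6,C_{2\times 2}^k)$ is the set of tuples $(g_1,\dots,g_k)$ with $g_i\in C_{2\times 2}$, $g_1\cdots g_k=1$ and $\langle g_1,\dots,g_k\rangle=A_6$. Hurwitz action: the braid group $B_k$ acts on tuples through its standard generators by $\sigma_i(g_1,\dots,g_k)=(g_1,\dots,g_{i-1},g_{i+1},g_{i+1}^{-1}g_ig_{i+1},g_{i+2},\dots,g_k)$. Absolute action: $s\in N_{S_6}(A_6)=S_6$ acts by $\phi_s(g_1,\dots,g_k)=(s^{-1}g_1s,\dots,s^{-1}g_ks)$. Hurwitz space: $\mathcal{H}(A_6,C_{2\times 2}^k)^{abs}$ is the space of degree $6$ coverings $f:X\to\mathbb{P}^1$, $X$ a connected curve, with exactly $k$ branch points, monodromy group $A_6$ and local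 monodromy at each branch point in $C_{2\times 2}$, where $f:X\to\mathbb{P}^1$ and $g:Y\to\mathbb{P}^1$ are equivalent if there is a biholomorphism $\psi:X\to Y$ with $f=g\circ\psi$. By the Riemann existence theorem it is described by $\mathrm{Ni}(A_6,C_{2\times 2}^k)/S_6$, and its connected components (equivalently, irreducible components) correspond bijectively to the orbits of the Hurwitz action on $\mathrm{Ni}(A_6,C_{2\times 2}^k)/S_6$. By Riemann–Hurwitz the genus of $X$ is $k-5$. Valentiner group and lifting invariant: identify $A_6$ with the subgroup of $S_6$ generated by $s_1=(1,2)(3,4)$, $s_2=(1,2,4,5)(3,6)$. The Valentiner group $V$ (order $1080$) is the subgroup of $S_{18}$ generated by $v_1=(2,6)(4,11)(7,9)(8,13)(10,14)(12,16)$ and $v_2=(1,2,7,4)(3,8,6,10)(5,9,13,12)(11,15)(14,17)(16,18)$; the surjection $\pi:V\to A_6$ is given by $v_1\mapsto s_1$, $v_2\mapsto s_2$, and its kernel is central and cyclic of order $3$. Every $x\in C_{2\times 2}$ has a unique lift $\hat x\in V$ of order $2$. The lifting invariant of a tuple $\mathbf{g}=(g_1,\dots,g_k)$ in $C_{2\times 2}$ with product $1$ is $\gamma(\mathbf{g})=\hat g_1\cdots\hat g_k\in\ker\pi$; its order ($1$ or $3$) is invariant under the Hurwitz and absolute actions. $\mathcal{H}_+(A_6,C_{2\times 2}^k)^{abs}$ denotes the locus of coverings with $\gamma$ trivial, and $\mathcal{H}_-(A_6,C_{2\times 2}^k)^{abs}$ the locus of coverings with $\gamma$ of order $3$. *)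

theory Defs
  imports "HOL-Combinatorics.Orbits" "HOL-Algebra.Sym_Groups" "HOL-Algebra.Group_Action"
    "HOL-Algebra.Multiplicative_Group"
begin

text \<open>
  Permutations are multiplied as in \<^term>\<open>sym_group\<close>, i.e. composed from right to left.
  Composing them from left to right gives the same objects below: passing to the opposite group
  is inversion \<open>g \<mapsto> g\<inverse>\<close>, which fixes every element of the class \<open>C\<^sub>2\<^sub>\<times>\<^sub>2\<close>
  and every involution of the Valentiner group.
\<close>

section \<open>Nielsen classes\<close>

definition C22 :: "(nat \<Rightarrow> nat) set" where
  "C22 = {transpose a b \<circ> transpose c d | a b c d. distinct [a, b, c, d] \<and> {a, b, c, d} \<subseteq> {1..6}}"

definition tuple_prod :: "('a, 'b) monoid_scheme \<Rightarrow> 'a list \<Rightarrow> 'a" where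
  "tuple_prod G gs = foldr (\<otimes>\<^bsub>G\<^esub>) gs \<one>\<^bsub>G\<^esub>"

definition nielsen :: "('a, 'b) monoid_scheme \<Rightarrow> 'a set \<Rightarrow> nat \<Rightarrow> 'a list set" where
  "nielsen G C k =
     {gs. length gs = k \<and> set gs \<subseteq> C \<and> tuple_prod G gs = \<one>\<^bsub>G\<^esub> \<and> generate G (set gs) = carrier G}"

abbreviation Ni :: "nat \<Rightarrow> (nat \<Rightarrow> nat) list set" where
  "Ni k \<equiv> nielsen (alt_group 6) C22 k"

text \<open>List positions start at \<open>0\<close>, so the generators \<open>\<sigma>\<^sub>1, \<dots>, \<sigma>\<^bsub>k-1\<^esub>\<close> of the
  braid group correspond to \<open>i = 0, \<dots>, k - 2\<close>.\<close>

definition hurwitz_move :: "('a, 'b) monoid_scheme \<Rightarrow> nat \<Rightarrow> 'a list \<Rightarrow> 'a list" where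
  "hurwitz_move G i gs =
     gs[i := gs ! Suc i, Suc i := inv\<^bsub>G\<^esub> (gs ! Suc i) \<otimes>\<^bsub>G\<^esub> gs ! i \<otimes>\<^bsub>G\<^esub> gs ! Suc i]"

definition conj_action :: "('a, 'b) monoid_scheme \<Rightarrow> 'a \<Rightarrow> 'a list \<Rightarrow> 'a list" where
  "conj_action G s gs = map (\<lambda>g. inv\<^bsub>G\<^esub> s \<otimes>\<^bsub>G\<^esub> g \<otimes>\<^bsub>G\<^esub> s) gs"

section \<open>The Hurwitz space and its components\<close>

text \<open>
  By the Riemann existence theorem, coverings with a given branch locus of size \<open>k\<close> are, up to
  equivalence, the elements of \<open>Ni(A\<^sub>6, C\<^sub>2\<^sub>\<times>\<^sub>2\<^sup>k) / S\<^sub>6\<close>, and the Hurwitz space is described by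
  this set with its braid group action: the (connected, equivalently irreducible) components of
  the space are the orbits.  Accordingly a locus of coverings that is a union of components is
  represented by a subset of \<open>Ni(A\<^sub>6, C\<^sub>2\<^sub>\<times>\<^sub>2\<^sup>k) / S\<^sub>6\<close>.
\<close>

definition hurwitz_space :: "nat \<Rightarrow> (nat \<Rightarrow> nat) list set set" where
  "hurwitz_space k = orbits (sym_group 6) (Ni k) (conj_action (sym_group 6))"

definition braid_gen :: "nat \<Rightarrow> nat \<Rightarrow> (nat \<Rightarrow> nat) list set \<Rightarrow> (nat \<Rightarrow> nat) list set" where
  "braid_gen k i = (\<lambda>P \<in> hurwitz_space k. hurwitz_move (alt_group 6) i ` P)"

text \<open>The image of the braid group on \<open>k\<close> strands in the permutations of
  \<^term>\<open>hurwitz_space k\<close>.\<close>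

definition braid_image ::
  "nat \<Rightarrow> ((nat \<Rightarrow> nat) list set \<Rightarrow> (nat \<Rightarrow> nat) list set) monoid" where
  "braid_image k = (BijGroup (hurwitz_space k))
     \<lparr>carrier := generate (BijGroup (hurwitz_space k)) {braid_gen k i | i. Suc i < k}\<rparr>"

definition hurwitz_components :: "nat \<Rightarrow> (nat \<Rightarrow> nat) list set set set" where
  "hurwitz_components k = orbits (braid_image k) (hurwitz_space k) (\<lambda>b. b)"

section \<open>The Valentiner group and the lifting invariant\<close>

definition s1 :: "nat \<Rightarrow> nat" where
  "s1 = cycle_of_list [1, 2] \<circ> cycle_of_list [3, 4]"

definition s2 :: "nat \<Rightarrow> nat" where
  "s2 = cycle_of_list [1, 2, 4, 5] \<circ> cycle_of_list [3, 6]"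

definition v1 :: "nat \<Rightarrow> nat" where
  "v1 = cycle_of_list [2, 6] \<circ> cycle_of_list [4, 11] \<circ> cycle_of_list [7, 9]
      \<circ> cycle_of_list [8, 13] \<circ> cycle_of_list [10, 14] \<circ> cycle_of_list [12, 16]"

definition v2 :: "nat \<Rightarrow> nat" where
  "v2 = cycle_of_list [1, 2, 7, 4] \<circ> cycle_of_list [3, 8, 6, 10] \<circ> cycle_of_list [5, 9, 13, 12]
      \<circ> cycle_of_list [11, 15] \<circ> cycle_of_list [14, 17] \<circ> cycle_of_list [16, 18]"

definition valentiner :: "(nat \<Rightarrow> nat) monoid" where
  "valentiner = (sym_group 18) \<lparr>carrier := generate (sym_group 18) {v1, v2}\<rparr>"

text \<open>Only the values on the carrier matter; there the homomorphism is unique, since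
  \<^term>\<open>v1\<close> and \<^term>\<open>v2\<close> generate.\<close>

definition valentiner_proj :: "(nat \<Rightarrow> nat) \<Rightarrow> (nat \<Rightarrow> nat)" where
  "valentiner_proj = (SOME p. p \<in> hom valentiner (alt_group 6) \<and> p v1 = s1 \<and> p v2 = s2)"

definition inv_lift :: "(nat \<Rightarrow> nat) \<Rightarrow> (nat \<Rightarrow> nat)" where
  "inv_lift x =
     (THE v. v \<in> carrier valentiner \<and> valentiner_proj v = x \<and> group.ord valentiner v = 2)"

definition lifting_invariant :: "(nat \<Rightarrow> nat) list \<Rightarrow> (nat \<Rightarrow> nat)" where
  "lifting_invariant gs = tuple_prod valentiner (map inv_lift gs)"

definition hurwitz_plus :: "nat \<Rightarrow> (nat \<Rightarrow> nat) list set set" where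
  "hurwitz_plus k =
     {P \<in> hurwitz_space k. \<forall>gs \<in> P. lifting_invariant gs = \<one>\<^bsub>valentiner\<^esub>}"

definition hurwitz_minus :: "nat \<Rightarrow> (nat \<Rightarrow> nat) list set set" where
  "hurwitz_minus k =
     {P \<in> hurwitz_space k. \<forall>gs \<in> P. group.ord valentiner (lifting_invariant gs) = 3}"

section \<open>Genus\<close>

text \<open>Ramification index sum of \<open>e - 1\<close> over a fibre whose local monodromy is \<open>g\<close>: the degree
  \<open>6\<close> minus the number of cycles of \<open>g\<close>, fixed points included.\<close>

definition ramification :: "(nat \<Rightarrow> nat) \<Rightarrow> nat" where
  "ramification g = 6 - card (Orbits.orbit g ` {1..6})"

text \<open>The Riemann--Hurwitz formula for a connected covering of the projective line of degree
  \<open>6\<close> with branch cycles \<open>gs\<close>.\<close>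

definition covering_genus :: "(nat \<Rightarrow> nat) list \<Rightarrow> nat \<Rightarrow> bool" where
  "covering_genus gs g \<longleftrightarrow> 2 * int g - 2 = 6 * (- 2) + int (\<Sum>x\<leftarrow>gs. ramification x)"

text \<open>Components of the whole Hurwitz scheme, the disjoint union over all numbers \<open>k\<close> of branch
  points, whose coverings have genus \<open>g\<close>.\<close>

definition hurwitz_components_of_genus :: "nat \<Rightarrow> (nat \<Rightarrow> nat) list set set set" where
  "hurwitz_components_of_genus g =
     {Z. \<exists>k. Z \<in> hurwitz_components k \<and> (\<forall>P \<in> Z. \<forall>gs \<in> P. covering_genus gs g)}"

end

(*
  The 45 elements of C22 are identified with the 45 involutions of the Valentiner group V, so a
  tuple becomes a word in these involutions and its lifting invariant is the product of the word.
  For words generating A6 of length n >= 3 the braid class is determined by the product in V.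
  This is proved by induction on n: such a word is braid equivalent to a # x with x generating,
  so it is determined by a once the product v is fixed; and (a, b, u) ~ (b, b a b, u) identifies the
  choices a and b whenever b a v is the product of some word u for which (b, u) and (b a b, u)
  generate.  Only n <= 6 requires finite computations, which are done up to conjugation.
  A generating word of length 5 can have every product except 1, and one of length n >= 6 every
  product; the products z and z^2, z a generator of the centre, are exchanged by odd permutations.
*)
theory Submission
  imports Defs
begin

section \<open>Braid equivalence of words in a class of involutions\<close>

text \<open>Over A6 every tuple has product 1, but an induction on the length meets tails with
  arbitrary product; and since braid moves also preserve the product of the lifts, the statement to
  prove is one about words in V with any product. Length 3 is the natural start: two involutions
  generate a dihedral group, and for a triple the product in V alone decides whether it generates.
  The obstacle is size: V has 1080 elements and every computation is replayed by rewriting. Searches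
  are therefore stored as certificates (conjugators, braid moves, closure steps), and conjugation
  reduces all elements to 11 representatives. To reach that number odd elements are used as well;
  they invert the centre, which is why V is embedded in semimonomial rather than monomial
  permutations of its 18 points. Generation is tested by closure of sets of involutions under
  conjugation, so that no subgroup has to be listed: a tail that does not yet generate is improved
  by a letter that moves some set of points preserved by the tail.\<close>

definition cnj :: "'a::monoid_mult \<Rightarrow> 'a \<Rightarrow> 'a" where
  "cnj c x = c * x * c"

text \<open>Conjugation by the product of \<open>ss\<close>, provided its entries square to 1. The
  list of factors takes the place of a group element with an inverse, since the reversed list undoes
  it; so everything can run in a monoid.\<close>

definition cnjs :: "'a::monoid_mult list \<Rightarrow> 'a \<Rightarrow> 'a" where
  "cnjs ss x = foldr cnj ss x"

lemma cnjs_simps [simp]: "cnjs [] = id" "cnjs (s # ss) x = cnj s (cnjs ss x)"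
  by (simp_all add: cnjs_def fun_eq_iff)

lemma cnjs_append: "cnjs (ss @ ts) x = cnjs ss (cnjs ts x)"
  by (simp add: cnjs_def)

lemma cnj_one: "s * s = 1 \<Longrightarrow> cnj s 1 = 1"
  by (simp add: cnj_def)

lemma cnj_mult: "s * s = 1 \<Longrightarrow> cnj s (x * y) = cnj s x * cnj s y"
  by (simp add: cnj_def mult.assoc) (metis mult.assoc mult_1_left)

lemma cnj_cnj: "s * s = 1 \<Longrightarrow> cnj s (cnj s x) = x"
  by (simp add: cnj_def mult.assoc) (metis mult.assoc mult_1_left)

lemma prod_list_rev:
  fixes u :: "'a::monoid_mult list"
  assumes "\<And>a. a \<in> set u \<Longrightarrow> a * a = 1" shows "prod_list u * prod_list (rev u) = 1"
  using assms
proof (induction u)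
  case (Cons a u)
  have "prod_list (a # u) * prod_list (rev (a # u)) = a * (prod_list u * prod_list (rev u)) * a"
    by (simp add: mult.assoc)
  moreover have "prod_list u * prod_list (rev u) = 1" "a * a = 1" using Cons by auto
  ultimately show ?case by (metis mult_1_right)
qed simp

text \<open>\<open>swap\<close> acts at the head only; \<open>Cons\<close> carries it to every
  position and \<open>sym\<close> supplies the inverse moves. On words in a class of involutions the
  equivalence classes are the orbits of the braid group.\<close>

inductive braid_eq :: "'a::monoid_mult list \<Rightarrow> 'a list \<Rightarrow> bool" (infix "\<sim>" 50) where
  refl: "w \<sim> w"
| sym: "w \<sim> w' \<Longrightarrow> w' \<sim> w"
| trans: "w \<sim> w' \<Longrightarrow> w' \<sim> w'' \<Longrightarrow> w \<sim> w''"
| swap: "a # b # w \<sim> b # cnj b a # w"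
| Cons: "w \<sim> w' \<Longrightarrow> a # w \<sim> a # w'"

declare braid_eq.refl [simp] braid_eq.trans [trans]

lemma braid_eq_length: "w \<sim> w' \<Longrightarrow> length w = length w'"
  by (induction rule: braid_eq.induct) simp_all

lemma braid_eq_append1: "w \<sim> w' \<Longrightarrow> u @ w \<sim> u @ w'"
  by (induction u) (simp_all add: braid_eq.Cons)

lemma braid_eq_append2: "w \<sim> w' \<Longrightarrow> w @ u \<sim> w' @ u"
proof (induction rule: braid_eq.induct)
  case (sym w w') then show ?case by (blast intro: braid_eq.sym)
next
  case (trans w w' w'') then show ?case by (meson braid_eq.trans)
qed (simp_all add: braid_eq.swap braid_eq.Cons)

lemma braid_eq_map_cnj:
  assumes "s * s = 1" "w \<sim> w'" shows "map (cnj s) w \<sim> map (cnj s) w'"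
  using assms(2)
proof (induction rule: braid_eq.induct)
  case (sym w w') then show ?case by (blast intro: braid_eq.sym)
next
  case (trans w w' w'') then show ?case by (meson braid_eq.trans)
next
  case (swap a b w)
  have "cnj s (cnj b a) = cnj (cnj s b) (cnj s a)"
    using assms(1) by (simp add: cnj_def[of b] cnj_def[of "cnj s b"] cnj_mult)
  then show ?case by (simp add: braid_eq.swap)
qed (simp_all add: braid_eq.Cons)

fun braid_move :: "nat \<Rightarrow> 'a::monoid_mult list \<Rightarrow> 'a list" where
  "braid_move 0 (a # b # w) = b # cnj b a # w"
| "braid_move (Suc k) (a # w) = a # braid_move k w"
| "braid_move k w = w"

lemma braid_move: "w \<sim> braid_move k w"
  by (induction k w rule: braid_move.induct) (simp_all add: braid_eq.swap braid_eq.Cons)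

definition braid_moves :: "nat list \<Rightarrow> 'a::monoid_mult list \<Rightarrow> 'a list" where
  "braid_moves ks w = fold braid_move ks w"

lemma braid_moves: "w \<sim> braid_moves ks w"
  unfolding braid_moves_def
  by (induction ks arbitrary: w) (auto intro: braid_eq.trans braid_move)

section \<open>Generation expressed by closure under conjugation\<close>

definition cnj_closed :: "'a::monoid_mult set \<Rightarrow> bool" where
  "cnj_closed M \<longleftrightarrow> (\<forall>x\<in>M. \<forall>y\<in>M. cnj y x \<in> M)"

locale involution_class =
  fixes C :: "'a::monoid_mult set"
  assumes sq: "a \<in> C \<Longrightarrow> a * a = 1"
    and closed: "a \<in> C \<Longrightarrow> b \<in> C \<Longrightarrow> cnj b a \<in> C"
begin

lemma cancel [simp]: "a \<in> C \<Longrightarrow> a * (a * x) = x"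
  by (metis mult.assoc mult_1_left sq)

definition normalizers :: "'a set" where
  "normalizers = {s. s * s = 1 \<and> (\<forall>x\<in>C. cnj s x \<in> C)}"

lemma normalizers_sq: "s \<in> normalizers \<Longrightarrow> s * s = 1"
  by (simp add: normalizers_def)

lemma normalizers_cnj: "s \<in> normalizers \<Longrightarrow> x \<in> C \<Longrightarrow> cnj s x \<in> C"
  by (simp add: normalizers_def)

lemma C_normalizers: "C \<subseteq> normalizers"
  by (auto simp: normalizers_def sq closed)

lemma braid_eq_subset: "w \<sim> w' \<Longrightarrow> set w \<subseteq> C \<longleftrightarrow> set w' \<subseteq> C"
proof (induction rule: braid_eq.induct)
  case (swap a b w)
  have "b \<in> C \<Longrightarrow> cnj b a \<in> C \<Longrightarrow> a \<in> C"
    using closed[of "cnj b a" b] cnj_cnj[OF sq, of b a] by simp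
  then show ?case by (auto simp: closed)
qed auto

lemma braid_eq_prod_list: "w \<sim> w' \<Longrightarrow> set w \<subseteq> C \<Longrightarrow> prod_list w = prod_list w'"
proof (induction rule: braid_eq.induct)
  case (sym w w') then show ?case using braid_eq_subset by metis
next
  case (trans w w' w'') then show ?case using braid_eq_subset by metis
next
  case (swap a b w) then show ?case by (simp add: cnj_def mult.assoc)
qed auto

text \<open>This uses the inverse braid move; \<open>swap\<close> itself would conjugate \<open>a\<close> on its way.\<close>

lemma move_right:
  assumes "a \<in> C" shows "a # u \<sim> map (cnj a) u @ [a]"
proof (induction u)
  case (Cons b u)
  have "cnj a b # a # u \<sim> a # b # u"
    using braid_eq.swap[of "cnj a b" a u] cnj_cnj[OF sq[OF assms]] by simp
  then show ?case
    by (simp, meson Cons.IH braid_eq.Cons braid_eq.sym braid_eq.trans)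
qed simp

text \<open>Stands for generation of the group without speaking of subgroups;
  \<open>gen_iff_generate\<close> proves the equivalence for A6. In this form a list of conjugations
  certifies generation, and one closed set refutes it.\<close>

definition gen :: "'a list \<Rightarrow> bool" where
  "gen w \<longleftrightarrow> set w \<subseteq> C \<and> (\<forall>M. cnj_closed M \<longrightarrow> set w \<subseteq> M \<longrightarrow> C \<subseteq> M)"

lemma gen_subset: "gen w \<Longrightarrow> set w \<subseteq> C"
  by (simp add: gen_def)

lemma gen_mono: "gen w \<Longrightarrow> set w \<subseteq> set w' \<Longrightarrow> set w' \<subseteq> C \<Longrightarrow> gen w'"
  by (auto simp: gen_def)

text \<open>As \<open>M\<close> consists of involutions, \<open>a\<close> is recovered as
  \<open>cnj b (cnj b a)\<close>, so a move can be read backwards inside \<open>M\<close>.\<close>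

lemma braid_eq_closed_subset:
  assumes "cnj_closed M" "M \<subseteq> C" shows "w \<sim> w' \<Longrightarrow> set w \<subseteq> M \<longleftrightarrow> set w' \<subseteq> M"
proof (induction rule: braid_eq.induct)
  case (swap a b w)
  have "b \<in> M \<Longrightarrow> cnj b a \<in> M \<Longrightarrow> a \<in> M"
    using assms sq cnj_cnj[of b a] unfolding cnj_closed_def by (metis subsetD)
  then show ?case using assms by (auto simp: cnj_closed_def)
qed auto

text \<open>Intersecting a closed set with \<open>C\<close> leaves it closed, so subsets of
  \<open>C\<close> suffice as tests; for these \<open>braid_eq_closed_subset\<close> gives braid
  invariance.\<close>

lemma gen_alt: "gen w \<longleftrightarrow> set w \<subseteq> C \<and> (\<forall>M. cnj_closed M \<longrightarrow> M \<subseteq> C \<longrightarrow> set w \<subseteq> M \<longrightarrow> M = C)"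
  (is "_ \<longleftrightarrow> ?R")
proof
  assume "?R"
  show "gen w"
    unfolding gen_def
  proof (intro conjI allI impI)
    fix M assume M: "cnj_closed M" "set w \<subseteq> M"
    have "cnj_closed (M \<inter> C)"
      using M closed by (auto simp: cnj_closed_def)
    then have "M \<inter> C = C"
      using \<open>?R\<close> M by (metis Int_lower2 Int_subset_iff)
    then show "C \<subseteq> M" by blast
  qed (use \<open>?R\<close> in blast)
qed (auto simp: gen_def)

lemma gen_braid_eq: "w \<sim> w' \<Longrightarrow> gen w \<longleftrightarrow> gen w'"
  unfolding gen_alt using braid_eq_closed_subset braid_eq_subset by metis

text \<open>The preimage of a closed set under \<open>cnj s\<close> is closed, and
  \<open>cnj s\<close> permutes \<open>C\<close>.\<close>

lemma gen_map_cnj: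
  assumes "s \<in> normalizers" "gen w" shows "gen (map (cnj s) w)"
  unfolding gen_def
proof (intro conjI allI impI)
  note ss = normalizers_sq[OF assms(1)]
  show "set (map (cnj s) w) \<subseteq> C"
    using assms gen_subset normalizers_cnj by fastforce
  fix M assume M: "cnj_closed M" "set (map (cnj s) w) \<subseteq> M"
  have "cnj_closed (cnj s -` M)"
    unfolding cnj_closed_def
  proof (clarsimp)
    fix x y assume "cnj s x \<in> M" "cnj s y \<in> M"
    moreover have "cnj s (cnj y x) = cnj (cnj s y) (cnj s x)"
      using ss by (simp add: cnj_def[of y] cnj_def[of "cnj s y"] cnj_mult)
    ultimately show "cnj s (cnj y x) \<in> M"
      using M(1) by (simp add: cnj_closed_def)
  qed
  moreover have "set w \<subseteq> cnj s -` M" using M(2) by auto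
  ultimately have "C \<subseteq> cnj s -` M" using assms(2) by (simp add: gen_def)
  then show "C \<subseteq> M"
    using cnj_cnj[OF ss] normalizers_cnj[OF assms(1)] by (metis subset_iff vimageE)
qed

context
  fixes ss :: "'a list"
  assumes ss: "set ss \<subseteq> normalizers"
begin

lemma cnjs_mult: "cnjs ss (x * y) = cnjs ss x * cnjs ss y"
  using ss by (induction ss) (simp_all add: cnj_mult normalizers_sq)

lemma cnjs_one: "cnjs ss 1 = 1"
  using ss by (induction ss) (simp_all add: cnj_one normalizers_sq)

lemma cnjs_C: "x \<in> C \<Longrightarrow> cnjs ss x \<in> C"
  using ss by (induction ss) (simp_all add: normalizers_cnj)

lemma cnjs_rev: "cnjs (rev ss) (cnjs ss x) = x"
  using ss by (induction ss) (simp_all add: cnjs_append cnj_cnj normalizers_sq)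

lemma cnjs_rev': "cnjs ss (cnjs (rev ss) x) = x"
  using ss
proof (induction ss arbitrary: x)
  case (Cons a ss)
  then show ?case by (simp add: cnjs_append cnj_cnj normalizers_sq)
qed simp

lemma cnjs_prod_list: "cnjs ss (prod_list w) = prod_list (map (cnjs ss) w)"
  by (induction w) (simp_all add: cnjs_one cnjs_mult)

lemma cnjs_eq_iff: "cnjs ss x = cnjs ss y \<longleftrightarrow> x = y"
  by (metis cnjs_rev)

lemma gen_map_cnjs: "gen w \<Longrightarrow> gen (map (cnjs ss) w)"
  using ss
proof (induction ss)
  case (Cons s ss)
  then have "gen (map (cnj s) (map (cnjs ss) w))" by (intro gen_map_cnj) auto
  then show ?case by (simp add: comp_def)
qed simp

lemma braid_eq_map_cnjs: "w \<sim> w' \<Longrightarrow> map (cnjs ss) w \<sim> map (cnjs ss) w'"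
  using ss
proof (induction ss)
  case (Cons s ss)
  then have "map (cnj s) (map (cnjs ss) w) \<sim> map (cnj s) (map (cnjs ss) w')"
    by (intro braid_eq_map_cnj) (auto simp: normalizers_sq)
  then show ?case by (simp add: comp_def)
qed simp

end

lemma map_cnjs_rev:
  "set ss \<subseteq> normalizers \<Longrightarrow> map (cnjs (rev ss)) (map (cnjs ss) w) = w"
  by (simp add: comp_def cnjs_rev)

section \<open>Linking the possible first letters of a word\<close>

definition determined :: "nat \<Rightarrow> bool" where
  "determined n \<longleftrightarrow> (\<forall>w w'. gen w \<and> gen w' \<and> length w = n \<and> length w' = n
     \<and> prod_list w = prod_list w' \<longrightarrow> w \<sim> w')"

text \<open>\<open>v\<close> is the product of the whole words and \<open>n\<close> the length of
  their tails. The relation is vacuous for a first letter that no generating tail completes, which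
  is why \<open>linked_trans\<close> asks for a tail after the middle letter.\<close>

definition linked :: "nat \<Rightarrow> 'a \<Rightarrow> 'a \<Rightarrow> 'a \<Rightarrow> bool" where
  "linked n v a b \<longleftrightarrow> (\<forall>x y. gen x \<and> gen y \<and> length x = n \<and> length y = n
     \<and> prod_list x = a * v \<and> prod_list y = b * v \<longrightarrow> a # x \<sim> b # y)"

lemma linked_refl: "determined n \<Longrightarrow> linked n v a a"
  unfolding linked_def determined_def by (metis braid_eq.Cons)

lemma linked_sym: "linked n v a b \<Longrightarrow> linked n v b a"
  unfolding linked_def by (metis braid_eq.sym)

lemma linked_trans:
  assumes "linked n v a b" "linked n v b c" "gen x" "length x = n" "prod_list x = b * v"
  shows "linked n v a c"
  using assms unfolding linked_def by (metis braid_eq.trans)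

text \<open>The bridge is the word \<open>a # b # u\<close>: by \<open>determined n\<close> its tail
  \<open>b # u\<close> is equivalent to \<open>x\<close>, and after one swap the tail
  \<open>cnj b a # u\<close>, whose product is \<open>b * v\<close>, is equivalent to
  \<open>y\<close>.\<close>

lemma linked_edge:
  assumes det: "determined n" and ab: "a \<in> C" "b \<in> C"
    and u: "gen (b # u)" "gen (cnj b a # u)" "Suc (length u) = n" "prod_list u = b * (a * v)"
  shows "linked n v a b"
  unfolding linked_def
proof (intro allI impI; elim conjE)
  fix x y
  assume x: "gen x" "gen y" "length x = n" "length y = n" "prod_list x = a * v" "prod_list y = b * v"
  have "x \<sim> b # u"
    using det u x ab unfolding determined_def by (simp add: cancel)
  moreover have "cnj b a # u \<sim> y"
    using det u x ab unfolding determined_def by (simp add: cnj_def mult.assoc)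
  ultimately show "a # x \<sim> b # y"
    by (meson braid_eq.Cons braid_eq.swap braid_eq.trans)
qed

lemma determined_Suc:
  assumes "\<And>w. gen w \<Longrightarrow> length w = Suc n \<Longrightarrow> \<exists>a x. w \<sim> a # x \<and> gen x"
    and "\<And>v a b x y. a \<in> C \<Longrightarrow> b \<in> C \<Longrightarrow> gen x \<Longrightarrow> gen y \<Longrightarrow> length x = n \<Longrightarrow> length y = n
       \<Longrightarrow> prod_list x = a * v \<Longrightarrow> prod_list y = b * v \<Longrightarrow> linked n v a b"
  shows "determined (Suc n)"
  unfolding determined_def
proof (intro allI impI; elim conjE)
  fix w w' assume w: "gen w" "gen w'" "length w = Suc n" "length w' = Suc n" "prod_list w = prod_list w'"
  obtain a x where x: "w \<sim> a # x" "gen x" using assms(1) w by blast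
  obtain b y where y: "w' \<sim> b # y" "gen y" using assms(1) w by blast
  have C: "set (a # x) \<subseteq> C" "set (b # y) \<subseteq> C"
    using braid_eq_subset gen_subset w x y by metis+
  have l: "length x = n" "length y = n" using braid_eq_length[OF x(1)] braid_eq_length[OF y(1)] w by auto
  have p: "prod_list w = a * prod_list x" "prod_list w = b * prod_list y"
    using braid_eq_prod_list[OF x(1)] braid_eq_prod_list[OF y(1)] w gen_subset by auto
  then have "prod_list x = a * prod_list w" "prod_list y = b * prod_list w"
    using C cancel[of a "prod_list x"] cancel[of b "prod_list y"] by simp_all
  then have "a # x \<sim> b # y"
    using assms(2)[of a b x y "prod_list w"] C l x y unfolding linked_def by auto
  then show "w \<sim> w'" using x y by (meson braid_eq.sym braid_eq.trans)
qed

end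

section \<open>Semimonomial permutations of eighteen points\<close>

text \<open>The 18 points fall into six blocks, the orbits of the central subgroup of order 3, so an
  element of V is a permutation of the blocks with an entry of Z/3 for each. Enumeration types keep
  such products computable by rewriting.\<close>

datatype block = B1 | B2 | B3 | B4 | B5 | B6
datatype trit = T0 | T1 | T2
datatype pt = Pt block trit

text \<open>\<open>Semi f p1 \<dots> p6\<close> maps the point \<open>Pt Bi T0\<close> to \<open>pi\<close>; on the remaining points of each block
  it is determined by commuting with the cyclic shift of the trits, or by inverting it if \<open>f\<close> holds.\<close>

datatype semi = Semi bool pt pt pt pt pt pt

fun trit_add :: "trit \<Rightarrow> trit \<Rightarrow> trit" where
  "trit_add T0 y = y"
| "trit_add T1 T0 = T1" | "trit_add T1 T1 = T2" | "trit_add T1 T2 = T0"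
| "trit_add T2 T0 = T2" | "trit_add T2 T1 = T0" | "trit_add T2 T2 = T1"

fun trit_neg :: "trit \<Rightarrow> trit" where
  "trit_neg T0 = T0" | "trit_neg T1 = T2" | "trit_neg T2 = T1"

fun row :: "semi \<Rightarrow> block \<Rightarrow> pt" where
  "row (Semi f p1 p2 p3 p4 p5 p6) B1 = p1"
| "row (Semi f p1 p2 p3 p4 p5 p6) B2 = p2"
| "row (Semi f p1 p2 p3 p4 p5 p6) B3 = p3"
| "row (Semi f p1 p2 p3 p4 p5 p6) B4 = p4"
| "row (Semi f p1 p2 p3 p4 p5 p6) B5 = p5"
| "row (Semi f p1 p2 p3 p4 p5 p6) B6 = p6"

fun inverting :: "semi \<Rightarrow> bool" where
  "inverting (Semi f p1 p2 p3 p4 p5 p6) = f"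

fun shift :: "bool \<Rightarrow> trit \<Rightarrow> pt \<Rightarrow> pt" where
  "shift False e (Pt b d) = Pt b (trit_add d e)"
| "shift True e (Pt b d) = Pt b (trit_add d (trit_neg e))"

fun img :: "semi \<Rightarrow> pt \<Rightarrow> pt" where
  "img p (Pt b e) = shift (inverting p) e (row p b)"

fun xor :: "bool \<Rightarrow> bool \<Rightarrow> bool" where
  "xor False b = b" | "xor True b = (\<not> b)"

lemma trit_simps [simp]:
  "trit_add x T0 = x" "trit_neg (trit_neg x) = x"
  "trit_add (trit_add x y) z = trit_add x (trit_add y z)"
  "trit_neg (trit_add x y) = trit_add (trit_neg x) (trit_neg y)"
  by (cases x; cases y; cases z; simp)+

fun semi_mult :: "semi \<Rightarrow> semi \<Rightarrow> semi" where
  "semi_mult p (Semi f p1 p2 p3 p4 p5 p6) = Semi (xor (inverting p) f)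
     (img p p1) (img p p2) (img p p3) (img p p4) (img p p5) (img p p6)"

text \<open>\<open>img p\<close> turns a shift by \<open>e\<close> into a shift by \<open>e\<close>
  or by its negative, according to \<open>inverting p\<close>; hence the images of the
  \<open>T0\<close> points determine the rest.\<close>

lemma img_semi_mult: "img (semi_mult p q) x = img p (img q x)"
proof (cases p; cases q; cases x)
  fix f p1 p2 p3 p4 p5 p6 g q1 q2 q3 q4 q5 q6 b e
  assume h: "p = Semi f p1 p2 p3 p4 p5 p6" "q = Semi g q1 q2 q3 q4 q5 q6" "x = Pt b e"
  have r: "row (semi_mult p q) b = img p (row q b)"
    by (cases b) (simp_all add: h)
  obtain c d where cd: "row q b = Pt c d" by (cases "row q b")
  obtain c' d' where cd': "row p c = Pt c' d'" by (cases "row p c")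
  show ?thesis
    using r cd cd' h by (cases f; cases g) simp_all
qed

instantiation semi :: monoid_mult
begin

definition one_semi :: semi where
  "1 = Semi False (Pt B1 T0) (Pt B2 T0) (Pt B3 T0) (Pt B4 T0) (Pt B5 T0) (Pt B6 T0)"

definition times_semi :: "semi \<Rightarrow> semi \<Rightarrow> semi" where
  "times_semi = semi_mult"

instance
proof
  have row1: "row 1 b = Pt b T0" and inv1: "inverting 1 = False" for b
    by (cases b) (simp_all add: one_semi_def)
  have img1: "img 1 x = x" for x
    by (cases x) (simp add: row1 inv1)
  fix p q r :: semi
  show "p * q * r = p * (q * r)"
  proof (cases r)
    fix f p1 p2 p3 p4 p5 p6 assume r: "r = Semi f p1 p2 p3 p4 p5 p6"
    have "inverting (semi_mult p q) = xor (inverting p) (inverting q)" by (cases q) simp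
    moreover have "xor (xor a b) c = xor a (xor b c)" for a b c by (cases a; cases b) simp_all
    ultimately show ?thesis by (simp add: r times_semi_def img_semi_mult)
  qed
  show "1 * p = p" by (cases p) (simp add: img1 inv1 times_semi_def)
  show "p * 1 = p"
  proof (cases p)
    fix f p1 p2 p3 p4 p5 p6 assume p: "p = Semi f p1 p2 p3 p4 p5 p6"
    have "img p (Pt b T0) = row p b" for b
      by (cases "row p b"; cases f) (simp_all add: p)
    then show ?thesis
      by (simp add: one_semi_def times_semi_def) (simp add: p; cases f; simp)
  qed
qed

end

lemma img_times: "img (p * q) x = img p (img q x)"
  by (simp add: times_semi_def img_semi_mult)

section \<open>Tables\<close>

text \<open>\<open>iabcd\<close> is the involution of the Valentiner group over \<open>(a b)(c d)\<close>; \<open>odd_inv\<close> lies over the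
  transposition \<open>(5 6)\<close> and normalizes the Valentiner group.\<close>

definition i1234 :: semi where "i1234 = Semi False (Pt B2 T0) (Pt B1 T0) (Pt B4 T0) (Pt B3 T0) (Pt B5 T0) (Pt B6 T0)"
definition i1235 :: semi where "i1235 = Semi False (Pt B2 T1) (Pt B1 T2) (Pt B5 T0) (Pt B4 T0) (Pt B3 T0) (Pt B6 T0)"
definition i1236 :: semi where "i1236 = Semi False (Pt B2 T2) (Pt B1 T1) (Pt B6 T2) (Pt B4 T0) (Pt B5 T0) (Pt B3 T1)"
definition i1245 :: semi where "i1245 = Semi False (Pt B2 T2) (Pt B1 T1) (Pt B3 T0) (Pt B5 T0) (Pt B4 T0) (Pt B6 T0)"
definition i1246 :: semi where "i1246 = Semi False (Pt B2 T1) (Pt B1 T2) (Pt B3 T0) (Pt B6 T2) (Pt B5 T0) (Pt B4 T1)"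
definition i1256 :: semi where "i1256 = Semi False (Pt B2 T0) (Pt B1 T0) (Pt B3 T0) (Pt B4 T0) (Pt B6 T2) (Pt B5 T1)"
definition i1324 :: semi where "i1324 = Semi False (Pt B3 T2) (Pt B4 T2) (Pt B1 T1) (Pt B2 T1) (Pt B5 T0) (Pt B6 T0)"
definition i1325 :: semi where "i1325 = Semi False (Pt B3 T1) (Pt B5 T0) (Pt B1 T2) (Pt B4 T0) (Pt B2 T0) (Pt B6 T0)"
definition i1326 :: semi where "i1326 = Semi False (Pt B3 T0) (Pt B6 T0) (Pt B1 T0) (Pt B4 T0) (Pt B5 T0) (Pt B2 T0)"
definition i1345 :: semi where "i1345 = Semi False (Pt B3 T0) (Pt B2 T0) (Pt B1 T0) (Pt B5 T1) (Pt B4 T2) (Pt B6 T0)"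
definition i1346 :: semi where "i1346 = Semi False (Pt B3 T1) (Pt B2 T0) (Pt B1 T2) (Pt B6 T1) (Pt B5 T0) (Pt B4 T2)"
definition i1356 :: semi where "i1356 = Semi False (Pt B3 T2) (Pt B2 T0) (Pt B1 T1) (Pt B4 T0) (Pt B6 T0) (Pt B5 T0)"
definition i1423 :: semi where "i1423 = Semi False (Pt B4 T2) (Pt B3 T2) (Pt B2 T1) (Pt B1 T1) (Pt B5 T0) (Pt B6 T0)"
definition i1425 :: semi where "i1425 = Semi False (Pt B4 T0) (Pt B5 T1) (Pt B3 T0) (Pt B1 T0) (Pt B2 T2) (Pt B6 T0)"
definition i1426 :: semi where "i1426 = Semi False (Pt B4 T1) (Pt B6 T2) (Pt B3 T0) (Pt B1 T2) (Pt B5 T0) (Pt B2 T1)"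
definition i1435 :: semi where "i1435 = Semi False (Pt B4 T1) (Pt B2 T0) (Pt B5 T2) (Pt B1 T2) (Pt B3 T1) (Pt B6 T0)"
definition i1436 :: semi where "i1436 = Semi False (Pt B4 T0) (Pt B2 T0) (Pt B6 T0) (Pt B1 T0) (Pt B5 T0) (Pt B3 T0)"
definition i1456 :: semi where "i1456 = Semi False (Pt B4 T2) (Pt B2 T0) (Pt B3 T0) (Pt B1 T1) (Pt B6 T1) (Pt B5 T2)"
definition i1523 :: semi where "i1523 = Semi False (Pt B5 T1) (Pt B3 T0) (Pt B2 T0) (Pt B4 T0) (Pt B1 T2) (Pt B6 T0)"
definition i1524 :: semi where "i1524 = Semi False (Pt B5 T0) (Pt B4 T1) (Pt B3 T0) (Pt B2 T2) (Pt B1 T0) (Pt B6 T0)"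
definition i1526 :: semi where "i1526 = Semi False (Pt B5 T2) (Pt B6 T1) (Pt B3 T0) (Pt B4 T0) (Pt B1 T1) (Pt B2 T2)"
definition i1534 :: semi where "i1534 = Semi False (Pt B5 T2) (Pt B2 T0) (Pt B4 T1) (Pt B3 T2) (Pt B1 T1) (Pt B6 T0)"
definition i1536 :: semi where "i1536 = Semi False (Pt B5 T0) (Pt B2 T0) (Pt B6 T1) (Pt B4 T0) (Pt B1 T0) (Pt B3 T2)"
definition i1546 :: semi where "i1546 = Semi False (Pt B5 T1) (Pt B2 T0) (Pt B3 T0) (Pt B6 T0) (Pt B1 T2) (Pt B4 T0)"
definition i1623 :: semi where "i1623 = Semi False (Pt B6 T2) (Pt B3 T1) (Pt B2 T2) (Pt B4 T0) (Pt B5 T0) (Pt B1 T1)"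
definition i1624 :: semi where "i1624 = Semi False (Pt B6 T0) (Pt B4 T0) (Pt B3 T0) (Pt B2 T0) (Pt B5 T0) (Pt B1 T0)"
definition i1625 :: semi where "i1625 = Semi False (Pt B6 T1) (Pt B5 T2) (Pt B3 T0) (Pt B4 T0) (Pt B2 T1) (Pt B1 T2)"
definition i1634 :: semi where "i1634 = Semi False (Pt B6 T1) (Pt B2 T0) (Pt B4 T2) (Pt B3 T1) (Pt B5 T0) (Pt B1 T2)"
definition i1635 :: semi where "i1635 = Semi False (Pt B6 T0) (Pt B2 T0) (Pt B5 T1) (Pt B4 T0) (Pt B3 T2) (Pt B1 T0)"
definition i1645 :: semi where "i1645 = Semi False (Pt B6 T2) (Pt B2 T0) (Pt B3 T0) (Pt B5 T2) (Pt B4 T1) (Pt B1 T1)"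
definition i2345 :: semi where "i2345 = Semi False (Pt B1 T0) (Pt B3 T1) (Pt B2 T2) (Pt B5 T2) (Pt B4 T1) (Pt B6 T0)"
definition i2346 :: semi where "i2346 = Semi False (Pt B1 T0) (Pt B3 T0) (Pt B2 T0) (Pt B6 T0) (Pt B5 T0) (Pt B4 T0)"
definition i2356 :: semi where "i2356 = Semi False (Pt B1 T0) (Pt B3 T2) (Pt B2 T1) (Pt B4 T0) (Pt B6 T1) (Pt B5 T2)"
definition i2435 :: semi where "i2435 = Semi False (Pt B1 T0) (Pt B4 T0) (Pt B5 T1) (Pt B2 T0) (Pt B3 T2) (Pt B6 T0)"
definition i2436 :: semi where "i2436 = Semi False (Pt B1 T0) (Pt B4 T1) (Pt B6 T1) (Pt B2 T2) (Pt B5 T0) (Pt B3 T2)"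
definition i2456 :: semi where "i2456 = Semi False (Pt B1 T0) (Pt B4 T2) (Pt B3 T0) (Pt B2 T1) (Pt B6 T0) (Pt B5 T0)"
definition i2534 :: semi where "i2534 = Semi False (Pt B1 T0) (Pt B5 T2) (Pt B4 T2) (Pt B3 T1) (Pt B2 T1) (Pt B6 T0)"
definition i2536 :: semi where "i2536 = Semi False (Pt B1 T0) (Pt B5 T1) (Pt B6 T0) (Pt B4 T0) (Pt B2 T2) (Pt B3 T0)"
definition i2546 :: semi where "i2546 = Semi False (Pt B1 T0) (Pt B5 T0) (Pt B3 T0) (Pt B6 T1) (Pt B2 T0) (Pt B4 T2)"
definition i2634 :: semi where "i2634 = Semi False (Pt B1 T0) (Pt B6 T1) (Pt B4 T1) (Pt B3 T2) (Pt B5 T0) (Pt B2 T2)"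
definition i2635 :: semi where "i2635 = Semi False (Pt B1 T0) (Pt B6 T2) (Pt B5 T2) (Pt B4 T0) (Pt B3 T1) (Pt B2 T1)"
definition i2645 :: semi where "i2645 = Semi False (Pt B1 T0) (Pt B6 T0) (Pt B3 T0) (Pt B5 T1) (Pt B4 T2) (Pt B2 T0)"
definition i3456 :: semi where "i3456 = Semi False (Pt B1 T0) (Pt B2 T0) (Pt B4 T0) (Pt B3 T0) (Pt B6 T2) (Pt B5 T1)"
definition i3546 :: semi where "i3546 = Semi False (Pt B1 T0) (Pt B2 T0) (Pt B5 T0) (Pt B6 T2) (Pt B3 T0) (Pt B4 T1)"
definition i3645 :: semi where "i3645 = Semi False (Pt B1 T0) (Pt B2 T0) (Pt B6 T2) (Pt B5 T0) (Pt B4 T0) (Pt B3 T1)"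
definition odd_inv :: semi where "odd_inv = Semi True (Pt B1 T0) (Pt B2 T0) (Pt B3 T1) (Pt B4 T1) (Pt B6 T0) (Pt B5 T0)"
definition involutions :: "semi list" where
  "involutions = [i1234, i1235, i1236, i1245, i1246, i1256, i1324, i1325, i1326, i1345, i1346,
  i1356, i1423, i1425, i1426, i1435, i1436, i1456, i1523, i1524, i1526, i1534, i1536, i1546,
  i1623, i1624, i1625, i1634, i1635, i1645, i2345, i2346, i2356, i2435, i2436, i2456, i2534,
  i2536, i2546, i2634, i2635, i2645, i3456, i3546, i3645]"
text \<open>Representatives under conjugation by V and odd elements. \<open>rep0\<close> is 1,
  \<open>rep1\<close> is central of order 3, \<open>rep2\<close> is an involution and
  \<open>rep3\<close> its central multiple of order 6. \<open>rep4\<close> and \<open>rep5\<close>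
  lie over the two cycle types of order 3, \<open>rep6\<close> (order 4) and \<open>rep7\<close>
  (order 12) over a 4-cycle times a transposition, \<open>rep8\<close> (order 5),
  \<open>rep9\<close> and \<open>rep10\<close> (order 15) over 5-cycles; the fifth powers of the
  last two are \<open>z1\<close> and \<open>z2\<close>.\<close>

definition rep0 :: semi where "rep0 = Semi False (Pt B1 T0) (Pt B2 T0) (Pt B3 T0) (Pt B4 T0) (Pt B5 T0) (Pt B6 T0)"
definition rep1 :: semi where "rep1 = Semi False (Pt B1 T1) (Pt B2 T1) (Pt B3 T1) (Pt B4 T1) (Pt B5 T1) (Pt B6 T1)"
definition rep2 :: semi where "rep2 = Semi False (Pt B2 T0) (Pt B1 T0) (Pt B4 T0) (Pt B3 T0) (Pt B5 T0) (Pt B6 T0)"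
definition rep3 :: semi where "rep3 = Semi False (Pt B2 T1) (Pt B1 T1) (Pt B4 T1) (Pt B3 T1) (Pt B5 T1) (Pt B6 T1)"
definition rep4 :: semi where "rep4 = Semi False (Pt B1 T1) (Pt B2 T2) (Pt B4 T0) (Pt B6 T2) (Pt B5 T0) (Pt B3 T1)"
definition rep5 :: semi where "rep5 = Semi False (Pt B4 T0) (Pt B6 T1) (Pt B1 T1) (Pt B3 T2) (Pt B2 T2) (Pt B5 T0)"
definition rep6 :: semi where "rep6 = Semi False (Pt B2 T2) (Pt B4 T1) (Pt B6 T0) (Pt B5 T0) (Pt B1 T0) (Pt B3 T0)"
definition rep7 :: semi where "rep7 = Semi False (Pt B4 T0) (Pt B3 T2) (Pt B2 T0) (Pt B6 T1) (Pt B1 T0) (Pt B5 T0)"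
definition rep8 :: semi where "rep8 = Semi False (Pt B3 T0) (Pt B5 T1) (Pt B4 T0) (Pt B2 T0) (Pt B1 T2) (Pt B6 T0)"
definition rep9 :: semi where "rep9 = Semi False (Pt B1 T2) (Pt B3 T1) (Pt B6 T0) (Pt B5 T0) (Pt B2 T0) (Pt B4 T0)"
definition rep10 :: semi where "rep10 = Semi False (Pt B5 T0) (Pt B2 T1) (Pt B6 T0) (Pt B1 T2) (Pt B3 T0) (Pt B4 T0)"

text \<open>\<open>i1234\<close> followed by its first two conjugates under the generator over
  \<open>s2\<close>.\<close>

definition base_triple :: "semi list" where "base_triple = [i1234,i1526,i1345]"
text \<open>A pair \<open>(x, y)\<close> adds \<open>cnj y x\<close>: there are 42 steps, one for
  each involution outside \<open>base_triple\<close>. The lists \<open>root_steps7\<close>,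
  \<open>root_steps9\<close> and \<open>root_steps10\<close> lead from the roots of the triples to
  \<open>base_triple\<close>.\<close>

definition base_steps :: "(semi \<times> semi) list" where
  "base_steps = [(i1234,i1526), (i1234,i1345), (i1526,i1234), (i1526,i1345), (i1345,i1234),
  (i1345,i1526), (i1234,i2634), (i1234,i2435), (i1234,i1435), (i1526,i1523), (i1526,i2435),
  (i1345,i3456), (i1345,i1625), (i3456,i1345), (i3456,i1523), (i3456,i2634), (i3456,i2435),
  (i1523,i1625), (i1625,i1523), (i1625,i2634), (i1625,i1435), (i2634,i1625), (i2634,i2435),
  (i2435,i1625), (i2435,i2634), (i2435,i1435), (i1435,i1523), (i1234,i1346), (i1234,i2436),
  (i1234,i2635), (i1234,i1356), (i1234,i2346), (i1234,i2345), (i1526,i1425), (i1526,i1624),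
  (i1345,i1634), (i1345,i1546), (i3456,i2346), (i1523,i1356), (i1523,i1245), (i2634,i3645),
  (i1536,i2534)]"
definition root_steps7 :: "(semi \<times> semi) list" where
  "root_steps7 = [(i1346,i1236), (i1346,i1356), (i1236,i1346), (i2634,i1345), (i1423,i1356)]"
definition root_steps9 :: "(semi \<times> semi) list" where
  "root_steps9 = [(i1526,i1245), (i1623,i1526), (i1526,i2536), (i1624,i2536), (i1245,i1235)]"
definition root_steps10 :: "(semi \<times> semi) list" where
  "root_steps10 = [(i1235,i1326), (i1326,i1235), (i1326,i2346), (i1536,i2346), (i1625,i1234),
  (i1235,i1524)]"


text \<open>Entry \<open>(k, ss)\<close> of \<open>class_rowj\<close> at the position of the involution \<open>c\<close> expresses \<open>c * repj\<close> as the
  conjugate of the representative \<open>k\<close> by \<open>ss\<close>.\<close>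

definition class_row0 :: "(semi \<times> semi list) list" where
  "class_row0 = [(rep2, []), (rep2, [i1245]), (rep2, [i1246]), (rep2, [i1235]), (rep2, [i1236]),
  (rep2, [i3546]), (rep2, [i1456]), (rep2, [i2345]), (rep2, [i2346]), (rep2, [i1425]), (rep2,
  [i1426]), (rep2, [i2346,i1235]), (rep2, [i1356]), (rep2, [i2435]), (rep2, [i2436]), (rep2,
  [i1325]), (rep2, [i1326]), (rep2, [i1526,i1235]), (rep2, [i1345]), (rep2, [i1435]), (rep2,
  [i2546,i1235]), (rep2, [i2534]), (rep2, [i2546]), (rep2, [i2536]), (rep2, [i1346]), (rep2,
  [i1436]), (rep2, [i1546,i1235]), (rep2, [i2634]), (rep2, [i2645]), (rep2, [i2635]), (rep2,
  [i1524]), (rep2, [i1624]), (rep2, [i1346,i1235]), (rep2, [i1523]), (rep2, [i1623]), (rep2,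
  [i1625,i1235]), (rep2, [i1534]), (rep2, [i1546]), (rep2, [i1536]), (rep2, [i1634]), (rep2,
  [i1645]), (rep2, [i1635]), (rep2, [i1526]), (rep2, [i1325,i1236]), (rep2, [i1326,i1235])]"

definition class_row1 :: "(semi \<times> semi list) list" where
  "class_row1 = [(rep3, []), (rep3, [i1245]), (rep3, [i1246]), (rep3, [i1235]), (rep3, [i1236]),
  (rep3, [i3546]), (rep3, [i1456]), (rep3, [i2345]), (rep3, [i2346]), (rep3, [i1425]), (rep3,
  [i1426]), (rep3, [i2346,i1235]), (rep3, [i1356]), (rep3, [i2435]), (rep3, [i2436]), (rep3,
  [i1325]), (rep3, [i1326]), (rep3, [i1526,i1235]), (rep3, [i1345]), (rep3, [i1435]), (rep3,
  [i2546,i1235]), (rep3, [i2534]), (rep3, [i2546]), (rep3, [i2536]), (rep3, [i1346]), (rep3,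
  [i1436]), (rep3, [i1546,i1235]), (rep3, [i2634]), (rep3, [i2645]), (rep3, [i2635]), (rep3,
  [i1524]), (rep3, [i1624]), (rep3, [i1346,i1235]), (rep3, [i1523]), (rep3, [i1623]), (rep3,
  [i1625,i1235]), (rep3, [i1534]), (rep3, [i1546]), (rep3, [i1536]), (rep3, [i1634]), (rep3,
  [i1645]), (rep3, [i1635]), (rep3, [i1526]), (rep3, [i1325,i1236]), (rep3, [i1326,i1235])]"

definition class_row2 :: "(semi \<times> semi list) list" where
  "class_row2 = [(rep0, []), (rep4, [i1256]), (rep4, []), (rep4, [i3456]), (rep4, [i1234]), (rep2,
  [i1526]), (rep2, [i1356]), (rep8, [odd_inv,i1256]), (rep8, [i1256]), (rep8,
  [odd_inv,i2356,i1235]), (rep8, [i2356,i1235]), (rep6, [i1245,i1234]), (rep2, [i1456]), (rep8,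
  [i1234]), (rep8, [odd_inv,i1234]), (rep8, [i1324]), (rep8, [odd_inv,i1324]), (rep6,
  [i2345,i1234]), (rep8, []), (rep8, [odd_inv,i3456]), (rep6, [i2536,i1234]), (rep4,
  [i1324,i1256]), (rep5, [i2435]), (rep5, [i2634,i1234]), (rep8, [odd_inv]), (rep8, [i3456]),
  (rep6, [i1546]), (rep4, [i1324]), (rep5, [i1624,i1245]), (rep5, [i1546,i1235]), (rep8, [i1423]),
  (rep8, [odd_inv,i1423]), (rep6, [i1435]), (rep8, [odd_inv,i1635,i1236]), (rep8, [i1635,i1236]),
  (rep6, [i1235]), (rep4, [i1423,i1256]), (rep5, [i1634]), (rep5, [i1345,i1234]), (rep4, [i1423]),
  (rep5, [i1456,i1235]), (rep5, [i2435,i1245]), (rep2, [i3546]), (rep6, [i1326]), (rep6,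
  [i1624,i1234])]"

definition class_row3 :: "(semi \<times> semi list) list" where
  "class_row3 = [(rep1, []), (rep4, [i1436,i1345]), (rep4, [i2534,i1234]), (rep4, [i2634,i1256]),
  (rep4, [i1534]), (rep3, [i1526]), (rep3, [i1356]), (rep10, [i1635,i1234]), (rep9,
  [odd_inv,i2645,i1234]), (rep10, [i1623,i1234]), (rep9, [odd_inv,i1426,i1234]), (rep7,
  [i1546,i1234]), (rep3, [i1456]), (rep9, [odd_inv,i1325,i1245]), (rep10, [i1524,i1235]), (rep9,
  [odd_inv,i1534]), (rep10, [i2534]), (rep7, [i1635,i1256]), (rep9, [odd_inv,i1425,i1235]),
  (rep10, [i2645]), (rep7, [i1325,i1234]), (rep4, [i1426,i1235]), (rep5, [i1425,i1235]), (rep5,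
  [i2346,i1236]), (rep10, [i1536,i1235]), (rep9, [odd_inv,i1635]), (rep7, [i1524]), (rep4,
  [i1325,i1245]), (rep5, [i1534]), (rep5, [i1436,i1234]), (rep9, [odd_inv,i2534,i1234]), (rep10,
  [i1534,i1234]), (rep7, [i1624,i1235]), (rep10, [i1426]), (rep9, [odd_inv,i1623]), (rep7,
  [i2536]), (rep4, [i1326,i1245]), (rep5, [i1523,i1236]), (rep5, [i1325,i1245]), (rep4,
  [i1425,i1235]), (rep5, [i2346]), (rep5, [i2534,i1234]), (rep3, [i3546]), (rep7, [i1346]), (rep7,
  [i2436,i1234])]"

definition class_row4 :: "(semi \<times> semi list) list" where
  "class_row4 = [(rep2, [i1236]), (rep6, [i1423,i1246]), (rep2, []), (rep6, [i1624,i1234]), (rep2,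
  [i1246]), (rep6, [i1623]), (rep8, [i2456]), (rep7, [i1524,i1324]), (rep8, [odd_inv]), (rep9,
  [i1256]), (rep4, [i1436]), (rep10, [odd_inv,i1546]), (rep8, [odd_inv,i1325]), (rep7,
  [i1546,i1345]), (rep8, [i1356]), (rep10, [odd_inv,i1436]), (rep4, [i1634]), (rep9,
  [i1634,i1234]), (rep7, [odd_inv,i2356,i1235]), (rep7, [odd_inv,i2346,i1234]), (rep7,
  [odd_inv,i1326]), (rep3, [odd_inv,i2635]), (rep3, [odd_inv,i2634]), (rep3, [odd_inv,i2645]),
  (rep8, [i1256]), (rep8, [odd_inv,i1524]), (rep7, [i1435]), (rep4, [i1346]), (rep9,
  [i1435,i1234]), (rep10, [odd_inv]), (rep9, [odd_inv]), (rep4, [i2436]), (rep10, [i2345,i1234]),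
  (rep10, [i2634,i1234]), (rep4, [i2634]), (rep9, [odd_inv,i2346]), (rep3, [i1536]), (rep3,
  [i1534]), (rep3, [i1546]), (rep4, [i2346]), (rep9, [odd_inv,i2536]), (rep10, [i1256]), (rep4,
  [i3546]), (rep4, [i3645]), (rep4, [i3456])]"

definition class_row5 :: "(semi \<times> semi list) list" where
  "class_row5 = [(rep10, [odd_inv,i1423,i1235]), (rep5, [i1246]), (rep7, []), (rep6,
  [i1635,i1236]), (rep5, [i3546]), (rep9, [i1635]), (rep8, [i1624,i1236]), (rep3,
  [odd_inv,i2435]), (rep3, [i1526,i1235]), (rep9, [odd_inv,i1324]), (rep10,
  [odd_inv,i1324,i1235]), (rep2, [i2435]), (rep9, [odd_inv,i2536]), (rep2, [i1634]), (rep3,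
  [odd_inv,i1526]), (rep10, [odd_inv,i1246]), (rep8, [i1634,i1234]), (rep3, [i1534]), (rep7,
  [odd_inv,i1345,i1236]), (rep5, [i2436]), (rep8, [odd_inv,i2634]), (rep8, [i1346,i1234]), (rep5,
  [i1524]), (rep7, [i1236]), (rep5, [i1645]), (rep7, [odd_inv,i1345]), (rep10, [i1536,i1234]),
  (rep9, [odd_inv,i1624,i1234]), (rep6, [i1236]), (rep5, [i2345]), (rep5, [i1623]), (rep6,
  [i1526,i1234]), (rep10, [i1634,i1234]), (rep7, [i2435]), (rep5, [i1536]), (rep8,
  [odd_inv,i1456]), (rep3, [i2346]), (rep8, [odd_inv,i1325]), (rep9, [i1325,i1245]), (rep2,
  [i2346,i1235]), (rep9, [i1634,i1234]), (rep10, [i1645]), (rep3, [odd_inv,i2346]), (rep5,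
  [i1235]), (rep7, [odd_inv,i1423,i1235])]"

definition class_row6 :: "(semi \<times> semi list) list" where
  "class_row6 = [(rep9, []), (rep10, [i1245]), (rep4, [i1623,i1256]), (rep2, [i1546]), (rep9,
  [odd_inv,i2546]), (rep10, [odd_inv,i3645,i1234]), (rep10, [odd_inv,i1346]), (rep7,
  [odd_inv,i1236,i1234]), (rep7, [i2346,i1234]), (rep9, [i1425]), (rep5, [i1625,i1234]), (rep7,
  [i1534,i1234]), (rep7, [i2534]), (rep6, [i1245]), (rep7, [odd_inv,i1623,i1234]), (rep7,
  [i2536,i1235]), (rep2, [i1235]), (rep7, [odd_inv,i1346]), (rep9, [odd_inv,i1634]), (rep2,
  [i1326]), (rep9, [i1526]), (rep10, [odd_inv,i1623,i1234]), (rep4, [i1623]), (rep10, [i2536]),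
  (rep7, [odd_inv,i1326,i1245]), (rep10, [i1436]), (rep7, [i1634]), (rep5, [i1634,i1236]), (rep7,
  [odd_inv,i1635,i1256]), (rep9, [odd_inv,i2435,i1234]), (rep10, [i1524]), (rep7,
  [odd_inv,i1524,i1324]), (rep5, [i1236]), (rep9, [odd_inv,i1345,i1234]), (rep4, [i1326,i1256]),
  (rep9, [i1234]), (rep7, [odd_inv,i3456,i1235]), (rep2, [i1435]), (rep7, [i3645,i1234]), (rep7,
  [i2346]), (rep5, [i1425,i1236]), (rep10, [odd_inv,i1456,i1234]), (rep7, [i2436]), (rep7,
  [odd_inv,i2456]), (rep4, [i1623,i1245])]"

definition class_row7 :: "(semi \<times> semi list) list" where
  "class_row7 = [(rep6, [i1436,i1234]), (rep6, [i2356,i1236]), (rep5, []), (rep7,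
  [odd_inv,i1423,i1235]), (rep9, [i2456,i1235]), (rep10, [odd_inv,i1625]), (rep7,
  [odd_inv,i1356]), (rep7, [odd_inv,i1346,i1234]), (rep5, [i1645]), (rep6, [i2534]), (rep8,
  [i1546,i1235]), (rep8, [odd_inv,i1635,i1236]), (rep4, [i1425,i1423]), (rep8, [i1623,i1235]),
  (rep10, [odd_inv,i1235]), (rep9, [i2356]), (rep8, [odd_inv,i1634]), (rep3, [i1524]), (rep4,
  [i2435,i1324]), (rep8, [odd_inv,i1435]), (rep9, [i1325,i1236]), (rep10, [odd_inv,i1526]), (rep8,
  [i3456]), (rep3, [i1346]), (rep3, [i1526,i1235]), (rep6, [i1245,i1234]), (rep6, [i1634]), (rep7,
  [odd_inv,i1536,i1256]), (rep7, [odd_inv,i1324]), (rep7, [i1456]), (rep3, [i2536]), (rep4,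
  [i1435]), (rep4, [i1326,i1256]), (rep5, [i2435]), (rep7, [odd_inv,i2456]), (rep8, [i1435]),
  (rep5, [i1236]), (rep7, [odd_inv,i1524,i1234]), (rep8, [odd_inv,i1246]), (rep6, [i2346]), (rep6,
  [i2436]), (rep7, [odd_inv,i3456,i1235]), (rep9, [i2634,i1234]), (rep10, [odd_inv,i1456,i1234]),
  (rep6, [i1635,i1236])]"

definition class_row8 :: "(semi \<times> semi list) list" where
  "class_row8 = [(rep2, [i2435]), (rep8, [odd_inv,i1256]), (rep7, [i1435]), (rep8,
  [odd_inv,i1356,i1234]), (rep7, [odd_inv,i1436]), (rep5, [i1346,i1235]), (rep4, [i2456]), (rep4,
  [i1256]), (rep8, [odd_inv,i1625]), (rep2, [i1523]), (rep10, [odd_inv,i1256]), (rep9,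
  [odd_inv,i2536]), (rep8, [odd_inv,i1456]), (rep2, [i1425]), (rep7, [i2534,i1234]), (rep8,
  [odd_inv,i2456,i1234]), (rep5, [i1423,i1236]), (rep7, [odd_inv,i1245]), (rep2, []), (rep4,
  [i1524,i1256]), (rep9, [odd_inv,i1426,i1235]), (rep4, [i1325,i1256]), (rep10,
  [odd_inv,i1623,i1245]), (rep8, [odd_inv,i1423]), (rep7, [odd_inv,i1456,i1245]), (rep8,
  [odd_inv,i3546,i1234]), (rep10, [odd_inv,i1546]), (rep9, [odd_inv,i1623,i1235]), (rep5,
  [i2635,i1324]), (rep7, [i3456]), (rep8, [odd_inv,i2356]), (rep5, [i2634,i1234]), (rep7,
  [i1456,i1245]), (rep2, [i1345]), (rep9, [odd_inv,i1423]), (rep10, [odd_inv,i1423,i1235]), (rep4,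
  [i1356]), (rep8, [odd_inv,i1526]), (rep9, [odd_inv,i1256]), (rep10, [odd_inv,i1423]), (rep7,
  [odd_inv,i2356,i1235]), (rep5, [i2436,i1234]), (rep8, [odd_inv,i3645,i1234]), (rep7,
  [i1526,i1235]), (rep7, [odd_inv,i1534])]"

definition class_row9 :: "(semi \<times> semi list) list" where
  "class_row9 = [(rep6, []), (rep5, [i2634,i1234]), (rep10, [i1523]), (rep8,
  [odd_inv,i2346,i1235]), (rep10, [odd_inv,i2546]), (rep7, [i2436]), (rep7, [i2534]), (rep8,
  [odd_inv,i1423]), (rep5, [i1635]), (rep10, [odd_inv,i2435]), (rep10, [i1624,i1234]), (rep6,
  [i1234]), (rep10, [odd_inv,i1346]), (rep10, [i1425]), (rep7, [i2356]), (rep6, [i2635,i1236]),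
  (rep8, [odd_inv,i1236,i1234]), (rep5, [i3456,i1236]), (rep10, []), (rep5, [i2356,i1245]), (rep6,
  [i1526]), (rep7, [i2645]), (rep10, [odd_inv,i2356]), (rep8, [odd_inv,i1256]), (rep8,
  [odd_inv,i2635]), (rep6, [i1356,i1234]), (rep10, [odd_inv,i2634]), (rep5, [i2534,i1245]), (rep7,
  [i3546]), (rep10, [i1435,i1234]), (rep4, [i2435,i1245]), (rep4, [i1256]), (rep3,
  [odd_inv,i1326,i1235]), (rep10, [odd_inv,i2546,i1234]), (rep3, [odd_inv,i1536]), (rep10,
  [odd_inv,i2356,i1234]), (rep3, [odd_inv,i1523]), (rep4, [i2546,i1235]), (rep4, [i2634,i1234]),
  (rep10, [odd_inv,i2634,i1234]), (rep10, [odd_inv,i2435,i1234]), (rep3, [odd_inv,i1346,i1235]),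
  (rep10, [odd_inv,i3645,i1234]), (rep3, [odd_inv,i1634]), (rep4, [i2345,i1234])]"

definition class_row10 :: "(semi \<times> semi list) list" where
  "class_row10 = [(rep6, [i1245]), (rep8, [odd_inv,i1423]), (rep9, [odd_inv,i1345]), (rep5,
  [i1645]), (rep9, [i1326,i1234]), (rep7, [odd_inv,i1526]), (rep7, [odd_inv,i1236]), (rep5,
  [i2634,i1234]), (rep6, [i1635,i1236]), (rep9, [odd_inv,i1345,i1234]), (rep3, [i2534]), (rep9,
  [odd_inv,i1536,i1234]), (rep9, [odd_inv,i1456]), (rep9, [i1425]), (rep8, [odd_inv,i1246,i1234]),
  (rep4, [i1534,i1235]), (rep4, [i1435,i1234]), (rep3, [i2645]), (rep9, []), (rep8,
  [odd_inv,i1645]), (rep9, [odd_inv,i2356]), (rep3, [i1326,i1235]), (rep4, [i1345,i1235]), (rep4,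
  [i1256]), (rep7, [odd_inv,i1423,i1235]), (rep5, [i1325,i1324]), (rep6, [i1235,i1234]), (rep9,
  [odd_inv,i3546,i1234]), (rep3, [i1426]), (rep9, [odd_inv,i1634,i1234]), (rep6, [i1346,i1236]),
  (rep8, [odd_inv,i1256]), (rep5, [i1236,i1234]), (rep9, [odd_inv,i1634]), (rep9, [i2345,i1234]),
  (rep6, [i1436,i1235]), (rep7, [odd_inv,i1625]), (rep8, [odd_inv,i1624,i1236]), (rep9,
  [odd_inv,i1536]), (rep5, [odd_inv,i1245]), (rep9, [i1523]), (rep7, [odd_inv,i1426,i1234]),
  (rep9, [odd_inv,i1346,i1234]), (rep4, [i1634,i1234]), (rep3, [i1526,i1235])]"

text \<open>A row \<open>(r, S, cs)\<close> consists of a word \<open>r\<close> whose entries preserve the set of points \<open>S\<close>, and for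
  every involution \<open>d\<close> that does not preserve \<open>S\<close> of braid moves after which \<open>d # r\<close> ends in a conjugate
  of the word \<open>r'\<close> of a later row, or in three letters with product in \<open>lev3\<close> if \<open>r' = []\<close>.  Since a
  generating word has letters outside every such stabilizer, one can climb until \<open>lev3\<close> is reached.\<close>

definition ascent_table :: "(semi list \<times> pt list \<times> (nat list \<times> semi list \<times> semi list) list) list" where
  "ascent_table = [
   ([], [Pt B5 T0],  [([],[i1234],[i1245]), ([],[i1234],[i1235]), ([],[i1234],[i3546]),
   ([],[i1234],[i2345]), ([],[i1234],[i1425]), ([],[i1234],[i2346,i1235]), ([],[i1234],[i2435]),
   ([],[i1234],[i1325]), ([],[i1234],[i1526,i1235]), ([],[i1234],[i1345]), ([],[i1234],[i1435]),
   ([],[i1234],[i2546,i1235]), ([],[i1234],[i2534]), ([],[i1234],[i2546]), ([],[i1234],[i2536]),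
   ([],[i1234],[i1546,i1235]), ([],[i1234],[i2645]), ([],[i1234],[i2635]), ([],[i1234],[i1524]),
   ([],[i1234],[i1346,i1235]), ([],[i1234],[i1523]), ([],[i1234],[i1625,i1235]),
   ([],[i1234],[i1534]), ([],[i1234],[i1546]), ([],[i1234],[i1536]), ([],[i1234],[i1645]),
   ([],[i1234],[i1635]), ([],[i1234],[i1526]), ([],[i1234],[i1325,i1236]),
   ([],[i1234],[i1326,i1235])]),
   ([i1234], [Pt B6 T2],  [([],[i1234,i1235],[i1256,i1245]), ([],[i1234,i1235],[i3546,i1236]),
   ([],[i1234,i1256],[i3546]), ([],[i1234,i1325],[odd_inv,i2345]),
   ([],[i1234,i1325],[odd_inv,i2345,i1235]), ([],[i1234,i1526],[i2345,i1236]),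
   ([],[i1234,i1325],[i3456,i2345]), ([],[i1234,i1325],[i2456,i1245]),
   ([],[i1234,i1526],[i2435,i1246]), ([],[i1234,i1356],[i1645,i1236]), ([],[i1234,i1536],[i2546]),
   ([],[i1234,i1536],[i2634,i1345]), ([],[i1234,i1325],[i1356,i1245]),
   ([],[i1234,i1325],[odd_inv,i1435,i1234]), ([],[i1234,i1356],[i1546,i1235]),
   ([],[i1234,i1235],[i2546,i1326]), ([],[i1234,i1536],[i2645,i1324]),
   ([],[i1234,i1536],[i2436,i2345]), ([],[i1234,i1325],[i1456,i1345]),
   ([],[i1234,i1526],[i1346,i1235]), ([],[i1234,i1325],[odd_inv,i1523,i1423]),
   ([],[i1234,i1526],[i1436,i1245]), ([],[i1234,i1536],[i1623,i1245]),
   ([],[i1234,i1536],[i1536,i1234]), ([],[i1234,i1235],[i1623,i1456]),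
   ([],[i1234,i1536],[i1645,i1256]), ([],[i1234,i1536],[i1635,i1423]),
   ([],[i1234,i1256],[i1526,i1324]), ([],[i1234,i1356],[i1624,i1245]),
   ([],[i1234,i1356],[i1524,i1246])]),
   ([i1234,i1256], [Pt B4 T0, Pt B5 T2, Pt B2 T2, Pt B1 T2, Pt B3 T0, Pt B6 T1],
   [([0],[i1234,i1235],[i1236,i1235]), ([0],[i1234,i1235],[i1236]),
   ([0],[i1234,i1235],[i3456,i1236]), ([0],[i1234,i1235],[i1246,i1234]),
   ([0],[i1234,i1356],[i2356]), ([0],[i1234,i1325],[i1436,i1423]),
   ([0],[i1234,i1536],[i1435,i1245]), ([0],[i1234,i1235],[i1526,i1236]),
   ([0],[i1234,i1356],[i1345,i1245]), ([0],[i1234,i1325],[i3546,i2345]),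
   ([0],[i1234,i1536],[i1356,i1235]), ([0],[i1234,i1235],[i2346,i1524]),
   ([0],[i1234,i1325],[i1536,i1235]), ([1,0],[i1234,i1356],[i1645,i1236]),
   ([0],[i1234,i1526],[i1534,i1234]), ([0],[i1234,i1325],[odd_inv,i1536,i1346]),
   ([0],[i1234,i1325],[i1634,i1236]), ([1,0],[i1234,i1356],[i1546,i1235]),
   ([0],[i1234,i1526],[i1634]), ([0],[i1234,i1325],[odd_inv,i1536]),
   ([0],[i1234,i1536],[i2634,i2356]), ([0],[i1234,i1235],[i1625,i1236]),
   ([0],[i1234,i1536],[i1425,i1423]), ([0],[i1234,i1235],[i2536,i1346]),
   ([0],[i1234,i1526],[i2534]), ([0],[i1234,i1325],[odd_inv,i2635,i1256]),
   ([0],[i1234,i1526],[i2634,i1234]), ([0],[i1234,i1325],[odd_inv,i2546,i1234]),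
   ([0],[i1234,i1356],[i1326,i1235]), ([0],[i1234,i1356],[i1325,i1236])]),
   ([i1234,i1235], [Pt B5 T0, Pt B4 T0, Pt B3 T0, Pt B6 T2],
   [([0],[i1234,i1325],[odd_inv,i2356]), ([0],[i1234,i1325],[i1435,i1423]), ([],[],[]),
   ([0,0],[i1234,i1325],[odd_inv,i1635,i1236]), ([],[],[]), ([],[],[]),
   ([0],[i1234,i1325],[i1345,i1245]), ([1,0],[i1234,i1325],[odd_inv,i1456,i1234]), ([],[],[]),
   ([0],[i1234,i1325],[i1524,i1324]), ([],[],[]), ([],[],[]),
   ([0],[i1234,i1325],[odd_inv,i1635,i1236]), ([1,0],[i1234,i1325],[i1534,i1523]), ([],[],[]),
   ([0],[i1234,i1325],[odd_inv,i2356,i1523]), ([],[],[]), ([],[],[]), ([],[],[]), ([],[],[]),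
   ([],[],[]), ([0],[i1234,i1536],[i1423,i1246]), ([0],[i1234,i1536],[i1635,i1256]),
   ([0,0],[i1234,i1536],[i2635,i1324]), ([0,0],[i1234,i1325],[i1435,i1423]), ([],[],[]),
   ([],[],[]), ([0],[i1234,i1325],[odd_inv,i2356,i1235]), ([],[],[]), ([],[],[]),
   ([0],[i1234,i1325],[i2534,i1234]), ([],[],[]), ([],[],[]), ([0],[i1234,i1536],[i1356,i1325]),
   ([0],[i1234,i1536],[i2635,i1324]), ([0,0],[i1234,i1536],[i1635,i1256])]),
   ([i1234,i1536], [Pt B5 T2, Pt B2 T2, Pt B1 T2, Pt B4 T1, Pt B3 T1, Pt B6 T2],  [([],[],[]),
   ([],[i1234,i1235,i1634],[i1256,i1245]), ([],[],[]),
   ([0,0],[i1234,i1235,i1634],[odd_inv,i1245,i1234]), ([],[i1234,i1256,i1345],[i3546]),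
   ([1,0],[i1234,i1325],[i3645,i1423]), ([],[],[]), ([],[],[]),
   ([1,0],[i1234,i1325],[odd_inv,i1625,i1234]), ([],[],[]),
   ([0],[i1234,i1325],[odd_inv,i2546,i1245]), ([0,0],[i1234,i1325],[i2546,i2345]), ([],[],[]),
   ([],[],[]), ([],[],[]), ([0],[i1234,i1325],[i2546,i2345]), ([],[],[]),
   ([],[i1234,i1235,i1634],[odd_inv,i2546,i1326]), ([1],[i1234,i1235,i1634],[i2536,i1256]),
   ([0,0],[i1234,i1325],[odd_inv,i2356,i1236]), ([],[],[]), ([],[],[]), ([],[],[]),
   ([0],[i1234,i1325],[odd_inv,i1546,i1324]), ([0],[i1234,i1325],[i1325,i1256]), ([],[],[]),
   ([],[],[]), ([],[],[]), ([0],[i1234,i1325],[odd_inv,i2356,i1236]),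
   ([0,0],[i1234,i1235,i1634],[i1423,i1235]), ([1],[i1234,i1235,i1634],[odd_inv,i2436,i1526]),
   ([],[],[]), ([0],[i1234,i1325],[i2635]), ([],[i1234,i1256,i1345],[odd_inv,i1526,i1324]),
   ([],[],[]), ([],[],[])]),
   ([i1234,i1356], [Pt B1 T0, Pt B2 T0, Pt B4 T2, Pt B3 T2],  [([],[],[]), ([],[],[]), ([],[],[]),
   ([],[],[]), ([],[],[]), ([],[],[]), ([],[],[]), ([],[],[]), ([],[],[]), ([],[],[]), ([],[],[]),
   ([],[],[]), ([],[],[]), ([],[],[]), ([],[],[]), ([],[],[]), ([1],[i1234,i1526],[i2346,i1235]),
   ([],[],[]), ([],[],[]), ([],[],[]), ([],[],[]), ([],[],[]), ([1],[i1234,i1526],[i2346,i1235]),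
   ([],[],[]), ([],[],[]), ([],[],[]), ([],[],[]), ([],[],[]), ([],[],[]), ([],[],[]),
   ([1],[i1234,i1526],[i2346,i1235]), ([],[],[]), ([],[],[]), ([1],[i1234,i1526],[i2346,i1235]),
   ([],[],[]), ([],[],[])]),
   ([i1234,i1526], [Pt B5 T1, Pt B2 T2, Pt B1 T2, Pt B6 T0],  [([],[],[]), ([],[],[]), ([],[],[]),
   ([],[],[]), ([0],[i1234,i1324,i1526],[]), ([],[],[]), ([],[],[]), ([],[],[]), ([],[],[]),
   ([],[],[]), ([0],[i1234,i1324,i1526],[i1256]), ([],[],[]), ([],[],[]), ([],[],[]), ([],[],[]),
   ([],[],[]), ([],[],[]), ([],[],[]), ([],[],[]), ([],[],[]), ([],[],[]), ([],[],[]), ([],[],[]),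
   ([],[],[]), ([],[],[]), ([],[],[]), ([],[],[]), ([],[],[]), ([],[],[]), ([],[],[]), ([],[],[]),
   ([],[],[]), ([],[],[]), ([],[],[]), ([0,1,1],[i1234,i1324,i1526],[i1423,i1256]),
   ([0,1,1],[i1234,i1324,i1526],[i1324])]),
   ([i1234,i1325], [Pt B6 T2],  [([],[],[]), ([],[],[]),
   ([],[i1234,i1256,i1325],[odd_inv,i3546,i1234]), ([],[],[]),
   ([1],[i1234,i1256,i1325],[odd_inv,i2456,i2346]), ([],[],[]),
   ([1,1,0],[i1234,i1256,i1345],[i2435,i1245]), ([],[],[]), ([],[],[]), ([],[],[]),
   ([0,0,1,0],[i1234,i1256,i1345],[i1546,i1245]), ([],[],[]),
   ([0,1,1],[i1234,i1256,i1345],[i1324,i1256]), ([],[],[]), ([],[],[]), ([],[],[]), ([],[],[]),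
   ([0,1,1],[i1234,i1256,i1325],[i1256]), ([],[],[]), ([],[],[]),
   ([0,0,1],[i1234,i1256,i1325],[odd_inv,i2356,i1236]), ([],[],[]), ([],[],[]),
   ([1,0],[i1234,i1256,i1345],[i2345,i1423]), ([],[],[]),
   ([1,1],[i1234,i1256,i1325],[odd_inv,i1623,i1245]), ([],[],[]),
   ([0],[i1234,i1256,i1345],[i1324]), ([],[],[]), ([],[],[])]),
   ([i1234,i1235,i1634], [Pt B1 T0, Pt B2 T0, Pt B2 T2, Pt B1 T1, Pt B1 T2, Pt B2 T1, Pt B6 T0, Pt
   B6 T1, Pt B6 T2],  [([0,0],[],[]), ([0],[],[]), ([0],[],[]), ([0],[],[]), ([0,0],[],[]),
   ([0],[],[]), ([0],[],[]), ([0,0],[],[]), ([0,0,0],[],[]), ([1,0,0],[],[]), ([0,0],[],[]),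
   ([0],[],[]), ([0],[],[]), ([0],[],[]), ([0,0],[],[]), ([0],[],[]), ([0,0],[],[]),
   ([0,0],[],[]), ([0,0],[],[]), ([1,0,0],[],[]), ([0],[],[]), ([0],[],[]), ([0,0,0],[],[]),
   ([0],[],[]), ([0],[],[]), ([0,0],[],[]), ([0,0],[],[]), ([0,0,0],[],[]), ([0,0],[],[]),
   ([0],[],[]), ([0],[],[]), ([0],[],[]), ([1,1,0],[],[]), ([0],[],[]), ([0],[],[]),
   ([0,0],[],[])]),
   ([i1234,i1324,i1526], [Pt B5 T1, Pt B2 T2, Pt B1 T2, Pt B4 T1, Pt B3 T1, Pt B6 T0],
   [([0],[],[]), ([0,0],[],[]), ([0,0],[],[]), ([0],[],[]), ([1,0],[],[]), ([0],[],[]),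
   ([1,0],[],[]), ([0],[],[]), ([1,0],[],[]), ([0],[],[]), ([0,0],[],[]), ([0,0],[],[]),
   ([0],[],[]), ([0],[],[]), ([0,0],[],[]), ([0],[],[]), ([0],[],[]), ([0],[],[]), ([1,0],[],[]),
   ([0],[],[]), ([1,0],[],[]), ([0,0],[],[]), ([0],[],[]), ([1,0],[],[]), ([0],[],[]),
   ([0,0],[],[]), ([0],[],[]), ([0],[],[]), ([1,0],[],[]), ([1,0],[],[]), ([0,0],[],[]),
   ([1,0],[],[]), ([0],[],[]), ([0],[],[]), ([1,0],[],[]), ([0],[],[])]),
   ([i1234,i1256,i1325], [Pt B4 T0, Pt B5 T2, Pt B2 T2, Pt B1 T2, Pt B3 T0, Pt B6 T1],
   [([0],[],[]), ([0],[],[]), ([0,0],[],[]), ([0,0],[],[]), ([0],[],[]), ([0],[],[]), ([0],[],[]),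
   ([0],[],[]), ([0],[],[]), ([0,0],[],[]), ([0],[],[]), ([0,0],[],[]), ([0],[],[]),
   ([1,0],[],[]), ([0],[],[]), ([0,0],[],[]), ([0,0],[],[]), ([1,0],[],[]), ([0],[],[]),
   ([0],[],[]), ([0],[],[]), ([0],[],[]), ([0],[],[]), ([0,0],[],[]), ([0],[],[]), ([0],[],[]),
   ([0],[],[]), ([0,0],[],[]), ([0],[],[]), ([0],[],[])]),
   ([i1234,i1256,i1345], [Pt B1 T0, Pt B5 T1, Pt B4 T0, Pt B2 T0, Pt B3 T0, Pt B6 T0],
   [([0,0],[],[]), ([0,0],[],[]), ([0],[],[]), ([0],[],[]), ([0],[],[]), ([0],[],[]),
   ([0,0],[],[]), ([0],[],[]), ([0],[],[]), ([0],[],[]), ([0,0],[],[]), ([0,0],[],[]),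
   ([0],[],[]), ([1,0],[],[]), ([0],[],[]), ([0],[],[]), ([0],[],[]), ([1,0],[],[]),
   ([0,0],[],[]), ([0],[],[]), ([0,0],[],[]), ([0],[],[]), ([0,0],[],[]), ([0,0],[],[]),
   ([0,0],[],[]), ([0],[],[]), ([0],[],[]), ([0],[],[]), ([0],[],[]), ([0],[],[])])]"

text \<open>\<open>pathsj\<close> lists, for all triples \<open>[a, b, c]\<close> of involutions with product \<open>repj\<close> in lexicographic
  order, braid moves leading to \<open>rootj\<close>.\<close>

definition root7 :: "semi list" where "root7 = [i1346,i1236,i1356]"
definition paths7 :: "nat list list list" where
  "paths7 = [[[1,0,0,1,1,0],[1,1,1,0,0,1,1,0],[0,0,1,1,0],[1,1,0,0,1,1,0]],
  [[0,1,1,1],[1,1,0,1,1,1],[1,1,1,0,1,1,1],[1,0,1,1,1]], [[1,1,0,0,0,0],[1,0,0,0,0],[0,0,0,0]],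
  [], [], [], [], [], [[0,1,1,1,0,1,1,1],[0,1,1,0,0,1,1],[1,0,1,1,1,0,1,1,1]],
  [[0,1,0,1,1,1],[0,1,1,1,1],[1,1,0,1,0,1,1,1],[1,0,1,0,1,1,1]], [[],[1,1,1,1],[1,1,1],[1,1],[1]],
  [[0,0,0,1,1,0],[0,0,1,1,1,1],[1,1,0,0,0,1,1,0],[0,1,1,0,0,0,1,1,1],[1,0,0,0,1,1,0]],
  [[1,0],[0],[1,1,0]],
  [[0,0,0,1,1,0,0,1],[1,0,0,1,1,0,0,0,1,1],[0,0,1,1,0,0,0,1,1],[0,1,1,1,0,0,0],[0,0,1,1,1,1,0,1]],
  [], [], [[1,1,0,0,1,1],[1,0,0,1,1],[0,0,1,1],[0,1,1,0,0,1],[1,1,1,0,0,1,1]], [],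
  [[1,0,0,0,1,1,1],[1,1,0,0,0,1,1,1],[0,0,0,1,1,1]],
  [[1,1,1,1,0,1],[0,1],[1,0,1],[1,1,0,1],[1,1,1,0,1]], [], [],
  [[0,1,1,0,0,1,1,0],[0,0,1,1,1,0,1,1,1],[0,1,1,1,0,0,1,1],[0,1,1,1,0,0],[0,0,1,1,1,0,1]], [], [],
  [[1,1,0,0],[1,1,1,0,0],[0,0],[1,0,0]],
  [[1,1,0,0,0,1,1],[0,0,0,1,1],[1,0,0,0,1,1],[0,1,1,1,0,0,1]], [], [], [], [],
  [[0,1,1,1,0,1],[0,1,1,0,0],[0,0,1,1,0,1,1]],
  [[0,0,1,1,0,0,1],[1,0,0,1,1,0,0,1],[0,0,1,1,0,0,0]],
  [[0,1,1,1,0,0,1,1,0],[0,0,1,1,1,0,0],[1,0,0,1,1,1,0,0]], [],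
  [[0,1,1,0,1,1,1],[1,0,1,1,0,1,1,1],[0,1,1,0],[0,1,1,0,1],[0,1,1,0,1,1]],
  [[0,1,1],[1,0,1,1],[1,1,0,1,1]], [],
  [[0,0,1,1,1],[1,0,0,1,1,1],[1,1,0,0,1,1,1],[0,1,1,0,0,0,1,1],[1,1,1,0,0,1,1,1]],
  [[1,1,1,0,0,0],[1,0,0,0],[0,0,0],[1,1,0,0,0]], [[1,1,1,0,0,1],[1,1,0,0,1],[0,0,1],[1,0,0,1]],
  [], [], [], [[0,1,1,1,1,0,1],[0,0,1,1,1,0,0,1,1],[0,0,0,1,1,0,1,1],[0,1,1,0,0,0]]]"
definition root9 :: "semi list" where "root9 = [i1245,i1526,i1623]"
definition paths9 :: "nat list list list" where
  "paths9 = [[[0,1,1],[1,0,1,1],[1,1,0,1,1],[1,1,1,0,1,1]], [[0,0,1,1],[1,0,0,1,1],[1,1,0,0,1,1]],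
  [], [[1,1],[1,1,1],[],[1,1,1,1],[1]], [], [], [],
  [[0,1,1,0,1,1],[1,1,0,1,1,0,1,1],[0,1,1,0,1],[0,1,1,0],[1,0,1,1,0,1,1]],
  [[0,1,1,1,1],[1,0,0,1,0,1,1],[0,0,1,0,1,1]], [], [],
  [[0,1,1,0,0,1,1],[1,0,0,1,1,1],[1,1,0,0,1,1,1],[0,0,1,1,1]], [], [], [],
  [[0,0,1,1,0,1,1],[0,1,1,1,0,1],[1,0,0,1,1,0,1,1],[0,1,1,0,0]],
  [[0,1],[1,1,1,0,1],[1,1,1,1,0,1],[1,0,1],[1,1,0,1]], [[1,0,0,0],[1,1,0,0,0],[0,0,0]], [],
  [[0,0,1],[1,1,0,0,1],[1,0,0,1]], [[0,0,0,0],[1,1,0,0,0,0],[1,1,1,0,0,0,0],[1,0,0,0,0]], [], [],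
  [[0,1,1,1,0,1,1],[1,0,1,1,1,0,1,1],[1,1,0,1,1,1,0,1,1],[0,1,1,0,0,1],[0,0,1,1,0,0,0]],
  [[0,0,1,1,0,0,1,1],[0,0,1,1,0,0],[1,0,0,1,1,0,0],[0,0,1,1,1,0],[0,0,0,1,1,1,1]],
  [[0],[1,0],[1,1,1,0],[1,1,0]], [], [[0,0,1,1,0,1],[0,1,1,1,0],[1,0,0,1,1,0,1]], [], [],
  [[0,0,0,1,1,0,1,1],[0,1,1,1,1,0,1],[0,1,1,0,0,0]], [[0,1,0,1,1],[1,0,1,0,1,1],[0,1,1,1]], [],
  [], [], [], [], [[0,0,0,1],[1,1,0,0,0,1],[1,0,0,0,1]], [[1,1,0,0],[0,0],[1,0,0]], [], [], [],
  [], [], [[0,0,1,1,0],[0,0,1,1,1,1],[1,0,0,1,1,0]]]"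
definition root10 :: "semi list" where "root10 = [i1235,i1326,i2346]"
definition paths10 :: "nat list list list" where
  "paths10 = [[[0,0,1,1,1],[0,1,1,0,0,1,1],[1,1,0,0,1,1,1],[1,0,0,1,1,1]],
  [[1,1,1],[],[1,1],[1],[1,1,1,1]], [], [[0,1,1,1],[1,1,0,1,1,1],[1,0,1,1,1]], [], [], [],
  [[1,0,0,1,1,0],[0,0,1,1,1,1],[0,0,1,1,0]],
  [[1,1,0,0,0,0],[0,0,0,0],[1,1,1,0,0,0,0],[1,0,0,0,0]], [], [], [], [], [],
  [[0,1],[1,1,1,1,0,1],[1,1,1,0,1],[1,0,1],[1,1,0,1]],
  [[1,0,0,1,1,0,1],[0,1,1,1,0],[0,0,1,1,0,1]], [[1,0,0,1,1],[1,1,0,0,1,1],[0,0,1,1]], [], [],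
  [[1,0,0,1,1,0,1,1,1],[0,1,1,1,0,1,1],[0,0,1,1,0,1,1,1],[0,0,1,1,0,0,0],[0,1,1,0,0,1]], [], [],
  [[1,0,0,0],[1,1,0,0,0],[0,0,0]], [[1,1,0,1,1,1,1],[0,1,1,1,1],[1,0,1,1,1,1]], [],
  [[1,1,0,0,0,1],[1,0,0,0,1],[0,0,0,1]], [[0],[1,1,0],[1,0],[1,1,1,0]], [], [], [],
  [[0,1,1,1,0,1],[1,0,0,1,1,0,1,1],[0,1,1,0,0],[0,0,1,1,0,1,1]],
  [[0,0,1,1,0,0,1,1],[0,0,0,1,1,1,1],[0,0,1,1,1,0],[1,0,0,1,1,0,0],[0,0,1,1,0,0]],
  [[1,0,0],[0,0],[1,1,0,0]], [], [], [[0,1,1],[1,0,1,1],[1,1,1,0,1,1],[1,1,0,1,1]], [],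
  [[0,1,1,0,1,1,1],[0,1,1,0,1],[0,1,1,0,1,1,1,1],[0,1,1,0],[0,1,1,0,1,1]], [],
  [[0,1,1,1,1,0,1],[0,1,1,0,0,0],[0,0,0,1,1,0,1,1]], [], [], [], [[1,1,0,0,1],[0,0,1],[1,0,0,1]],
  []]"

text \<open>An entry \<open>(v, h0, hs)\<close> provides a centre \<open>h0\<close> and its neighbours \<open>hs\<close> through which any two first
  letters of words with product \<open>v\<close> are linked.\<close>

definition links4 :: "(semi \<times> semi \<times> semi list) list" where
  "links4 = [(rep3, i1325, [i1326,i1456,i1526]), (rep4, i1325, [i1345]), (rep5, i1234, [i1624]),
  (rep6, i1234, [i1426,i1625,i1235]), (rep7, i1645, []), (rep8, i1236, [i1623,i1246]), (rep9,
  i1426, [i1246,i2635]), (rep10, i1324, [i1356,i1423])]"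
definition links5 :: "(semi \<times> semi \<times> semi list) list" where
  "links5 = [(rep1, i1234, [i1325,i1346,i1426]), (rep2, i1356, [i1526]), (rep3, i1325,
  [i1324,i1236,i2634]), (rep4, i1235, [i1546,i1436]), (rep5, i1234, [i1635,i1246]), (rep6, i1234,
  [i1425,i1345]), (rep7, i1234, [i1625,i1236]), (rep8, i1235, [i3456,i2436,i1326]), (rep9, i1234,
  [i1356,i1245]), (rep10, i1234, [i1625,i1236])]"
definition links6 :: "(semi \<times> semi \<times> semi list) list" where
  "links6 = [(rep0, i1234, [i1235]), (rep1, i1234, []), (rep2, i1235, [i1236]), (rep3, i1234, []),
  (rep4, i1325, []), (rep5, i1234, []), (rep6, i1234, []), (rep7, i1245, []), (rep8, i1236, []),
  (rep9, i1236, []), (rep10, i1236, [])]"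

definition z1 :: semi where "z1 = Semi False (Pt B1 T1) (Pt B2 T1) (Pt B3 T1) (Pt B4 T1) (Pt B5 T1) (Pt B6 T1)"
definition z2 :: semi where "z2 = Semi False (Pt B1 T2) (Pt B2 T2) (Pt B3 T2) (Pt B4 T2) (Pt B5 T2) (Pt B6 T2)"

text \<open>Elements of the Valentiner group have order 1, 2, 3, 4, 5, 6, 12 or 15; \<open>z1\<close> and \<open>z2\<close> are the
  nontrivial central ones.  The properties below describe the involutions, the products of two
  involutions, and the products of generating words of length 3, 4 and 5.\<close>

definition lev1 :: "semi \<Rightarrow> bool" where
  "lev1 x \<longleftrightarrow> x \<noteq> 1 \<and> x * x = 1"
definition lev2 :: "semi \<Rightarrow> bool" where
  "lev2 x \<longleftrightarrow> x \<noteq> z1 \<and> x \<noteq> z2 \<and> (let y = x * x; u = y * y in u = 1 \<or> u * x = 1 \<or> y * x = 1)"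
definition lev3 :: "semi \<Rightarrow> bool" where
  "lev3 x \<longleftrightarrow> (let y = x * x; u = y * y in u \<noteq> 1 \<and> u * x \<noteq> 1 \<and> u * y \<noteq> 1)"
definition lev4 :: "semi \<Rightarrow> bool" where
  "lev4 x \<longleftrightarrow> x \<noteq> z1 \<and> x \<noteq> z2 \<and> x * x \<noteq> 1"
definition lev5 :: "semi \<Rightarrow> bool" where
  "lev5 x \<longleftrightarrow> x \<noteq> 1"

definition reps where "reps = [rep0, rep1, rep2, rep3, rep4, rep5, rep6, rep7, rep8, rep9, rep10]"

definition class_ok where
  "class_ok r tab \<longleftrightarrow> list_all2 (\<lambda>c (k, ss). c * r = cnjs ss k) involutions tab"

definition preserves :: "pt list \<Rightarrow> semi \<Rightarrow> bool" where
  "preserves S c \<longleftrightarrow> list_all (\<lambda>x. List.member S (img c x)) S"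

definition ascends :: "semi list list \<Rightarrow> semi list \<Rightarrow> semi \<Rightarrow> nat list \<times> semi list \<times> semi list \<Rightarrow> bool" where
  "ascends rs r d = (\<lambda>(ks, r', ss). case braid_moves ks (d # r) of w \<Rightarrow>
     (if r' = [] then (case rev w of c # b # a # u \<Rightarrow> lev3 (a * (b * c)) | _ \<Rightarrow> False)
      else List.member rs r' \<and> list_all (List.member (odd_inv # involutions)) ss \<and> length r' \<le> length w
        \<and> drop (length w - length r') w = map (cnjs ss) r'))"

text \<open>\<open>map fst tab\<close> offers only later rows as targets, which makes the climb
  terminate. By the equal lengths in \<open>list_all2\<close>, \<open>cs \<noteq> []\<close> says
  that some involution does not preserve \<open>S\<close>.\<close>

fun ascent_ok :: "(semi list \<times> pt list \<times> (nat list \<times> semi list \<times> semi list) list) list \<Rightarrow> bool" where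
  "ascent_ok [] = True"
| "ascent_ok ((r, S, cs) # tab) \<longleftrightarrow>
     list_all (preserves S) r \<and> cs \<noteq> []
     \<and> list_all2 (ascends (map fst tab) r) (filter (\<lambda>d. \<not> preserves S d) involutions) cs
     \<and> ascent_ok tab"

text \<open>The last letter is forced: \<open>a * (b * c) = v\<close> gives
  \<open>c = b * (a * v)\<close>. A row thus runs over \<open>b\<close> and keeps the pairs whose
  \<open>c\<close> is an involution.\<close>

definition paths_ok where
  "paths_ok v r pss \<longleftrightarrow> list_all2 (\<lambda>a ps.
     list_all2 (\<lambda>(b, c) ks. braid_moves ks [a, b, c] = r)
       (filter (\<lambda>(b, c). lev1 c) (map (\<lambda>b. (b, b * (a * v))) involutions)) ps) involutions pss"

text \<open>\<open>A\<close> tests whether a generating tail with the given product exists,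
  \<open>B\<close> whether the word \<open>u\<close> of \<open>linked_edge\<close> exists. Every
  admissible first letter equals or neighbours a member of \<open>h0 # hs\<close>, and each member
  of \<open>hs\<close> neighbours \<open>h0\<close>.\<close>

definition link_ok where
  "link_ok A B = list_all (\<lambda>(v, h0, hs). list_all (List.member involutions) (h0 # hs) \<and> A (h0 * v) \<and> list_all (\<lambda>h. A (h * v) \<and> B (h0 * (h * v))) hs
     \<and> list_all (\<lambda>a. A (a * v) \<longrightarrow> list_ex (\<lambda>h. a = h \<or> B (h * (a * v))) (h0 # hs)) involutions)"

text \<open>An illegal step returns the empty list, so that a faulty certificate fails the
  membership checks.\<close>

fun derived :: "semi list \<Rightarrow> (semi \<times> semi) list \<Rightarrow> semi list" where
  "derived xs [] = xs"
| "derived xs ((x, y) # st) = (if List.member xs x \<and> List.member xs y then derived (cnj y x # xs) st else [])"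

section \<open>Evaluation of the certificates\<close>

lemma base_ok: "list_all (List.member (derived base_triple base_steps)) involutions"
  by code_simp

text \<open>Four elements suffice: the involutions that normalize a set form a closed set by
  \<open>cnj_closed_normalizers\<close>, and \<open>base_triple\<close> yields all letters.\<close>

lemma base_normalizes:
  "list_all (\<lambda>s. s * s = 1 \<and> list_all (\<lambda>c. List.member involutions (cnj s c)) involutions)
     (odd_inv # base_triple)"
  by code_simp

lemma distinct_involutions: "distinct involutions"
  by code_simp

lemma class_ok:
  "class_ok rep0 class_row0" "class_ok rep1 class_row1" "class_ok rep2 class_row2"
  "class_ok rep3 class_row3" "class_ok rep4 class_row4" "class_ok rep5 class_row5"
  "class_ok rep6 class_row6" "class_ok rep7 class_row7" "class_ok rep8 class_row8"
  "class_ok rep9 class_row9" "class_ok rep10 class_row10"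
  by code_simp+

definition class_row_ok where
  "class_row_ok tab \<longleftrightarrow> list_all (\<lambda>(k, ss). List.member reps k
     \<and> list_all (List.member (odd_inv # involutions)) ss) tab"

lemma class_row_ok:
  "list_all class_row_ok [class_row0, class_row1, class_row2, class_row3, class_row4, class_row5,
     class_row6, class_row7, class_row8, class_row9, class_row10]"
  by code_simp

lemma ascent_ok: "ascent_ok ascent_table"
  by code_simp

lemma paths_ok: "paths_ok rep7 root7 paths7" "paths_ok rep9 root9 paths9" "paths_ok rep10 root10 paths10"
  by code_simp+

lemma root_steps_ok:
  "list_all (List.member (derived root7 root_steps7)) base_triple"
  "list_all (List.member (derived root9 root_steps9)) base_triple"
  "list_all (List.member (derived root10 root_steps10)) base_triple"
  by code_simp+

lemma links_ok: "link_ok lev3 lev2 links4" "link_ok lev4 lev3 links5" "link_ok lev5 lev4 links6"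
  by code_simp+

lemma lev_reps:
  "list_all (\<lambda>r. lev1 r \<longrightarrow> r = rep2) reps"
  "list_all (\<lambda>r. lev3 r \<longrightarrow> r = rep7 \<or> r = rep9 \<or> r = rep10) reps"
  "list_all (\<lambda>r. lev4 r \<longrightarrow> List.member (map fst links4) r) reps"
  "list_all (\<lambda>r. lev5 r \<longrightarrow> List.member (map fst links5) r) reps"
  "list_all (\<lambda>r. List.member (map fst links6) r) reps"
  by code_simp+

text \<open>Supplies existence: an element of one level is an involution times an element of the
  level below, so words are built by prepending letters. For lengths 4 and 5 \<open>lev_up\<close>
  excludes all other products.\<close>

lemma lev_down:
  "list_all (\<lambda>r. lev2 r \<longrightarrow> list_ex (\<lambda>a. lev1 (a * r)) involutions) reps"
  "list_all (\<lambda>r. lev4 r \<longrightarrow> list_ex (\<lambda>a. lev3 (a * r)) involutions) reps"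
  "list_all (\<lambda>r. lev5 r \<longrightarrow> list_ex (\<lambda>a. lev4 (a * r)) involutions) reps"
  "list_all (\<lambda>r. list_ex (\<lambda>a. lev5 (a * r)) involutions) reps"
  by code_simp+

lemma lev_up:
  "list_all (\<lambda>r. lev4 r \<or> list_all (\<lambda>a. \<not> lev3 (a * r)) involutions) reps"
  "list_all (\<lambda>r. lev5 r \<or> list_all (\<lambda>a. \<not> lev4 (a * r)) involutions) reps"
  by code_simp+

lemma cnj_z: "list_all (\<lambda>s. List.member [z1, z2] (cnj s z1) \<and> List.member [z1, z2] (cnj s z2))
    (odd_inv # involutions)"
  by code_simp

lemma prod_root: "prod_list root7 = rep7" "prod_list root9 = rep9" "prod_list root10 = rep10"
  by code_simp+

section \<open>Generating words are determined by their product\<close>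

lemma list_all2_ex: "list_all2 P xs ys \<Longrightarrow> x \<in> set xs \<Longrightarrow> \<exists>y\<in>set ys. P x y"
  by (induction rule: list_all2_induct) auto

lemma derived_subset: "cnj_closed M \<Longrightarrow> set xs \<subseteq> M \<Longrightarrow> set (derived xs st) \<subseteq> M"
proof (induction xs st rule: derived.induct)
  case (2 xs x y st)
  then show ?case by (auto simp: cnj_closed_def List.member_iff)
qed simp

lemma cnj_closed_base:
  assumes "cnj_closed M" "set base_triple \<subseteq> M" shows "set involutions \<subseteq> M"
  using derived_subset[OF assms, of base_steps] base_ok by (auto simp: list_all_iff List.member_iff)

abbreviation normal_involutions :: "semi list" where
  "normal_involutions \<equiv> odd_inv # involutions"

text \<open>Conjugation by \<open>cnj y x\<close> amounts to conjugation by \<open>y\<close>,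
  \<open>x\<close> and \<open>y\<close> in turn.\<close>

lemma cnj_closed_normalizers:
  "cnj_closed {s. s * s = 1 \<and> (\<forall>x\<in>A. cnj s x \<in> A)}"
  unfolding cnj_closed_def
proof (clarsimp)
  fix x y assume x: "x * x = 1" "\<forall>a\<in>A. cnj x a \<in> A" and y: "y * y = 1" "\<forall>a\<in>A. cnj y a \<in> A"
  have "cnj (cnj y x) a = cnj y (cnj x (cnj y a))" for a
    by (simp add: cnj_def mult.assoc)
  moreover have "cnj y x * cnj y x = 1"
    using x y by (simp add: cnj_mult[symmetric] cnj_one)
  ultimately show "cnj y x * cnj y x = 1 \<and> (\<forall>a\<in>A. cnj (cnj y x) a \<in> A)"
    using x y by simp
qed

lemma normal_involutions_normalize:
  "set normal_involutions \<subseteq> {s. s * s = 1 \<and> (\<forall>x\<in>set involutions. cnj s x \<in> set involutions)}"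
  using cnj_closed_base[OF cnj_closed_normalizers] base_normalizes
  by (auto simp: list_all_iff List.member_iff)

interpretation involution_class "set involutions"
  using normal_involutions_normalize by unfold_locales auto

lemma normalizers: "set normal_involutions \<subseteq> normalizers"
  using normal_involutions_normalize unfolding normalizers_def by blast

text \<open>A word generates as soon as its letters yield \<open>base_triple\<close>, which in turn
  yields all 45 involutions.\<close>

lemma gen_derived:
  assumes "list_all (List.member (derived r st)) base_triple" "set r \<subseteq> set involutions"
  shows "gen r"
  unfolding gen_def
proof (intro conjI allI impI)
  fix M assume M: "cnj_closed M" "set r \<subseteq> M"
  then have "set base_triple \<subseteq> M"
    using assms derived_subset[OF M, of st] by (auto simp: list_all_iff List.member_iff)
  then show "set involutions \<subseteq> M" using cnj_closed_base M by blast
qed (use assms in auto)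

text \<open>The Valentiner group inside \<open>semi\<close>, as \<open>valentiner_carrier\<close>
  will show. Inverses come from reversing words.\<close>

definition word_group :: "semi set" where
  "word_group = {prod_list w | w. set w \<subseteq> set involutions}"

lemma word_group_prod_list: "set w \<subseteq> set involutions \<Longrightarrow> prod_list w \<in> word_group"
  by (auto simp: word_group_def)

lemma word_group_one: "1 \<in> word_group"
  using word_group_prod_list[of "[]"] by simp

lemma word_group_times:
  assumes "x \<in> word_group" "y \<in> word_group" shows "x * y \<in> word_group"
proof -
  obtain u w where "x = prod_list u" "set u \<subseteq> set involutions" "y = prod_list w" "set w \<subseteq> set involutions"
    using assms by (auto simp: word_group_def)
  then show ?thesis using word_group_prod_list[of "u @ w"] by simp
qed

lemma involutions_word_group: "a \<in> set involutions \<Longrightarrow> a \<in> word_group"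
  using word_group_prod_list[of "[a]"] by simp

section \<open>Conjugacy classes and properties constant on them\<close>

lemma class_row_cases:
  assumes "r \<in> set reps" "a \<in> set involutions"
  shows "\<exists>k ss. k \<in> set reps \<and> set ss \<subseteq> set normal_involutions \<and> a * r = cnjs ss k"
proof -
  obtain tab where tab: "class_ok r tab" "class_row_ok tab"
    using assms(1) class_ok class_row_ok unfolding reps_def by auto
  then obtain k ss where "(k, ss) \<in> set tab" "a * r = cnjs ss k"
    using list_all2_ex[OF _ assms(2)] unfolding class_ok_def by fast
  then show ?thesis
    using tab(2) unfolding class_row_ok_def
    by (fastforce simp: list_all_iff List.member_iff subset_iff)
qed

text \<open>The group is never enumerated: pulling the conjugation out of
  \<open>a * cnjs ss r\<close> turns \<open>a\<close> into another involution, and the products of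
  the 45 involutions with the 11 representatives are tabulated.\<close>

lemma word_group_class:
  assumes "v \<in> word_group"
  obtains r ss where "r \<in> set reps" "set ss \<subseteq> set normal_involutions" "v = cnjs ss r"
proof -
  obtain w where w: "set w \<subseteq> set involutions" "v = prod_list w"
    using assms by (auto simp: word_group_def)
  have "\<exists>r ss. r \<in> set reps \<and> set ss \<subseteq> set normal_involutions \<and> prod_list w = cnjs ss r"
    using w(1)
  proof (induction w)
    case Nil
    have "rep0 = 1" by (simp add: rep0_def one_semi_def)
    then show ?case by (intro exI[of _ rep0] exI[of _ "[]"]) (simp add: reps_def)
  next
    case (Cons a w)
    then obtain r ss where r: "r \<in> set reps" "set ss \<subseteq> set normal_involutions" "prod_list w = cnjs ss r"
      by auto
    then have ss: "set ss \<subseteq> normalizers" using normalizers by blast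
    have "cnjs (rev ss) a \<in> set involutions"
      using ss Cons.prems cnjs_C[of "rev ss" a] by simp
    then obtain k ts where k: "k \<in> set reps" "set ts \<subseteq> set normal_involutions"
        "cnjs (rev ss) a * r = cnjs ts k"
      using class_row_cases r(1) by blast
    have "a * cnjs ss r = cnjs ss (cnjs (rev ss) a * r)"
      using ss by (simp add: cnjs_mult cnjs_rev')
    then have "prod_list (a # w) = cnjs (ss @ ts) k"
      using r k by (simp add: cnjs_append)
    then show ?case using r k by (intro exI[of _ k] exI[of _ "ss @ ts"]) auto
  qed
  then show thesis using that w by auto
qed

text \<open>Only the set is stable: \<open>odd_inv\<close> exchanges its two members.\<close>

lemma cnjs_z:
  assumes "set ss \<subseteq> set normal_involutions"
  shows "cnjs ss x \<in> {z1, z2} \<longleftrightarrow> x \<in> {z1, z2}"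
proof -
  have *: "cnj s x \<in> {z1, z2}" if "s \<in> set normal_involutions" "x \<in> {z1, z2}" for s x
    using that cnj_z by (auto simp: list_all_iff List.member_iff)
  have **: "x \<in> {z1, z2} \<Longrightarrow> set ts \<subseteq> set normal_involutions \<Longrightarrow> cnjs ts x \<in> {z1, z2}" for ts x
  proof (induction ts)
    case (Cons a ts)
    then have "cnjs ts x \<in> {z1, z2}" "a \<in> set normal_involutions" by simp_all
    then show ?case using * by (simp del: insert_iff)
  qed simp
  have "set ss \<subseteq> normalizers" using assms normalizers by blast
  then show ?thesis using **[of x ss] **[of "cnjs ss x" "rev ss"] cnjs_rev[of ss x] assms by auto
qed

definition cnj_invariant :: "(semi \<Rightarrow> bool) \<Rightarrow> bool" where
  "cnj_invariant A \<longleftrightarrow> (\<forall>ss x. set ss \<subseteq> set normal_involutions \<longrightarrow> A (cnjs ss x) = A x)"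

text \<open>The five properties refer only to powers being 1 and to membership in
  \<open>{z1, z2}\<close>, both of which conjugation respects.\<close>

lemma lev_invariant: "cnj_invariant lev1" "cnj_invariant lev2" "cnj_invariant lev3"
  "cnj_invariant lev4" "cnj_invariant lev5"
proof -
  have *: "lev1 (cnjs ss x) = lev1 x \<and> lev2 (cnjs ss x) = lev2 x \<and> lev3 (cnjs ss x) = lev3 x
     \<and> lev4 (cnjs ss x) = lev4 x \<and> lev5 (cnjs ss x) = lev5 x"
    if ss: "set ss \<subseteq> set normal_involutions" for ss x
  proof -
    have n: "set ss \<subseteq> normalizers" using ss normalizers by blast
    have one: "cnjs ss y = 1 \<longleftrightarrow> y = 1" for y
      using cnjs_eq_iff[OF n, of y 1] cnjs_one[OF n] by simp
    have z: "cnjs ss x = z1 \<or> cnjs ss x = z2 \<longleftrightarrow> x = z1 \<or> x = z2"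
      using cnjs_z[OF ss, of x] by simp
    show ?thesis
      using z unfolding lev1_def lev2_def lev3_def lev4_def lev5_def Let_def
      by (simp only: cnjs_mult[OF n, symmetric] one) blast
  qed
  show "cnj_invariant lev1" "cnj_invariant lev2" "cnj_invariant lev3"
    "cnj_invariant lev4" "cnj_invariant lev5"
    unfolding cnj_invariant_def using * by blast+
qed

text \<open>Reduces a statement about the whole group to the 11 representatives.\<close>

lemma reps_all:
  assumes "list_all P reps" "cnj_invariant P" "v \<in> word_group" shows "P v"
  using assms word_group_class[OF assms(3)] unfolding cnj_invariant_def list_all_iff by metis

text \<open>Conjugation permutes the involutions, so a quantifier over them does not spoil
  invariance.\<close>

lemma invariant_ex:
  assumes "cnj_invariant A" shows "cnj_invariant (\<lambda>x. list_ex (\<lambda>a. A (a * x)) involutions)"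
  unfolding cnj_invariant_def
proof (intro allI impI)
  fix ss x assume ss: "set ss \<subseteq> set normal_involutions"
  then have n: "set ss \<subseteq> normalizers" using normalizers by blast
  have A: "A (a * cnjs ss x) \<longleftrightarrow> A (cnjs (rev ss) a * x)" for a
    using assms ss cnjs_mult[OF n, of "cnjs (rev ss) a" x] cnjs_rev'[OF n, of a]
    unfolding cnj_invariant_def by metis
  have "cnjs (rev ss) a \<in> set involutions" if "a \<in> set involutions" for a
    using cnjs_C[of "rev ss" a] n that by simp
  moreover have "A (cnjs ss a * cnjs ss x) \<longleftrightarrow> A (a * x)" for a
    using assms ss cnjs_mult[OF n, of a x] unfolding cnj_invariant_def by metis
  ultimately show "list_ex (\<lambda>a. A (a * cnjs ss x)) involutions = list_ex (\<lambda>a. A (a * x)) involutions"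
    using A cnjs_C[OF n] unfolding list_ex_iff by blast
qed

lemma invariant_imp: "cnj_invariant A \<Longrightarrow> cnj_invariant B \<Longrightarrow> cnj_invariant (\<lambda>x. A x \<longrightarrow> B x)"
  by (simp add: cnj_invariant_def)

lemma lev_downD:
  assumes "v \<in> word_group"
  shows "lev2 v \<Longrightarrow> \<exists>a\<in>set involutions. lev1 (a * v)"
    and "lev4 v \<Longrightarrow> \<exists>a\<in>set involutions. lev3 (a * v)"
    and "lev5 v \<Longrightarrow> \<exists>a\<in>set involutions. lev4 (a * v)"
    and "\<exists>a\<in>set involutions. lev5 (a * v)"
  using reps_all[OF lev_down(1) invariant_imp[OF lev_invariant(2) invariant_ex[OF lev_invariant(1)]] assms]
    reps_all[OF lev_down(2) invariant_imp[OF lev_invariant(4) invariant_ex[OF lev_invariant(3)]] assms]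
    reps_all[OF lev_down(3) invariant_imp[OF lev_invariant(5) invariant_ex[OF lev_invariant(4)]] assms]
    reps_all[OF lev_down(4) invariant_ex[OF lev_invariant(5)] assms]
  unfolding list_ex_iff by blast+

lemma lev_upD:
  assumes "v \<in> word_group" "a \<in> set involutions"
  shows "lev3 (a * v) \<Longrightarrow> lev4 v" and "lev4 (a * v) \<Longrightarrow> lev5 v"
proof -
  have *: "list_all (\<lambda>r. list_ex (\<lambda>a. lev3 (a * r)) involutions \<longrightarrow> lev4 r) reps"
    "list_all (\<lambda>r. list_ex (\<lambda>a. lev4 (a * r)) involutions \<longrightarrow> lev5 r) reps"
    using lev_up unfolding list_all_iff list_ex_iff by blast+
  show "lev3 (a * v) \<Longrightarrow> lev4 v" and "lev4 (a * v) \<Longrightarrow> lev5 v"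
    using reps_all[OF *(1) invariant_imp[OF invariant_ex[OF lev_invariant(3)] lev_invariant(4)] assms(1)]
      reps_all[OF *(2) invariant_imp[OF invariant_ex[OF lev_invariant(4)] lev_invariant(5)] assms(1)] assms(2)
    unfolding list_ex_iff by blast+
qed

section \<open>Involutions and generating triples\<close>

lemma lev1_involutions:
  assumes "v \<in> word_group" shows "lev1 v \<longleftrightarrow> v \<in> set involutions"
proof
  assume "lev1 v"
  obtain r ss where r: "r \<in> set reps" "set ss \<subseteq> set normal_involutions" "v = cnjs ss r"
    using word_group_class[OF assms] .
  \<comment> \<open>The other representatives have order different from 2, so the group has no
    involutions besides the 45 letters.\<close>
  then have "r = rep2"
    using \<open>lev1 v\<close> lev_invariant(1) lev_reps(1) unfolding cnj_invariant_def list_all_iff by auto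
  moreover have "rep2 \<in> set involutions" by code_simp
  ultimately show "v \<in> set involutions" using r normalizers cnjs_C[of ss r] by blast
next
  have "list_all lev1 involutions" by code_simp
  then show "v \<in> set involutions \<Longrightarrow> lev1 v" by (simp add: list_all_iff)
qed

text \<open>The tables join all triples over \<open>rep7\<close>, \<open>rep9\<close> and
  \<open>rep10\<close> to one generating root each, and conjugation by \<open>ss\<close> carries
  this to \<open>v\<close>.\<close>

lemma triple_root:
  assumes "v \<in> word_group" "lev3 v"
  obtains ss r where "set ss \<subseteq> set normal_involutions" "gen r" "length r = 3" "v = prod_list (map (cnjs ss) r)"
    "\<And>a b c. set [a, b, c] \<subseteq> set involutions \<Longrightarrow> a * (b * c) = v \<Longrightarrow> [a, b, c] \<sim> map (cnjs ss) r"
proof -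
  obtain r ss where r: "r \<in> set reps" "set ss \<subseteq> set normal_involutions" "v = cnjs ss r"
    using word_group_class[OF assms(1)] .
  then have n: "set ss \<subseteq> normalizers" using normalizers by blast
  have "lev3 r" using assms(2) r lev_invariant(3) unfolding cnj_invariant_def by auto
  then have "r = rep7 \<or> r = rep9 \<or> r = rep10"
    using r lev_reps(2) unfolding list_all_iff by blast
  moreover have "set root7 \<subseteq> set involutions" "set root9 \<subseteq> set involutions" "set root10 \<subseteq> set involutions"
    "length root7 = 3" "length root9 = 3" "length root10 = 3"
    by code_simp+
  ultimately obtain rt pss where rt: "paths_ok r rt pss" "prod_list rt = r" "gen rt" "length rt = 3"
    using paths_ok prod_root gen_derived root_steps_ok by blast
  show thesis
  proof (rule that[of ss rt])
    show "v = prod_list (map (cnjs ss) rt)"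
      using cnjs_prod_list[OF n, of rt] rt r by simp
    fix a b c assume abc: "set [a, b, c] \<subseteq> set involutions" "a * (b * c) = v"
    \<comment> \<open>\<open>f\<close> undoes the conjugation: the triple gets product
      \<open>r\<close>, where the table applies.\<close>
    define f where "f = cnjs (rev ss)"
    have f: "f a \<in> set involutions" "f b \<in> set involutions" "f c \<in> set involutions"
      using n cnjs_C[of "rev ss"] abc unfolding f_def by auto
    have "f a * (f b * f c) = r"
      using n abc r cnjs_rev[OF n] cnjs_mult[of "rev ss"] unfolding f_def by (metis set_rev)
    then have fc: "f c = f b * (f a * r)"
      using cancel[OF f(1), of "f b * f c"] cancel[OF f(2), of "f c"] by simp
    have "list_all2 (\<lambda>a ps. list_all2 (\<lambda>(b, c) ks. braid_moves ks [a, b, c] = rt)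
       (filter (\<lambda>(b, c). lev1 c) (map (\<lambda>b. (b, b * (a * r))) involutions)) ps) involutions pss"
      using rt(1) by (simp add: paths_ok_def)
    then obtain ps where ps: "list_all2 (\<lambda>(b, c) ks. braid_moves ks [f a, b, c] = rt)
       (filter (\<lambda>(b, c). lev1 c) (map (\<lambda>b. (b, b * (f a * r))) involutions)) ps"
      using list_all2_ex[OF _ f(1)] by blast
    have "lev1 (f c)" using lev1_involutions[OF involutions_word_group] f by blast
    then have "(f b, f c) \<in> set (filter (\<lambda>(b, c). lev1 c) (map (\<lambda>b. (b, b * (f a * r))) involutions))"
      using f fc by auto
    from list_all2_ex[OF ps this] obtain ks where "braid_moves ks [f a, f b, f c] = rt"
      by (simp only: case_prod_conv) blast
    then have "map f [a, b, c] \<sim> rt" using braid_moves[of "[f a, f b, f c]" ks] by simp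
    then have "map (cnjs ss) (map f [a, b, c]) \<sim> map (cnjs ss) rt"
      by (rule braid_eq_map_cnjs[OF n])
    then show "[a, b, c] \<sim> map (cnjs ss) rt"
      unfolding f_def by (simp add: cnjs_rev'[OF n])
  qed (use r rt in auto)
qed

text \<open>A product satisfying \<open>lev3\<close> has order 12 or 15: a lift of an element of
  order 4 or 5, twisted by the centre. It forces generation because the triple is braid equivalent
  to a conjugate of a generating root.\<close>

lemma gen_triple:
  assumes "set [a, b, c] \<subseteq> set involutions" "lev3 (a * (b * c))" shows "gen [a, b, c]"
proof -
  have v: "a * (b * c) \<in> word_group"
    using word_group_prod_list[OF assms(1)] by simp
  obtain ss r where "set ss \<subseteq> set normal_involutions" "gen r" "[a, b, c] \<sim> map (cnjs ss) r"
    using triple_root[OF v assms(2)] assms(1) by metis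
  then show ?thesis
    using gen_braid_eq gen_map_cnjs normalizers by (metis subset_trans)
qed

section \<open>Reduction of a generating word to a generating triple at its end\<close>

definition twisted_tail :: "semi list \<Rightarrow> bool" where
  "twisted_tail w \<longleftrightarrow> (\<exists>u a b c. w \<sim> u @ [a, b, c] \<and> lev3 (a * (b * c)))"

lemma twisted_tail_cnjs:
  assumes ss: "set ss \<subseteq> set normal_involutions" and "twisted_tail w"
  shows "twisted_tail (map (cnjs ss) w)"
proof -
  have n: "set ss \<subseteq> normalizers" using ss normalizers by blast
  obtain u a b c where u: "w \<sim> u @ [a, b, c]" "lev3 (a * (b * c))"
    using assms(2) by (auto simp: twisted_tail_def)
  have "map (cnjs ss) w \<sim> map (cnjs ss) u @ [cnjs ss a, cnjs ss b, cnjs ss c]"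
    using braid_eq_map_cnjs[OF n u(1)] by simp
  moreover have "lev3 (cnjs ss a * (cnjs ss b * cnjs ss c))"
    using u(2) ss lev_invariant(3) unfolding cnj_invariant_def by (simp add: cnjs_mult[OF n, symmetric])
  ultimately show ?thesis unfolding twisted_tail_def by blast
qed

text \<open>Thus letters that all preserve a set \<open>S\<close> moved by some involution cannot
  generate; this is the only obstruction that the ascent uses.\<close>

lemma cnj_closed_preserves: "cnj_closed {x. preserves S x}"
  by (auto simp: cnj_closed_def preserves_def cnj_def list_all_iff List.member_iff img_times)

lemma gen_not_preserves:
  assumes "gen w" "\<exists>d\<in>set involutions. \<not> preserves S d" shows "\<exists>d\<in>set w. \<not> preserves S d"
  using assms cnj_closed_preserves[of S] unfolding gen_def by blast

text \<open>The letters of \<open>u\<close> are arbitrary. One of them, \<open>d\<close>, does not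
  preserve \<open>S\<close>; it is brought next to \<open>r\<close> at the cost of conjugating the
  letters it passes, and only \<open>d # r\<close> is looked up in the table.\<close>

lemma ascent:
  "ascent_ok tab \<Longrightarrow> r \<in> set (map fst tab) \<Longrightarrow> gen w \<Longrightarrow> w \<sim> u @ r \<Longrightarrow> twisted_tail w"
proof (induction tab arbitrary: r w u rule: ascent_ok.induct)
  case (2 r0 S cs tab)
  show ?case
  proof (cases "r = r0")
    case False
    then show ?thesis using 2 by auto
  next
    case True
    have ok: "list_all (preserves S) r" "cs \<noteq> []"
      "list_all2 (ascends (map fst tab) r) (filter (\<lambda>d. \<not> preserves S d) involutions) cs" "ascent_ok tab"
      using 2 True by auto
    have w: "set (u @ r) \<subseteq> set involutions" using 2 braid_eq_subset gen_subset by blast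
    have "filter (\<lambda>d. \<not> preserves S d) involutions \<noteq> []" using ok by auto
    then have ex: "\<exists>d\<in>set involutions. \<not> preserves S d" unfolding filter_empty_conv by blast
    have "gen (u @ r)" using 2 gen_braid_eq by blast
    from gen_not_preserves[OF this ex] obtain d where d: "d \<in> set u" "\<not> preserves S d"
      using ok(1) by (auto simp: list_all_iff)
    then obtain u1 u2 where u12: "u = u1 @ d # u2" by (meson split_list)
    have dC: "d \<in> set involutions" using d w by auto
    then have "d \<in> set (filter (\<lambda>d. \<not> preserves S d) involutions)" using d(2) by simp
    from list_all2_ex[OF ok(3) this] obtain ks r' ss where c: "ascends (map fst tab) r d (ks, r', ss)"
      by (metis prod_cases3)
    define y where "y = braid_moves ks (d # r)"
    define u' where "u' = u1 @ map (cnj d) u2"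
    have "w \<sim> u1 @ ((d # u2) @ r)" using 2 u12 by simp
    also have "\<dots> \<sim> u1 @ (map (cnj d) u2 @ [d]) @ r"
      by (intro braid_eq_append1 braid_eq_append2 move_right dC)
    finally have wy: "w \<sim> u' @ y"
      unfolding u'_def y_def using braid_moves[of "d # r" ks] braid_eq_append1[of "d # r" _ u']
      by (simp add: u'_def) (meson braid_eq.trans)
    show ?thesis
    proof (cases "r' = []")
      case True
      then obtain c b a v where "rev y = c # b # a # v" "lev3 (a * (b * c))"
        using c unfolding ascends_def y_def by (auto split: list.splits)
      then have "y = rev v @ [a, b, c]" by (metis append.assoc append_Cons append_Nil rev.simps(2) rev_rev_ident)
      then show ?thesis
        using wy \<open>lev3 _\<close> unfolding twisted_tail_def by (metis append.assoc)
    next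
      case False
      then have r': "r' \<in> set (map fst tab)" "set ss \<subseteq> set normal_involutions"
          "drop (length y - length r') y = map (cnjs ss) r'"
        using c unfolding ascends_def y_def by (auto simp: list_all_iff List.member_iff simp del: list.set)
      then have n: "set ss \<subseteq> normalizers" using normalizers by blast
      define v where "v = u' @ take (length y - length r') y"
      \<comment> \<open>Conjugation by \<open>rev ss\<close> makes the tail the row
        \<open>r'\<close> itself, as the induction hypothesis requires; \<open>twisted_tail\<close>
        survives the way back.\<close>
      define w' where "w' = map (cnjs (rev ss)) w"
      have "w \<sim> v @ map (cnjs ss) r'"
        using wy r'(3) unfolding v_def by (metis append.assoc append_take_drop_id)
      then have "w' \<sim> map (cnjs (rev ss)) v @ r'"
        using braid_eq_map_cnjs[of "rev ss"] n map_cnjs_rev[OF n] unfolding w'_def by (metis map_append set_rev)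
      moreover have "gen w'" unfolding w'_def using gen_map_cnjs[of "rev ss" w] n 2 by simp
      ultimately have "twisted_tail w'" using 2 r' ok by blast
      then have "twisted_tail (map (cnjs ss) w')" using twisted_tail_cnjs r' by blast
      moreover have "map (cnjs ss) w' = w"
        unfolding w'_def by (simp add: comp_def cnjs_rev'[OF n])
      ultimately show ?thesis by simp
    qed
  qed
qed simp

lemma gen_twisted_tail:
  assumes "gen w" obtains u a b c where "w \<sim> u @ [a, b, c]" "lev3 (a * (b * c))"
    "gen [a, b, c]" "set u \<subseteq> set involutions"
proof -
  \<comment> \<open>The climb starts from the empty tail, whose row only uses that a generating word
    moves the point \<open>Pt B5 T0\<close>.\<close>
  have "[] \<in> set (map fst ascent_table)" by (simp add: ascent_table_def)
  then have "twisted_tail w" using ascent[OF ascent_ok _ assms, of "[]" w] by simp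
  then obtain u a b c where "w \<sim> u @ [a, b, c]" "lev3 (a * (b * c))"
    by (auto simp: twisted_tail_def)
  moreover have "set (u @ [a, b, c]) \<subseteq> set involutions"
    using calculation assms braid_eq_subset gen_subset by blast
  ultimately show thesis using that gen_triple by auto
qed

text \<open>The last three letters generate already, so dropping a letter in front of them keeps a
  generating word; a word of length at least 4 has such a letter.\<close>

lemma gen_tail:
  assumes "gen w" "length w = Suc n" "n \<ge> 3"
  obtains a x where "w \<sim> a # x" "gen x" "length x = n" "a \<in> set involutions" "prod_list x = a * prod_list w"
proof -
  obtain u a b c where u: "w \<sim> u @ [a, b, c]" "gen [a, b, c]" "set u \<subseteq> set involutions"
    using gen_twisted_tail[OF assms(1)] by metis
  then have l: "length w = length u + 3" using braid_eq_length by fastforce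
  then obtain d u' where u': "u = d # u'" using assms by (cases u) auto
  have "set (u' @ [a, b, c]) \<subseteq> set involutions" using u u' gen_subset[OF u(2)] by auto
  then have "gen (u' @ [a, b, c])" using gen_mono[OF u(2)] by auto
  moreover have "prod_list w = d * prod_list (u' @ [a, b, c])"
    using braid_eq_prod_list[OF u(1)] assms gen_subset u' by simp
  ultimately show thesis
    using that[of d "u' @ [a, b, c]"] u u' l assms cancel[of d "prod_list (u' @ [a, b, c])"] by auto
qed

section \<open>Products of generating words of each length\<close>

definition gen_prod :: "nat \<Rightarrow> semi \<Rightarrow> bool" where
  "gen_prod n v \<longleftrightarrow> (\<exists>w. gen w \<and> length w = n \<and> prod_list w = v)"

lemma gen_prod_Suc:
  assumes "a \<in> set involutions" "gen_prod n (a * v)" shows "gen_prod (Suc n) v"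
proof -
  obtain w where w: "gen w" "length w = n" "prod_list w = a * v"
    using assms by (auto simp: gen_prod_def)
  then have "gen (a # w)" using gen_mono[of w "a # w"] gen_subset assms by auto
  then show ?thesis unfolding gen_prod_def using w assms by (intro exI[of _ "a # w"]) simp
qed

lemma gen_prod_SucD:
  assumes "gen_prod (Suc n) v" "n \<ge> 3" obtains a where "a \<in> set involutions" "gen_prod n (a * v)"
proof -
  obtain w where "gen w" "length w = Suc n" "prod_list w = v"
    using assms by (auto simp: gen_prod_def)
  then show thesis using gen_tail[of w n] assms that unfolding gen_prod_def by metis
qed

lemma gen_word_group: "gen w \<Longrightarrow> prod_list w \<in> word_group"
  using gen_subset word_group_prod_list by blast

lemma gen_prod_word_group: "gen_prod n v \<Longrightarrow> v \<in> word_group"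
  by (auto simp: gen_prod_def gen_word_group)

lemma gen3:
  assumes "gen w" "length w = 3" obtains a b c where "w = [a, b, c]" "lev3 (a * (b * c))"
proof -
  obtain u a b c where u: "w \<sim> u @ [a, b, c]" "lev3 (a * (b * c))"
    using gen_twisted_tail[OF assms(1)] by metis
  then have "u = []" using braid_eq_length[OF u(1)] assms by simp
  then have "lev3 (prod_list w)" using braid_eq_prod_list[OF u(1)] gen_subset assms u by simp
  then show thesis
    using assms that by (auto simp: numeral_eq_Suc length_Suc_conv)
qed

lemma gen_prod3: "v \<in> word_group \<Longrightarrow> gen_prod 3 v \<longleftrightarrow> lev3 v"
proof
  assume "gen_prod 3 v" then show "lev3 v"
    using gen3 unfolding gen_prod_def by fastforce
next
  assume "v \<in> word_group" "lev3 v"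
  then obtain ss r where "set ss \<subseteq> set normal_involutions" "gen r" "length r = 3" "v = prod_list (map (cnjs ss) r)"
    using triple_root by metis
  then show "gen_prod 3 v"
    unfolding gen_prod_def using gen_map_cnjs[of ss r] normalizers by (intro exI[of _ "map (cnjs ss) r"]) auto
qed

text \<open>\<open>lev_downD\<close> prepends a letter to a generating triple; conversely
  \<open>gen_tail\<close> removes one and \<open>lev_upD\<close> restricts the product. Length 5 is
  reached in the same way from length 4.\<close>

lemma gen_prod4: "v \<in> word_group \<Longrightarrow> gen_prod 4 v \<longleftrightarrow> lev4 v"
proof
  assume v: "v \<in> word_group" "lev4 v"
  then obtain a where "a \<in> set involutions" "lev3 (a * v)" using lev_downD by blast
  then show "gen_prod 4 v"
    using gen_prod_Suc[of a 3 v] gen_prod3 v word_group_times involutions_word_group by simp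
next
  assume v: "v \<in> word_group" "gen_prod 4 v"
  obtain a where "a \<in> set involutions" "gen_prod 3 (a * v)"
    using gen_prod_SucD[of 3 v] v by auto
  then show "lev4 v" using lev_upD v gen_prod3 gen_prod_word_group by blast
qed

lemma gen_prod5: "v \<in> word_group \<Longrightarrow> gen_prod 5 v \<longleftrightarrow> lev5 v"
proof
  assume v: "v \<in> word_group" "lev5 v"
  then obtain a where "a \<in> set involutions" "lev4 (a * v)" using lev_downD by blast
  then show "gen_prod 5 v"
    using gen_prod_Suc[of a 4 v] gen_prod4 v word_group_times involutions_word_group by simp
next
  assume v: "v \<in> word_group" "gen_prod 5 v"
  obtain a where "a \<in> set involutions" "gen_prod 4 (a * v)"
    using gen_prod_SucD[of 4 v] v by auto
  then show "lev5 v" using lev_upD v gen_prod4 gen_prod_word_group by blast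
qed

lemma gen_prod_ge6: "n \<ge> 6 \<Longrightarrow> v \<in> word_group \<Longrightarrow> gen_prod n v"
proof (induction n arbitrary: v rule: dec_induct)
  case base
  obtain a where "a \<in> set involutions" "lev5 (a * v)" using lev_downD base by blast
  then show ?case
    using gen_prod_Suc[of a 5 v] gen_prod5 base word_group_times involutions_word_group by simp
next
  case (step n)
  \<comment> \<open>Any letter would do, since multiplication by it permutes the group.\<close>
  have "rep2 \<in> set involutions" by code_simp
  then show ?case using step gen_prod_Suc word_group_times involutions_word_group by blast
qed

section \<open>Induction on the length of the word\<close>

lemma determined3: "determined 3"
  unfolding determined_def
proof (intro allI impI; elim conjE)
  fix w w' assume w: "gen w" "gen w'" "length w = 3" "length w' = 3" "prod_list w = prod_list w'"
  obtain a b c where a: "w = [a, b, c]" "lev3 (a * (b * c))" using gen3 w by metis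
  obtain a' b' c' where a': "w' = [a', b', c']" using gen3 w by metis
  have "a * (b * c) \<in> word_group" using gen_word_group[OF w(1)] a by simp
  then obtain ss r where
    "\<And>x y z. set [x, y, z] \<subseteq> set involutions \<Longrightarrow> x * (y * z) = a * (b * c) \<Longrightarrow> [x, y, z] \<sim> map (cnjs ss) r"
    using triple_root[OF _ a(2)] by metis
  then have "w \<sim> map (cnjs ss) r" "w' \<sim> map (cnjs ss) r"
    using w a a' gen_subset by (metis mult.right_neutral prod_list.Cons prod_list.Nil)+
  then show "w \<sim> w'" by (meson braid_eq.sym braid_eq.trans)
qed

text \<open>\<open>A\<close> and \<open>D\<close> describe the products of generating words of
  lengths \<open>n\<close> and \<open>Suc n\<close>, and \<open>B\<close> provides edges. The table
  entry of the representative \<open>r\<close> is carried to \<open>v\<close> by \<open>ss\<close>,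
  and every first letter is linked to the centre through at most two edges.\<close>

lemma determined_link:
  assumes n: "determined n" "n \<ge> 3"
    and ok: "link_ok A B tab" "cnj_invariant A" "cnj_invariant B" "cnj_invariant D"
    and reps: "list_all (\<lambda>r. D r \<longrightarrow> List.member (map fst tab) r) reps"
    and A: "\<And>v. v \<in> word_group \<Longrightarrow> gen_prod n v \<longleftrightarrow> A v"
    and D: "\<And>v. v \<in> word_group \<Longrightarrow> gen_prod (Suc n) v \<longleftrightarrow> D v"
    and edge: "\<And>a b v. a \<in> set involutions \<Longrightarrow> b \<in> set involutions \<Longrightarrow> v \<in> word_group \<Longrightarrow>
      A (a * v) \<Longrightarrow> A (b * v) \<Longrightarrow> B (b * (a * v)) \<Longrightarrow>
      \<exists>u. gen (b # u) \<and> gen (cnj b a # u) \<and> Suc (length u) = n \<and> prod_list u = b * (a * v)"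
  shows "determined (Suc n)"
proof (rule determined_Suc)
  show "\<exists>a x. w \<sim> a # x \<and> gen x" if "gen w" "length w = Suc n" for w
    using gen_tail[OF that n(2)] by metis
next
  fix v a b x y
  assume ab: "a \<in> set involutions" "b \<in> set involutions" and x: "gen x" "gen y" "length x = n" "length y = n"
    "prod_list x = a * v" "prod_list y = b * v"
  have "v = a * prod_list x" using x ab cancel[of a v] by simp
  then have v: "v \<in> word_group"
    using word_group_times[OF involutions_word_group gen_word_group] ab x by blast
  have ex: "gen_prod n (a * v)" "gen_prod n (b * v)" using x by (auto simp: gen_prod_def)
  then have "D v" using D[OF v] gen_prod_Suc ab by blast
  obtain r ss where r: "r \<in> set reps" "set ss \<subseteq> set normal_involutions" "v = cnjs ss r"
    using word_group_class[OF v] .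
  then have ns: "set ss \<subseteq> normalizers" using normalizers by blast
  have "D r" using \<open>D v\<close> r ok(4) unfolding cnj_invariant_def by auto
  then obtain h0 hs where tab: "(r, h0, hs) \<in> set tab"
    using reps r by (auto simp: list_all_iff List.member_iff)
  have ok': "set (h0 # hs) \<subseteq> set involutions" "A (h0 * r)" "\<forall>h\<in>set hs. A (h * r) \<and> B (h0 * (h * r))"
    "\<forall>a\<in>set involutions. A (a * r) \<longrightarrow> (\<exists>h\<in>set (h0 # hs). a = h \<or> B (h * (a * r)))"
    using ok(1) tab unfolding link_ok_def list_all_iff list_ex_iff by (auto simp: List.member_iff)
  have conj: "P (cnjs ss x) \<longleftrightarrow> P x" if "cnj_invariant P" for P x
    using that r(2) by (auto simp: cnj_invariant_def)
  have edge': "linked n v (cnjs ss c) (cnjs ss d)"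
    if "c \<in> set involutions" "d \<in> set involutions" "A (c * r)" "A (d * r)" "c = d \<or> B (d * (c * r))" for c d
  proof (cases "c = d")
    case False
    have "\<exists>u. gen (cnjs ss d # u) \<and> gen (cnj (cnjs ss d) (cnjs ss c) # u) \<and> Suc (length u) = n
       \<and> prod_list u = cnjs ss d * (cnjs ss c * v)"
      using that False v conj[OF ok(2)] conj[OF ok(3)] unfolding r(3)
      by (intro edge) (auto simp: cnjs_C[OF ns] cnjs_mult[OF ns, symmetric])
    then show ?thesis using linked_edge[OF n(1)] cnjs_C[OF ns] that by blast
  qed (simp add: linked_refl n)
  have root: "linked n v c (cnjs ss h0)" if c: "c \<in> set involutions" "gen_prod n (c * v)" for c
  proof -
    define d where "d = cnjs (rev ss) c"
    have d: "d \<in> set involutions" "c = cnjs ss d"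
      using cnjs_C[of "rev ss" c] ns c by (simp_all add: d_def cnjs_rev'[OF ns])
    have "c * v = cnjs ss (d * r)" by (simp add: d r cnjs_mult[OF ns])
    then have Ad: "A (d * r)"
      using c A[OF gen_prod_word_group[OF c(2)]] conj[OF ok(2)] by simp
    then obtain h where h: "h \<in> set (h0 # hs)" "d = h \<or> B (h * (d * r))"
      using ok' d by blast
    have hA: "h \<in> set involutions" "A (h * r)" "h = h0 \<or> B (h0 * (h * r))" using ok' h by auto
    then have "A (cnjs ss h * v)" using conj[OF ok(2)] by (simp add: r cnjs_mult[OF ns, symmetric])
    moreover have "cnjs ss h * v \<in> word_group"
      using v hA word_group_times involutions_word_group cnjs_C[OF ns] by blast
    \<comment> \<open>The tail after the intermediate letter that \<open>linked_trans\<close> asks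
      for.\<close>
    ultimately obtain x where "gen x" "length x = n" "prod_list x = cnjs ss h * v"
      using A unfolding gen_prod_def by blast
    then show ?thesis
      using linked_trans edge'[OF d(1) hA(1) Ad hA(2) h(2)] edge'[OF hA(1) _ hA(2) ok'(2) hA(3)] ok'(1) d(2)
      by auto
  qed
  have "cnjs ss h0 * v = cnjs ss (h0 * r)" by (simp add: r cnjs_mult[OF ns])
  then have "A (cnjs ss h0 * v)" using ok' conj[OF ok(2)] by simp
  moreover have "cnjs ss h0 * v \<in> word_group"
    using v ok' word_group_times involutions_word_group cnjs_C[OF ns] by auto
  ultimately obtain z where "gen z" "length z = n" "prod_list z = cnjs ss h0 * v"
    using A unfolding gen_prod_def by blast
  then show "linked n v a b"
    using linked_trans[OF root[OF ab(1) ex(1)] linked_sym[OF root[OF ab(2) ex(2)]]] by blast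
qed

text \<open>If \<open>u\<close> generates by itself, any letter may be put in front of it.\<close>

lemma gen_edge:
  assumes "a \<in> set involutions" "b \<in> set involutions" "gen_prod n (b * (a * v))"
  shows "\<exists>u. gen (b # u) \<and> gen (cnj b a # u) \<and> Suc (length u) = Suc n \<and> prod_list u = b * (a * v)"
proof -
  obtain u where u: "gen u" "length u = n" "prod_list u = b * (a * v)"
    using assms by (auto simp: gen_prod_def)
  moreover have "gen (c # u)" if "c \<in> set involutions" for c
    using gen_mono[OF u(1), of "c # u"] gen_subset[OF u(1)] that by auto
  ultimately show ?thesis using assms closed by blast
qed

text \<open>Here \<open>u\<close> has only two letters and cannot generate by itself, so
  \<open>gen_edge\<close> is of no help. Instead \<open>lev2\<close> splits
  \<open>b * (a * v)\<close> into two involutions, and both triples generate because their products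
  \<open>a * v\<close> and \<open>b * v\<close> satisfy \<open>lev3\<close>.\<close>

lemma determined4: "determined 4"
proof -
  have "determined (Suc 3)"
  proof (rule determined_link[OF determined3 _ links_ok(1) lev_invariant(3,2,4) lev_reps(3)])
    fix a b v assume ab: "a \<in> set involutions" "b \<in> set involutions" and v: "v \<in> word_group"
      and lev: "lev3 (a * v)" "lev3 (b * v)" "lev2 (b * (a * v))"
    have w: "b * (a * v) \<in> word_group" using ab v word_group_times involutions_word_group by simp
    obtain c where c: "c \<in> set involutions" "lev1 (c * (b * (a * v)))" using lev_downD(1)[OF w lev(3)] by blast
    define d where "d = c * (b * (a * v))"
    have d: "d \<in> set involutions"
      using c w lev1_involutions word_group_times involutions_word_group unfolding d_def by blast
    have cd: "c * d = b * (a * v)" using c cancel by (simp add: d_def)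
    have "gen [b, c, d]" using gen_triple[of b c d] ab c d cd lev cancel[OF ab(2), of "a * v"] by simp
    moreover have "cnj b a * (c * d) = b * v"
      using ab cancel[OF ab(2), of "a * v"] cancel[OF ab(1), of v] by (simp add: cd cnj_def mult.assoc)
    then have "gen [cnj b a, c, d]" using gen_triple[of "cnj b a" c d] ab c d lev closed by simp
    ultimately show "\<exists>u. gen (b # u) \<and> gen (cnj b a # u) \<and> Suc (length u) = 3 \<and> prod_list u = b * (a * v)"
      using cd by (intro exI[of _ "[c, d]"]) simp
  qed (use gen_prod3 gen_prod4 in auto)
  then show ?thesis by simp
qed

lemma determined5: "determined 5"
proof -
  have "determined (Suc 4)"
  proof (rule determined_link[OF determined4 _ links_ok(2) lev_invariant(4,3,5) lev_reps(4)])
    fix a b v assume "a \<in> set involutions" "b \<in> set involutions" "v \<in> word_group" "lev3 (b * (a * v))"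
    then show "\<exists>u. gen (b # u) \<and> gen (cnj b a # u) \<and> Suc (length u) = 4 \<and> prod_list u = b * (a * v)"
      using gen_edge[of a b 3 v] gen_prod3 word_group_times involutions_word_group by simp
  qed (use gen_prod4 gen_prod5 in auto)
  then show ?thesis by simp
qed

lemma determined6: "determined 6"
proof -
  have "determined (Suc 5)"
  \<comment> \<open>At length 6 every element of the group is a product of a generating word, hence
    the trivial choice for \<open>D\<close>.\<close>
  proof (rule determined_link[OF determined5 _ links_ok(3) lev_invariant(5,4), of "\<lambda>_. True"])
    fix a b v assume "a \<in> set involutions" "b \<in> set involutions" "v \<in> word_group" "lev4 (b * (a * v))"
    then show "\<exists>u. gen (b # u) \<and> gen (cnj b a # u) \<and> Suc (length u) = 5 \<and> prod_list u = b * (a * v)"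
      using gen_edge[of a b 4 v] gen_prod4 word_group_times involutions_word_group by simp
  qed (use gen_prod5 gen_prod_ge6 lev_reps(5) in \<open>auto simp: cnj_invariant_def\<close>)
  then show ?thesis by simp
qed

text \<open>A generating \<open>u\<close> exists for every product except possibly 1. Two first
  letters can therefore fail to be joined by an edge only if \<open>b * (a * v) = 1\<close>, and
  then any third letter serves as an intermediate.\<close>

lemma determined_ge6: "n \<ge> 6 \<Longrightarrow> determined n"
proof (induction n rule: dec_induct)
  case (step n)
  show ?case
  proof (rule determined_Suc)
    show "\<exists>a x. w \<sim> a # x \<and> gen x" if "gen w" "length w = Suc n" for w
    proof -
      have "n \<ge> 3" using step by simp
      then show ?thesis using gen_tail[OF that] by metis
    qed
  next
    fix v a b x y
    assume ab: "a \<in> set involutions" "b \<in> set involutions" and x: "gen x" "gen y" "length x = n" "length y = n"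
      "prod_list x = a * v" "prod_list y = b * v"
    have "v = a * prod_list x" using x ab cancel[of a v] by simp
    then have v: "v \<in> word_group"
      using word_group_times[OF involutions_word_group gen_word_group] ab x by blast
    obtain m where m: "n = Suc m" "m \<ge> 5" using step by (cases n) auto
    have edge: "linked n v c d" if cd: "c \<in> set involutions" "d \<in> set involutions" "d * (c * v) \<noteq> 1" for c d
    proof -
      have w: "d * (c * v) \<in> word_group" using cd v word_group_times involutions_word_group by simp
      \<comment> \<open>Only for \<open>m = 5\<close>, that is \<open>n = 6\<close>, is the product
        1 excluded.\<close>
      have "gen_prod m (d * (c * v))"
        using m gen_prod5[OF w] gen_prod_ge6[OF _ w] cd by (cases "m = 5") (auto simp: lev5_def)
      then show ?thesis using gen_edge[OF cd(1,2)] linked_edge[OF step.IH cd(1,2)] m by metis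
    qed
    show "linked n v a b"
    proof (cases "b * (a * v) = 1")
      case True
      then have "v = a * b" using cancel[OF ab(2), of "a * v"] cancel[OF ab(1), of v] by simp
      have "\<exists>c\<in>set involutions. c \<noteq> a \<and> c \<noteq> b"
      proof -
        have "card (set involutions - {a, b}) \<noteq> 0"
          using distinct_card[OF distinct_involutions] card_Diff_subset[of "{a, b}" "set involutions"] ab
          by (auto simp: involutions_def card_insert_if)
        then have "set involutions - {a, b} \<noteq> {}" by force
        then show ?thesis by blast
      qed
      then obtain c where c: "c \<in> set involutions" "c \<noteq> a" "c \<noteq> b" by blast
      have "c * (a * v) \<noteq> 1"
      proof
        assume "c * (a * v) = 1"
        then have "c * b = 1" using cancel[OF ab(1), of b] \<open>v = a * b\<close> by simp
        then have "b = c" using cancel[OF c(1), of b] by simp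
        then show False using c by simp
      qed
      moreover have "b * (c * v) \<noteq> 1"
      proof
        assume "b * (c * v) = 1"
        then have "c * (a * b) = b" using cancel[OF ab(2), of "c * v"] \<open>v = a * b\<close> by simp
        then have "c * a = 1" using sq[OF ab(2)] by (metis mult.assoc mult_1_right)
        then have "a = c" using cancel[OF c(1), of a] by simp
        then show False using c by simp
      qed
      moreover have "gen_prod n (c * v)"
        using gen_prod_ge6 step c v word_group_times involutions_word_group by simp
      ultimately show ?thesis
        using edge[OF ab(1) c(1)] edge[OF c(1) ab(2)] linked_trans unfolding gen_prod_def by metis
    qed (simp add: edge ab)
  qed
qed (rule determined6)

lemma determined: "n \<ge> 5 \<Longrightarrow> determined n"
  using determined5 determined_ge6[of n] by (cases "n = 5") auto

section \<open>The Valentiner group\<close>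

text \<open>The points of a block are the fibre of the Valentiner group's block system over a point
  of \<open>{1..6}\<close>, listed along the central element \<open>z1\<close>.\<close>

fun point :: "pt \<Rightarrow> nat" where
  "point (Pt B1 T0) = 2" | "point (Pt B1 T1) = 8" | "point (Pt B1 T2) = 9"
| "point (Pt B2 T0) = 6" | "point (Pt B2 T1) = 13" | "point (Pt B2 T2) = 7"
| "point (Pt B3 T0) = 11" | "point (Pt B3 T1) = 14" | "point (Pt B3 T2) = 16"
| "point (Pt B4 T0) = 4" | "point (Pt B4 T1) = 10" | "point (Pt B4 T2) = 12"
| "point (Pt B5 T0) = 1" | "point (Pt B5 T1) = 3" | "point (Pt B5 T2) = 5"
| "point (Pt B6 T0) = 15" | "point (Pt B6 T1) = 17" | "point (Pt B6 T2) = 18"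

fun block_num :: "block \<Rightarrow> nat" where
  "block_num B1 = 1" | "block_num B2 = 2" | "block_num B3 = 3"
| "block_num B4 = 4" | "block_num B5 = 5" | "block_num B6 = 6"

fun pt_block :: "pt \<Rightarrow> block" where
  "pt_block (Pt b e) = b"

lemma ex_block: "(\<exists>b. P b) \<longleftrightarrow> P B1 \<or> P B2 \<or> P B3 \<or> P B4 \<or> P B5 \<or> P B6"
  by (metis block.exhaust)

lemma ex_trit: "(\<exists>e. P e) \<longleftrightarrow> P T0 \<or> P T1 \<or> P T2"
  by (metis trit.exhaust)

lemma ex_pt: "(\<exists>x. P x) \<longleftrightarrow> (\<exists>b e. P (Pt b e))"
  by (metis pt.exhaust)

lemma inj_point: "inj point"
proof (rule injI)
  fix x y assume h: "point x = point y"
  obtain b e where x: "x = Pt b e" by (cases x)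
  obtain c f where y: "y = Pt c f" by (cases y)
  show "x = y" using h unfolding x y
    by (cases b; cases e; cases c; cases f; simp)
qed

lemma range_point: "range point = {1..18}"
proof
  show "range point \<subseteq> {1..18}"
  proof
    fix n assume "n \<in> range point"
    then obtain b e where "n = point (Pt b e)" by (metis imageE pt.exhaust)
    then show "n \<in> {1..18}" by (cases b; cases e; simp)
  qed
  have "{1..18::nat} = set [1..<19]" by auto
  also have "\<dots> \<subseteq> range point"
    unfolding image_def by (simp add: upt_rec ex_pt ex_block ex_trit)
  finally show "{1..18} \<subseteq> range point" .
qed

lemma inj_block_num: "inj block_num"
proof (rule injI)
  fix x y show "block_num x = block_num y \<Longrightarrow> x = y"
    by (cases x; cases y; simp)
qed

lemma range_block_num: "range block_num = {1..6}"
proof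
  show "range block_num \<subseteq> {1..6}"
  proof
    fix n assume "n \<in> range block_num"
    then obtain b where "n = block_num b" by blast
    then show "n \<in> {1..6}" by (cases b) simp_all
  qed
  have "{1..6::nat} = set [1..<7]" by auto
  also have "\<dots> \<subseteq> range block_num"
    unfolding image_def by (simp add: upt_rec ex_block)
  finally show "{1..6} \<subseteq> range block_num" .
qed

section \<open>Action on 18 points and on six blocks\<close>

definition realize :: "semi \<Rightarrow> nat \<Rightarrow> nat" where
  "realize p n = (if n \<in> {1..18} then point (img p (inv' point n)) else n)"

definition on_blocks :: "semi \<Rightarrow> nat \<Rightarrow> nat" where
  "on_blocks p n = (if n \<in> {1..6} then block_num (pt_block (row p (inv' block_num n))) else n)"

lemma realize_point [simp]: "realize p (point x) = point (img p x)"
  using range_point inj_point unfolding realize_def by auto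

lemma on_blocks_num [simp]: "on_blocks p (block_num b) = block_num (pt_block (row p b))"
  using range_block_num inj_block_num unfolding on_blocks_def by auto

lemma realize_outside: "n \<notin> {1..18} \<Longrightarrow> realize p n = n"
  unfolding realize_def by (rule if_not_P)

lemma on_blocks_outside: "n \<notin> {1..6} \<Longrightarrow> on_blocks p n = n"
  unfolding on_blocks_def by (rule if_not_P)

lemma eq_on_points:
  assumes "\<And>x. f (point x) = g (point x)" "\<And>n. n \<notin> {1..18} \<Longrightarrow> f n = g n" shows "f = g"
proof
  fix n show "f n = g n"
    using assms range_point by (cases "n \<in> {1..18}") (metis imageE, blast)
qed

lemma eq_on_blocks:
  assumes "\<And>b. f (block_num b) = g (block_num b)" "\<And>n. n \<notin> {1..6} \<Longrightarrow> f n = g n" shows "f = g"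
proof
  fix n show "f n = g n"
    using assms range_block_num by (cases "n \<in> {1..6}") (metis imageE, blast)
qed

lemma realize_times: "realize (p * q) = realize p \<circ> realize q"
  by (rule eq_on_points) (simp_all add: img_times realize_outside)

lemma img_one: "img 1 x = x"
proof -
  obtain b e where "x = Pt b e" by (cases x)
  then show ?thesis by (cases b) (simp_all add: one_semi_def)
qed

lemma realize_one: "realize 1 = id"
  by (rule eq_on_points) (simp_all add: img_one realize_outside)

lemma pt_block_img: "pt_block (img p x) = pt_block (row p (pt_block x))"
proof -
  obtain b e where x: "x = Pt b e" by (cases x)
  obtain c d where "row p b = Pt c d" by (cases "row p b")
  then show ?thesis unfolding x by (cases "inverting p") simp_all
qed

lemma row_img: "row p b = img p (Pt b T0)"
proof -
  obtain c d where "row p b = Pt c d" by (cases "row p b")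
  then show ?thesis by (cases "inverting p") simp_all
qed

lemma on_blocks_times: "on_blocks (p * q) = on_blocks p \<circ> on_blocks q"
proof (rule eq_on_blocks)
  fix b
  have "pt_block (row (p * q) b) = pt_block (row p (pt_block (row q b)))"
    by (metis row_img img_times pt_block_img)
  then show "on_blocks (p * q) (block_num b) = (on_blocks p \<circ> on_blocks q) (block_num b)" by simp
qed (simp_all add: on_blocks_outside)

lemma on_blocks_one: "on_blocks 1 = id"
proof (rule eq_on_blocks)
  fix b show "on_blocks 1 (block_num b) = id (block_num b)"
    by (cases b) (simp_all add: one_semi_def del: block_num.simps)
qed (simp_all add: on_blocks_outside)

text \<open>The images of the \<open>T0\<close> points are the rows, and the image of a single
  \<open>T1\<close> point reveals whether shifts are inverted.\<close>

lemma realize_inject: "realize p = realize q \<longleftrightarrow> p = q"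
proof
  assume h: "realize p = realize q"
  have "point (img p x) = point (img q x)" for x
    using h realize_point by metis
  then have img: "img p = img q" using inj_point by (auto simp: inj_def)
  then have row: "row p = row q" using row_img by presburger
  obtain c d where cd: "row p B1 = Pt c d" by (cases "row p B1")
  have "img p (Pt B1 T1) = img q (Pt B1 T1)" using img by simp
  then have f: "inverting p = inverting q"
    using cd row by (cases "inverting p"; cases "inverting q"; cases d) simp_all
  have "row p b = row q b" for b using row by simp
  from this[of B1] this[of B2] this[of B3] this[of B4] this[of B5] this[of B6] f
  show "p = q" by (cases p; cases q) simp
qed simp

text \<open>The generator \<open>v2\<close> as a product of two involutions, which places it in
  \<open>word_group\<close>.\<close>

definition v2_code :: semi where "v2_code = i1245 * i2536"

lemma transpose_outside: "n \<noteq> a \<Longrightarrow> n \<noteq> b \<Longrightarrow> transpose a b n = n"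
  by (simp add: transpose_def)

lemma v1_realize: "v1 = realize i1234"
proof (rule eq_on_points)
  fix x
  obtain b e where x: "x = Pt b e" by (cases x)
  show "v1 (point x) = realize i1234 (point x)"
    unfolding realize_point unfolding x
    by (cases b; cases e) (simp_all add: v1_def i1234_def transpose_def)
next
  fix n :: nat assume "n \<notin> {1..18}"
  then have "n = 0 \<or> n > 18" by auto
  then have "v1 n = n" by (elim disjE) (simp_all add: v1_def id_outside_supp del: cycle_of_list.simps)
  then show "v1 n = realize i1234 n" using realize_outside[OF \<open>n \<notin> {1..18}\<close>] by presburger
qed

lemma v2_realize: "v2 = realize v2_code"
proof (rule eq_on_points)
  have c: "v2_code = Semi False (Pt B2 T2) (Pt B4 T1) (Pt B6 T0) (Pt B5 T0) (Pt B1 T0) (Pt B3 T0)" by code_simp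
  fix x
  obtain b e where x: "x = Pt b e" by (cases x)
  show "v2 (point x) = realize v2_code (point x)"
    unfolding realize_point unfolding x
    by (cases b; cases e) (simp_all add: v2_def c transpose_def)
next
  fix n :: nat assume "n \<notin> {1..18}"
  then have "n = 0 \<or> n > 18" by auto
  then have "v2 n = n" by (elim disjE) (simp_all add: v2_def id_outside_supp del: cycle_of_list.simps)
  then show "v2 n = realize v2_code n" using realize_outside[OF \<open>n \<notin> {1..18}\<close>] by presburger
qed

lemma s1_on_blocks: "s1 = on_blocks i1234"
proof (rule eq_on_blocks)
  fix b show "s1 (block_num b) = on_blocks i1234 (block_num b)"
    unfolding on_blocks_num by (cases b) (simp_all add: s1_def i1234_def transpose_def)
next
  fix n :: nat assume "n \<notin> {1..6}"
  then have "n = 0 \<or> n > 6" by auto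
  then have "s1 n = n" by (elim disjE) (simp_all add: s1_def id_outside_supp del: cycle_of_list.simps)
  then show "s1 n = on_blocks i1234 n" using on_blocks_outside[OF \<open>n \<notin> {1..6}\<close>] by presburger
qed

lemma s2_on_blocks: "s2 = on_blocks v2_code"
proof (rule eq_on_blocks)
  have c: "v2_code = Semi False (Pt B2 T2) (Pt B4 T1) (Pt B6 T0) (Pt B5 T0) (Pt B1 T0) (Pt B3 T0)" by code_simp
  fix b show "s2 (block_num b) = on_blocks v2_code (block_num b)"
    unfolding on_blocks_num by (cases b) (simp_all add: s2_def c transpose_def)
next
  fix n :: nat assume "n \<notin> {1..6}"
  then have "n = 0 \<or> n > 6" by auto
  then have "s2 n = n" by (elim disjE) (simp_all add: s2_def id_outside_supp del: cycle_of_list.simps)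
  then show "s2 n = on_blocks v2_code n" using on_blocks_outside[OF \<open>n \<notin> {1..6}\<close>] by presburger
qed

lemma v2_word_group: "v2_code \<in> word_group"
proof -
  have "i1245 \<in> set involutions" "i2536 \<in> set involutions" by (simp_all add: involutions_def)
  then show ?thesis
    unfolding v2_code_def using word_group_times involutions_word_group by blast
qed

lemma word_group_inverse:
  assumes "x \<in> word_group" obtains y where "y \<in> word_group" "x * y = 1" "y * x = 1"
proof -
  obtain w where w: "x = prod_list w" "set w \<subseteq> set involutions"
    using assms by (auto simp: word_group_def)
  then have "\<And>a. a \<in> set w \<Longrightarrow> a * a = 1" using sq by blast
  then show thesis
    using that[of "prod_list (rev w)"] prod_list_rev[of w] prod_list_rev[of "rev w"] w
      word_group_prod_list[of "rev w"] by simp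
qed

lemma permutes_of_inverse:
  assumes "f \<circ> g = id" "g \<circ> f = id" "\<And>n. n \<notin> A \<Longrightarrow> f n = n" shows "f permutes A"
  using o_bij[OF assms(2,1)] assms(3) by (simp add: permutes_def bij_iff)

lemma realize_permutes: "p \<in> word_group \<Longrightarrow> realize p permutes {1..18}"
  using permutes_of_inverse[of "realize p"] word_group_inverse[of p] realize_times realize_one realize_outside
  by metis

lemma sym_group_inv:
  assumes "f \<in> carrier (sym_group n)" "g \<in> carrier (sym_group n)" "g \<circ> f = id"
  shows "inv\<^bsub>sym_group n\<^esub> f = g"
  using group.inv_equality[OF sym_group_is_group] assms by (simp add: sym_group_mult sym_group_one)

lemma generators_sym: "{v1, v2} \<subseteq> carrier (sym_group 18)"
proof -
  have "i1234 \<in> word_group" by (rule involutions_word_group) (simp add: involutions_def)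
  then show ?thesis
    using realize_permutes v2_word_group by (simp add: v1_realize v2_realize sym_group_carrier)
qed

lemma valentiner_simps [simp]:
  "mult valentiner = (\<circ>)" "one valentiner = id"
  by (simp_all add: valentiner_def sym_group_def)

lemma valentiner_group: "group valentiner"
  unfolding valentiner_def
  using group.subgroup_imp_group[OF sym_group_is_group group.generate_is_subgroup[OF sym_group_is_group generators_sym]] .

text \<open>For the inclusion of \<open>word_group\<close> it is enough to reach
  \<open>base_triple\<close> from the two generators, and conjugating \<open>i1234\<close> by
  \<open>v2_code\<close> once and twice does so.\<close>

lemma valentiner_carrier: "carrier valentiner = realize ` word_group"
proof
  have i: "i1234 \<in> word_group" by (rule involutions_word_group) (simp add: involutions_def)
  show "carrier valentiner \<subseteq> realize ` word_group"
  proof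
    fix v assume "v \<in> carrier valentiner"
    then have "v \<in> generate (sym_group 18) {v1, v2}" by (simp add: valentiner_def)
    then show "v \<in> realize ` word_group"
    proof (induction rule: generate.induct)
      case one
      have "id \<in> realize ` word_group" using word_group_one realize_one by (metis imageI)
      then show ?case by (simp only: sym_group_one)
    next
      case (incl h)
      then show ?case using i v2_word_group v1_realize v2_realize by auto
    next
      case (inv h)
      then obtain p where p: "h = realize p" "p \<in> word_group"
        using i v2_word_group v1_realize v2_realize by auto
      obtain q where q: "q \<in> word_group" "q * p = 1" using word_group_inverse[OF p(2)] by metis
      have "inv\<^bsub>sym_group 18\<^esub> h = realize q"
        using p q realize_permutes realize_times[of q p]
        by (intro sym_group_inv) (simp_all add: sym_group_carrier realize_one)
      then show ?case using q by simp
    next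
      case (eng h1 h2)
      then obtain p q where "p \<in> word_group" "q \<in> word_group" "h1 = realize p" "h2 = realize q" by blast
      then show ?case
        using word_group_times[of p q] realize_times[of p q] by (metis imageI sym_group_mult)
    qed
  qed
  interpret V: group valentiner by (rule valentiner_group)
  define N where "N = {a \<in> word_group. realize a \<in> carrier valentiner}"
  have mult: "a * b \<in> N" if "a \<in> N" "b \<in> N" for a b
    using that V.m_closed[of "realize a" "realize b"] word_group_times
    by (auto simp: N_def realize_times)
  have "v1 \<in> carrier valentiner" "v2 \<in> carrier valentiner"
    by (simp_all add: valentiner_def generate.incl)
  then have N1: "i1234 \<in> N" "v2_code \<in> N"
    using i v2_word_group by (simp_all add: N_def v1_realize v2_realize)
  \<comment> \<open>The inverse of \<open>v2_code\<close>, an element of order 4, written as its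
    cube.\<close>
  have "i2536 * i1245 = v2_code * (v2_code * v2_code)" by code_simp
  then have v3: "i2536 * i1245 \<in> N" using mult[OF N1(2) mult[OF N1(2) N1(2)]] by (simp only:)
  have "i1526 = i2536 * i1245 * (i1234 * v2_code)" by code_simp
  then have i1526: "i1526 \<in> N" using mult[OF v3 mult[OF N1]] by (simp only:)
  have "i1345 = i2536 * i1245 * (i1526 * v2_code)" by code_simp
  then have "i1345 \<in> N" using mult[OF v3 mult[OF i1526 N1(2)]] by (simp only:)
  then have "set base_triple \<subseteq> N" using N1 i1526 by (simp add: base_triple_def)
  moreover have "cnj_closed N" unfolding cnj_closed_def cnj_def using mult by blast
  ultimately have "set involutions \<subseteq> N" by (metis cnj_closed_base)
  moreover have "prod_list w \<in> N" if "set w \<subseteq> N" for w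
    using that
  proof (induction w)
    case Nil
    show ?case using V.one_closed word_group_one by (simp add: N_def realize_one)
  qed (simp add: mult)
  ultimately have "word_group \<subseteq> N"
    unfolding word_group_def by blast
  then show "realize ` word_group \<subseteq> carrier valentiner" by (auto simp: N_def)
qed

section \<open>Double transpositions and generation of A6\<close>

lemma transpose_disjoint_commute:
  "distinct [a, b, c, d] \<Longrightarrow> transpose a b \<circ> transpose c d = transpose c d \<circ> transpose a b"
  by (auto simp: fun_eq_iff transpose_def)

text \<open>A normal form for double transpositions: \<open>a\<close> is the least point moved and
  \<open>c < d\<close>. The 45 quadruples come in the order of \<open>involutions\<close>, so that
  \<open>list_all2\<close> can match them.\<close>

definition supports :: "(nat \<times> nat \<times> nat \<times> nat) list" where
  "supports = [(a, b, c, d). a \<leftarrow> [1..<7], b \<leftarrow> [Suc a..<7], c \<leftarrow> [Suc a..<7], d \<leftarrow> [Suc c..<7], c \<noteq> b \<and> d \<noteq> b]"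

definition blocks :: "block list" where "blocks = [B1, B2, B3, B4, B5, B6]"

lemma blocks: "x \<in> set blocks"
  unfolding blocks_def by (cases x) simp_all

definition is_support :: "semi \<Rightarrow> nat \<times> nat \<times> nat \<times> nat \<Rightarrow> bool" where
  "is_support i = (\<lambda>(a, b, c, d). list_all
     (\<lambda>x. (transpose a b \<circ> transpose c d) (block_num x) = block_num (pt_block (row i x))) blocks)"

lemma supports_ok: "list_all2 is_support involutions supports"
  by code_simp

lemma on_blocks_support:
  assumes "is_support i (a, b, c, d)" "{a, b, c, d} \<subseteq> {1..6}"
  shows "on_blocks i = transpose a b \<circ> transpose c d"
proof (rule eq_on_blocks)
  fix x show "on_blocks i (block_num x) = (transpose a b \<circ> transpose c d) (block_num x)"
    using assms(1) blocks[of x] by (simp add: is_support_def list_all_iff)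
next
  fix n :: nat assume n: "n \<notin> {1..6}"
  then have "n \<noteq> a" "n \<noteq> b" "n \<noteq> c" "n \<noteq> d" using assms(2) by blast+
  then show "on_blocks i n = (transpose a b \<circ> transpose c d) n"
    by (simp add: on_blocks_outside[OF n] transpose_outside)
qed

lemma set_supports: "(a, b, c, d) \<in> set supports \<longleftrightarrow>
    1 \<le> a \<and> a < b \<and> a < c \<and> c < d \<and> b \<le> 6 \<and> d \<le> 6 \<and> c \<noteq> b \<and> d \<noteq> b"
  unfolding supports_def by auto

lemma C22_supports:
  assumes "g \<in> C22" obtains a b c d where "(a, b, c, d) \<in> set supports" "g = transpose a b \<circ> transpose c d"
proof -
  obtain a b c d where g: "g = transpose a b \<circ> transpose c d" "distinct [a, b, c, d]" "{a, b, c, d} \<subseteq> {1..6}"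
    using assms unfolding C22_def by blast
  have "\<exists>a' b'. {a', b'} = {a, b} \<and> a' < b' \<and> transpose a b = transpose a' b'"
    using g(2) transpose_commute[of a b] by (cases "a < b") (blast, metis distinct_length_2_or_more insert_commute linorder_less_linear)
  then obtain a' b' where a': "{a', b'} = {a, b}" "a' < b'" "transpose a b = transpose a' b'" by blast
  have "\<exists>c' d'. {c', d'} = {c, d} \<and> c' < d' \<and> transpose c d = transpose c' d'"
    using g(2) transpose_commute[of c d] by (cases "c < d") (blast, metis distinct_length_2_or_more insert_commute linorder_less_linear)
  then obtain c' d' where c': "{c', d'} = {c, d}" "c' < d'" "transpose c d = transpose c' d'" by blast
  have d: "distinct [a', b', c', d']" using g(2) a' c' by (auto simp: doubleton_eq_iff)
  have r: "{a', b', c', d'} \<subseteq> {1..6}" using g(3) a' c' by (auto simp: doubleton_eq_iff)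
  show thesis
  proof (cases "a' < c'")
    case True
    then have "(a', b', c', d') \<in> set supports" using a'(2) c'(2) d r by (simp add: set_supports)
    then show ?thesis using that g(1) a'(3) c'(3) by metis
  next
    case False
    then have "(c', d', a', b') \<in> set supports" using a'(2) c'(2) d r by (auto simp: set_supports)
    then show ?thesis using that g(1) a'(3) c'(3) transpose_disjoint_commute[OF d] by metis
  qed
qed

lemma list_all2_ex2: "list_all2 P xs ys \<Longrightarrow> y \<in> set ys \<Longrightarrow> \<exists>x\<in>set xs. P x y"
  by (induction rule: list_all2_induct) auto

lemma C22_on_blocks: "C22 = on_blocks ` set involutions"
proof
  show "C22 \<subseteq> on_blocks ` set involutions"
  proof
    fix g assume "g \<in> C22"
    then obtain a b c d where g: "(a, b, c, d) \<in> set supports" "g = transpose a b \<circ> transpose c d"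
      by (rule C22_supports)
    from list_all2_ex2[OF supports_ok g(1)] obtain i where i: "i \<in> set involutions" "is_support i (a, b, c, d)"
      by blast
    have "g = on_blocks i" using on_blocks_support[OF i(2)] g by (auto simp: set_supports)
    then show "g \<in> on_blocks ` set involutions" using i by blast
  qed
  show "on_blocks ` set involutions \<subseteq> C22"
  proof
    fix g assume "g \<in> on_blocks ` set involutions"
    then obtain i where i: "i \<in> set involutions" "g = on_blocks i" by blast
    from list_all2_ex[OF supports_ok i(1)] obtain p where p: "p \<in> set supports" "is_support i p" by blast
    obtain a b c d where "p = (a, b, c, d)" by (rule prod_cases4)
    with p have s: "(a, b, c, d) \<in> set supports" "is_support i (a, b, c, d)" by simp_all
    have "g = transpose a b \<circ> transpose c d"
      using on_blocks_support[OF s(2)] s(1) i by (auto simp: set_supports)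
    moreover have "distinct [a, b, c, d]" "{a, b, c, d} \<subseteq> {1..6}"
      using s(1) by (auto simp: set_supports)
    ultimately show "g \<in> C22" unfolding C22_def by blast
  qed
qed

text \<open>Makes the involution over a member of \<open>C22\<close> unique and lets tuples be
  identified with words.\<close>

lemma inj_on_blocks: "inj_on on_blocks (set involutions)"
proof -
  have d: "distinct (map (\<lambda>i. map (\<lambda>x. pt_block (row i x)) blocks) involutions)"
    by code_simp
  have "map (\<lambda>x. pt_block (row i x)) blocks = map (\<lambda>x. pt_block (row j x)) blocks"
    if "on_blocks i = on_blocks j" for i j
  proof -
    have "block_num (pt_block (row i x)) = block_num (pt_block (row j x))" for x
      using that on_blocks_num by metis
    then have "pt_block (row i x) = pt_block (row j x)" for x
      using inj_block_num by (auto simp: inj_def)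
    then show ?thesis by simp
  qed
  moreover have "inj_on (\<lambda>i. map (\<lambda>x. pt_block (row i x)) blocks) (set involutions)"
    using d unfolding distinct_map by blast
  ultimately show ?thesis by (meson inj_on_def)
qed

lemma on_blocks_cnj: "on_blocks (cnj b a) = on_blocks b \<circ> on_blocks a \<circ> on_blocks b"
  by (simp add: cnj_def on_blocks_times)

lemma on_blocks_cnjs: "on_blocks (cnjs ss a)
    = on_blocks (prod_list ss) \<circ> on_blocks a \<circ> on_blocks (prod_list (rev ss))"
  by (induction ss) (simp_all add: on_blocks_cnj on_blocks_times on_blocks_one comp_assoc)

lemma on_blocks_sq: "s * s = 1 \<Longrightarrow> on_blocks s \<circ> on_blocks s = id"
  by (metis on_blocks_one on_blocks_times)

lemma C22_alt: "C22 \<subseteq> carrier (alt_group 6)"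
proof
  fix g assume "g \<in> C22"
  then obtain a b c d where g: "g = transpose a b \<circ> transpose c d" "distinct [a, b, c, d]" "{a, b, c, d} \<subseteq> {1..6}"
    unfolding C22_def by blast
  then have "g permutes {1..6}" by (auto intro!: permutes_compose permutes_swap_id)
  moreover have "evenperm g"
    using g by (simp add: evenperm_comp permutation_swap_id evenperm_swap)
  ultimately show "g \<in> carrier (alt_group 6)" by (simp add: alt_group_carrier)
qed

interpretation A6: group "alt_group 6" by (rule alt_group_is_group)
interpretation S6: group "sym_group 6" by (rule sym_group_is_group)
interpretation V: group valentiner by (rule valentiner_group)

text \<open>The group is generated by 3-cycles, and a 3-cycle on \<open>a\<close>, \<open>b\<close>,
  \<open>c\<close> is a product of two double transpositions sharing the factor
  \<open>transpose d e\<close>, with \<open>d\<close> and \<open>e\<close> among the three remaining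
  points.\<close>

lemma generate_C22: "generate (alt_group 6) C22 = carrier (alt_group 6)"
proof
  show "generate (alt_group 6) C22 \<subseteq> carrier (alt_group 6)"
    by (rule A6.generate_incl[OF C22_alt])
  have "three_cycles 6 \<subseteq> generate (alt_group 6) C22"
  proof
    fix p assume "p \<in> three_cycles 6"
    then obtain cs where cs: "p = cycle_of_list cs" "cycle cs" "length cs = 3" "set cs \<subseteq> {1..6}"
      by auto
    obtain a b c where abc: "cs = [a, b, c]" using stupid_lemma[OF cs(3)] by blast
    have "card ({1..6} - {a, b, c}) \<ge> 2"
      using cs abc by (subst card_Diff_subset) (auto simp: card_insert_if)
    then obtain T where "T \<subseteq> {1..6} - {a, b, c}" "card T = 2" by (metis obtain_subset_with_card_n)
    then obtain d e where de: "{d, e} \<subseteq> {1..6} - {a, b, c}" "d \<noteq> e" by (metis card_2_iff)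
    have "transpose a b \<circ> transpose d e \<in> C22" "transpose d e \<circ> transpose b c \<in> C22"
      unfolding C22_def using de cs abc by fastforce+
    moreover have "p = (transpose a b \<circ> transpose d e) \<circ> (transpose d e \<circ> transpose b c)"
      using cs abc by (simp add: fun_eq_iff)
    ultimately show "p \<in> generate (alt_group 6) C22"
      using generate.eng[OF generate.incl generate.incl, of _ C22 _ "alt_group 6"] by (simp add: alt_group_mult)
  qed
  then show "carrier (alt_group 6) \<subseteq> generate (alt_group 6) C22"
    using A6.generate_subgroup_incl[OF _ A6.generate_is_subgroup[OF C22_alt]]
    unfolding alt_group_carrier_as_three_cycles[of 6] by blast
qed

lemma C22_inv:
  assumes "g \<in> C22" shows "inv\<^bsub>alt_group 6\<^esub> g = g"
proof -
  have "g \<circ> g = id" using assms on_blocks_sq sq unfolding C22_on_blocks by blast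
  then show ?thesis
    using A6.inv_equality[of g g] C22_alt assms by (auto simp: alt_group_mult alt_group_one)
qed

lemma generate_involutions:
  assumes "S \<subseteq> set involutions"
  shows "h \<in> generate (alt_group 6) (on_blocks ` S) \<Longrightarrow> \<exists>ss. set ss \<subseteq> S \<and> h = on_blocks (prod_list ss)"
proof (induction rule: generate.induct)
  case one
  then show ?case by (intro exI[of _ "[]"]) (simp add: alt_group_one on_blocks_one)
next
  case (incl h)
  then obtain a where "a \<in> S" "h = on_blocks a" by blast
  then show ?case by (intro exI[of _ "[a]"]) simp
next
  case (inv h)
  then obtain a where a: "a \<in> S" "h = on_blocks a" by blast
  then have "inv\<^bsub>alt_group 6\<^esub> h = on_blocks a" using C22_inv C22_on_blocks assms by blast
  then show ?case using a by (intro exI[of _ "[a]"]) simp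
next
  case (eng h1 h2)
  then obtain ss ts where "set ss \<subseteq> S" "h1 = on_blocks (prod_list ss)" "set ts \<subseteq> S" "h2 = on_blocks (prod_list ts)"
    by blast
  then show ?case by (intro exI[of _ "ss @ ts"]) (simp add: alt_group_mult on_blocks_times)
qed

lemma alt_word:
  assumes "h \<in> carrier (alt_group 6)" obtains ss where "set ss \<subseteq> set involutions" "h = on_blocks (prod_list ss)"
  using generate_involutions[of "set involutions" h] assms generate_C22 C22_on_blocks by auto

lemma odd_inv_on_blocks: "on_blocks odd_inv = transpose 5 6"
proof (rule eq_on_blocks)
  fix x show "on_blocks odd_inv (block_num x) = transpose 5 6 (block_num x)"
    unfolding on_blocks_num by (cases x) (simp_all add: odd_inv_def transpose_def)
qed (auto simp: on_blocks_outside transpose_def)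

text \<open>\<open>odd_inv\<close> lies over the transposition of 5 and 6, and composing with it
  makes an odd permutation even. Conjugation by any element of S6 is thereby expressed through
  \<open>cnjs\<close>.\<close>

lemma sym_word:
  assumes "s \<in> carrier (sym_group 6)"
  obtains ss where "set ss \<subseteq> set normal_involutions" "s = on_blocks (prod_list ss)"
proof (cases "evenperm s")
  case True
  then have "s \<in> carrier (alt_group 6)" using assms by (simp add: sym_group_carrier alt_group_carrier)
  then show ?thesis using alt_word that by (metis set_subset_Cons subset_trans)
next
  case False
  have t: "transpose 5 6 permutes {1..6::nat}" by (rule permutes_swap_id) auto
  have "evenperm (transpose 5 6 \<circ> s)"
    using False sym_group_carrier'[OF assms] by (simp add: evenperm_comp permutation_swap_id evenperm_swap)
  then have "transpose 5 6 \<circ> s \<in> carrier (alt_group 6)"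
    using assms t by (auto simp: sym_group_carrier alt_group_carrier intro: permutes_compose)
  then obtain ss where ss: "set ss \<subseteq> set involutions" "transpose 5 6 \<circ> s = on_blocks (prod_list ss)"
    by (rule alt_word)
  have "s = transpose 5 6 \<circ> (transpose 5 6 \<circ> s)" by (simp add: fun_eq_iff)
  then have "s = on_blocks (prod_list (odd_inv # ss))"
    using ss by (simp add: on_blocks_times odd_inv_on_blocks)
  then show ?thesis using that[of "odd_inv # ss"] ss by auto
qed

section \<open>The projection to A6, lifts of involutions and the kernel\<close>

lemma on_blocks_alt: "p \<in> word_group \<Longrightarrow> on_blocks p \<in> carrier (alt_group 6)"
proof -
  have "on_blocks (prod_list w) \<in> carrier (alt_group 6)" if "set w \<subseteq> set involutions" for w
    using that
  proof (induction w)
    case Nil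
    then show ?case using A6.one_closed by (simp only: prod_list.Nil on_blocks_one alt_group_one)
  next
    case (Cons a w)
    then have "on_blocks a \<in> carrier (alt_group 6)" using C22_alt C22_on_blocks by auto
    moreover have "on_blocks (prod_list w) \<in> carrier (alt_group 6)" using Cons by simp
    ultimately have "on_blocks a \<circ> on_blocks (prod_list w) \<in> carrier (alt_group 6)"
      using A6.m_closed by (metis alt_group_mult)
    then show ?case by (simp only: prod_list.Cons on_blocks_times)
  qed
  then show "p \<in> word_group \<Longrightarrow> on_blocks p \<in> carrier (alt_group 6)"
    by (auto simp: word_group_def)
qed

text \<open>\<open>on_blocks\<close> provides a homomorphism with the required values at
  \<open>v1\<close> and \<open>v2\<close>, so the choice operator returns one, and any two agree on
  the group generated.\<close>

lemma valentiner_proj_realize: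
  assumes "p \<in> word_group" shows "valentiner_proj (realize p) = on_blocks p"
proof -
  define q where "q v = on_blocks (inv' realize v)" for v
  have "inj realize" by (simp add: inj_def realize_inject)
  then have q: "q (realize p) = on_blocks p" for p by (simp add: q_def)
  have qhom: "q \<in> hom valentiner (alt_group 6)"
    using on_blocks_alt
    by (auto simp: hom_def valentiner_carrier q realize_times[symmetric] on_blocks_times alt_group_mult)
  have "q \<in> hom valentiner (alt_group 6) \<and> q v1 = s1 \<and> q v2 = s2"
    using qhom q by (simp add: v1_realize v2_realize s1_on_blocks s2_on_blocks)
  then have P: "valentiner_proj \<in> hom valentiner (alt_group 6) \<and> valentiner_proj v1 = s1 \<and> valentiner_proj v2 = s2"
    unfolding valentiner_proj_def
    by (rule someI[where P = "\<lambda>p. p \<in> hom valentiner (alt_group 6) \<and> p v1 = s1 \<and> p v2 = s2"])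
  have gens: "{v1, v2} \<subseteq> carrier valentiner" by (auto simp: valentiner_def generate.incl)
  have "v \<in> carrier valentiner \<and> valentiner_proj v = q v" if "v \<in> generate valentiner {v1, v2}" for v
    using that
  proof (induction rule: generate.induct)
    case one
    show ?case
      using P qhom hom_one[OF _ V.is_group A6.is_group] V.one_closed by metis
  next
    case (incl h)
    then show ?case using P gens q by (auto simp: v1_realize v2_realize s1_on_blocks s2_on_blocks)
  next
    case (inv h)
    then have "h \<in> carrier valentiner" "valentiner_proj h = q h"
      using P gens q by (auto simp: v1_realize v2_realize s1_on_blocks s2_on_blocks)
    moreover have "group_hom valentiner (alt_group 6) valentiner_proj" "group_hom valentiner (alt_group 6) q"
      using P qhom V.is_group A6.is_group by (auto simp: group_hom_def group_hom_axioms_def)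
    ultimately show ?case using group_hom.hom_inv V.inv_closed by metis
  next
    case (eng h1 h2)
    then show ?case using P qhom V.m_closed by (metis hom_mult)
  qed
  moreover have "generate valentiner {v1, v2} = carrier valentiner"
    using group.generate_consistent[OF sym_group_is_group _ group.generate_is_subgroup[OF sym_group_is_group generators_sym],
        of "{v1, v2}"] generate.incl[of _ "{v1, v2}" "sym_group 18"]
    by (auto simp: valentiner_def)
  ultimately show ?thesis using assms q valentiner_carrier by auto
qed

lemma ord_prime:
  assumes "group G" "x \<in> carrier G" "q \<noteq> 1" "\<And>d. d dvd q \<Longrightarrow> d = 1 \<or> d = q"
  shows "group.ord G x = q \<longleftrightarrow> x \<noteq> \<one>\<^bsub>G\<^esub> \<and> x [^]\<^bsub>G\<^esub> q = \<one>\<^bsub>G\<^esub>"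
  using group.pow_eq_id[OF assms(1,2), of q] group.ord_eq_1[OF assms(1,2)] assms(3,4)
  by (metis dvd_refl)

lemma realize_eq_id: "realize p = id \<longleftrightarrow> p = 1"
  by (metis realize_one realize_inject)

lemma ord_realize:
  assumes "p \<in> word_group"
  shows "group.ord valentiner (realize p) = 2 \<longleftrightarrow> lev1 p"
    and "group.ord valentiner (realize p) = 3 \<longleftrightarrow> p \<noteq> 1 \<and> p * p * p = 1"
proof -
  have c: "realize p \<in> carrier valentiner" using assms valentiner_carrier by blast
  have "realize p [^]\<^bsub>valentiner\<^esub> (2::nat) = realize (p * p)" "realize p [^]\<^bsub>valentiner\<^esub> (3::nat) = realize (p * p * p)"
    by (simp_all add: numeral_eq_Suc realize_times)
  moreover have "d = 1 \<or> d = 2" if "d dvd 2" for d :: nat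
  proof -
    have "d \<le> 2" using that by (rule dvd_imp_le) simp
    then consider "d = 0" | "d = 1" | "d = 2" by linarith
    then show ?thesis using that by cases simp_all
  qed
  moreover have "d = 1 \<or> d = 3" if "d dvd 3" for d :: nat
  proof -
    have "d \<le> 3" using that by (rule dvd_imp_le) simp
    then consider "d = 0" | "d = 1" | "d = 2" | "d = 3" by linarith
    then show ?thesis using that by cases simp_all
  qed
  ultimately show "group.ord valentiner (realize p) = 2 \<longleftrightarrow> lev1 p"
    "group.ord valentiner (realize p) = 3 \<longleftrightarrow> p \<noteq> 1 \<and> p * p * p = 1"
    using ord_prime[OF valentiner_group c, of 2] ord_prime[OF valentiner_group c, of 3]
    by (simp_all add: realize_eq_id lev1_def)
qed

text \<open>Uniqueness holds because an element of order 2 is one of the 45 letters, and these are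
  separated by their action on the blocks.\<close>

lemma inv_lift_on_blocks:
  assumes "a \<in> set involutions" shows "inv_lift (on_blocks a) = realize a"
  unfolding inv_lift_def
proof (rule the_equality)
  have "a \<in> word_group" "lev1 a"
    using assms involutions_word_group lev1_involutions by blast+
  then show "realize a \<in> carrier valentiner \<and> valentiner_proj (realize a) = on_blocks a \<and> group.ord valentiner (realize a) = 2"
    using valentiner_carrier valentiner_proj_realize ord_realize(1) by blast
  fix v assume v: "v \<in> carrier valentiner \<and> valentiner_proj v = on_blocks a \<and> group.ord valentiner v = 2"
  then obtain p where p: "p \<in> word_group" "v = realize p" using valentiner_carrier by blast
  then have "p \<in> set involutions" "on_blocks p = on_blocks a"
    using v ord_realize(1) lev1_involutions valentiner_proj_realize by auto
  then have "p = a" using assms inj_on_blocks by (auto simp: inj_on_def)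
  then show "v = realize a" using p by simp
qed

lemma lifting_invariant_on_blocks:
  assumes "set w \<subseteq> set involutions"
  shows "lifting_invariant (map on_blocks w) = realize (prod_list w)"
  using assms unfolding lifting_invariant_def tuple_prod_def
  by (induction w) (simp_all add: realize_one realize_times inv_lift_on_blocks)

lemma tuple_prod_on_blocks: "tuple_prod (alt_group 6) (map on_blocks w) = on_blocks (prod_list w)"
  unfolding tuple_prod_def
  by (induction w) (simp_all add: on_blocks_one on_blocks_times alt_group_one alt_group_mult)

text \<open>Triviality on blocks is unaffected by conjugation, and among the representatives only 1
  and \<open>z1\<close> have it; \<open>z2\<close> enters as a conjugate of
  \<open>z1\<close>.\<close>

lemma kernel_on_blocks:
  assumes "p \<in> word_group" "on_blocks p = id" shows "p = 1 \<or> p = z1 \<or> p = z2"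
proof -
  obtain r ss where r: "r \<in> set reps" "set ss \<subseteq> set normal_involutions" "p = cnjs ss r"
    using word_group_class[OF assms(1)] .
  have n: "set ss \<subseteq> normalizers" using r normalizers by blast
  have "on_blocks (cnjs ts x) = id" if "on_blocks x = id" "set ts \<subseteq> normalizers" for ts x
    using that
  proof (induction ts)
    case (Cons s ts)
    then have s: "s \<in> normalizers" "set ts \<subseteq> normalizers" by simp_all
    show ?case
      by (simp only: cnjs_simps on_blocks_cnj Cons.IH[OF Cons.prems(1) s(2)] comp_id
          on_blocks_sq[OF normalizers_sq[OF s(1)]])
  qed simp
  from this[of p "rev ss"] have "on_blocks r = id"
    using assms n by (simp add: r cnjs_rev)
  then have "block_num (pt_block (row r x)) = block_num x" for x
    using on_blocks_num[of r x] by simp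
  then have "list_all (\<lambda>x. pt_block (row r x) = x) blocks"
    using inj_block_num by (auto simp: inj_def list_all_iff)
  moreover have "list_all (\<lambda>r. list_all (\<lambda>x. pt_block (row r x) = x) blocks \<longrightarrow> r = 1 \<or> r = z1) reps"
    by code_simp
  ultimately have "r = 1 \<or> r = z1" using r by (auto simp: list_all_iff)
  then show ?thesis
  proof
    assume "r = z1"
    then show ?thesis using cnjs_z[OF r(2), of r] r by auto
  qed (use r cnjs_one[OF n] in simp)
qed

text \<open>Applying \<open>cnj i1245\<close> and then \<open>cnj i2536\<close> is conjugation by
  \<open>v2_code\<close>, which carries \<open>i1234\<close> through \<open>base_triple\<close>;
  closure does the rest.\<close>

lemma cnjs_transitive:
  assumes "x \<in> set involutions" shows "\<exists>ss. set ss \<subseteq> set involutions \<and> x = cnjs ss i1234"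
proof -
  define N where "N = {cnjs ss i1234 | ss. set ss \<subseteq> set involutions}"
  have i: "i1234 \<in> set involutions" "i2536 \<in> set involutions" "i1245 \<in> set involutions"
    by (simp_all add: involutions_def)
  have sub: "N \<subseteq> set involutions"
    unfolding N_def using cnjs_C i C_normalizers by blast
  have step: "cnj y x \<in> N" if x: "x \<in> N" and y: "y \<in> set involutions" for x y
  proof -
    obtain ss where "x = cnjs ss i1234" "set ss \<subseteq> set involutions"
      using x unfolding N_def by blast
    then show ?thesis unfolding N_def using y by (intro CollectI exI[of _ "y # ss"]) simp
  qed
  have N: "i1234 \<in> N" unfolding N_def by (intro CollectI exI[of _ "[]"]) simp
  have "i1526 = cnj i2536 (cnj i1245 i1234)" by code_simp
  then have N1: "i1526 \<in> N" using step[OF step[OF N i(3)] i(2)] by (simp only:)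
  have "i1345 = cnj i2536 (cnj i1245 i1526)" by code_simp
  then have "i1345 \<in> N" using step[OF step[OF N1 i(3)] i(2)] by (simp only:)
  then have "set base_triple \<subseteq> N" using N N1 by (simp add: base_triple_def)
  moreover have "cnj_closed N" using step sub unfolding cnj_closed_def by blast
  ultimately have "x \<in> N" using cnj_closed_base assms by blast
  then show ?thesis by (auto simp: N_def)
qed

text \<open>The involutions over a subgroup form a closed set, which gives one direction.
  Conversely, if the letters generate A6, a closed set of involutions containing them is stable
  under conjugation by every involution; being nonempty, it is the whole class by
  transitivity.\<close>

lemma gen_iff_generate:
  assumes w: "set w \<subseteq> set involutions"
  shows "gen w \<longleftrightarrow> generate (alt_group 6) (set (map on_blocks w)) = carrier (alt_group 6)"
proof
  have sub: "set (map on_blocks w) \<subseteq> carrier (alt_group 6)"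
    using w C22_alt C22_on_blocks by auto
  {
    assume "gen w"
    define H where "H = generate (alt_group 6) (set (map on_blocks w))"
    have "f \<circ> g \<in> H" if "f \<in> H" "g \<in> H" for f g
      using generate.eng[of f "alt_group 6" _ g] that unfolding H_def by (simp add: alt_group_mult)
    then have "cnj_closed {a. on_blocks a \<in> H}"
      unfolding cnj_closed_def by (simp add: on_blocks_cnj)
    moreover have "set w \<subseteq> {a. on_blocks a \<in> H}"
      unfolding H_def by (auto intro: generate.incl)
    ultimately have "set involutions \<subseteq> {a. on_blocks a \<in> H}"
      using \<open>gen w\<close> unfolding gen_def by blast
    then have C: "C22 \<subseteq> H" unfolding C22_on_blocks by blast
    show "generate (alt_group 6) (set (map on_blocks w)) = carrier (alt_group 6)"
      using A6.generate_subgroup_incl[OF C[unfolded H_def] A6.generate_is_subgroup[OF sub]]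
        A6.generate_incl[OF sub] generate_C22 by simp
  }
  assume g: "generate (alt_group 6) (set (map on_blocks w)) = carrier (alt_group 6)"
  show "gen w"
    unfolding gen_alt
  proof (intro conjI allI impI w)
    fix M assume M: "cnj_closed M" "M \<subseteq> set involutions" "set w \<subseteq> M"
    have conj: "\<exists>a'\<in>M. cnjs ss a = a'" if "set ss \<subseteq> set w" "a \<in> M" for ss a
      using that M by (induction ss) (auto simp: cnj_closed_def)
    have normal: "cnj b a \<in> M" if "a \<in> M" "b \<in> set involutions" for a b
    proof -
      have "on_blocks b \<in> generate (alt_group 6) (on_blocks ` set w)"
        using g C22_alt C22_on_blocks that by auto
      then obtain ss where ss: "set ss \<subseteq> set w" "on_blocks b = on_blocks (prod_list ss)"
        using generate_involutions[OF w] by blast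
      have "prod_list ss * prod_list (rev ss) = 1" using prod_list_rev[of ss] sq ss w by blast
      then have "on_blocks (prod_list ss) \<circ> on_blocks (prod_list (rev ss)) = id"
        by (metis on_blocks_times on_blocks_one)
      moreover have "on_blocks b \<circ> on_blocks b = id" using on_blocks_sq sq that by blast
      ultimately have "on_blocks (prod_list (rev ss)) = on_blocks b"
        using ss(2) by (metis comp_assoc comp_id id_comp)
      \<comment> \<open>Conjugation by \<open>b\<close> and by the word \<open>ss\<close> are
        compared on the blocks only; injectivity on the involutions lifts the equality.\<close>
      then have "on_blocks (cnjs ss a) = on_blocks (cnj b a)"
        using ss by (simp add: on_blocks_cnjs on_blocks_cnj)
      moreover have "cnjs ss a \<in> M" using conj ss that by blast
      ultimately show ?thesis
        using inj_on_blocks M that closed[of a b] by (metis inj_on_def subsetD)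
    qed
    have normals: "cnjs ss a \<in> M" if "set ss \<subseteq> set involutions" "a \<in> M" for ss a
      using that normal by (induction ss) auto
    \<comment> \<open>The empty set is closed too, so a letter to start from is required; the empty
      word would generate the trivial group.\<close>
    have "set w \<noteq> {}"
    proof
      assume "set w = {}"
      then have "carrier (alt_group 6) = {id}"
        using g A6.generate_empty by (simp add: alt_group_one)
      moreover have "on_blocks i1234 \<in> carrier (alt_group 6)"
        using C22_alt C22_on_blocks by (auto simp: involutions_def)
      moreover have "on_blocks i1234 (block_num B1) = block_num B2"
        unfolding on_blocks_num by (simp add: i1234_def)
      ultimately show False by simp
    qed
    then obtain a where a: "a \<in> M" using M(3) by (metis ex_in_conv subsetD)
    then obtain ss where ss: "set ss \<subseteq> set involutions" "a = cnjs ss i1234"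
      using cnjs_transitive M by blast
    then have "i1234 \<in> M"
      using normals[of "rev ss" a] a cnjs_rev[of ss i1234] C_normalizers by (metis set_rev subset_trans)
    then have "set involutions \<subseteq> M"
      using cnjs_transitive normals by blast
    then show "M = set involutions" using M by blast
  qed
qed

section \<open>Components of the Hurwitz space\<close>

text \<open>Nielsen tuples with each entry replaced by its involutory lift: product 1 in A6 becomes
  a product in the kernel.\<close>

definition words :: "nat \<Rightarrow> semi list set" where
  "words k = {w. gen w \<and> length w = k \<and> on_blocks (prod_list w) = id}"

lemma words_subset: "w \<in> words k \<Longrightarrow> set w \<subseteq> set involutions"
  by (simp add: words_def gen_subset)

lemma words_length: "w \<in> words k \<Longrightarrow> length w = k"
  by (simp add: words_def)

lemma Ni_words: "Ni k = map on_blocks ` words k"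
proof (intro Set.set_eqI iffI)
  fix gs assume gs: "gs \<in> Ni k"
  then have "gs \<in> lists (on_blocks ` set involutions)"
    by (auto simp: nielsen_def C22_on_blocks)
  then obtain w where w: "set w \<subseteq> set involutions" "gs = map on_blocks w"
    unfolding lists_image by (auto simp: in_lists_conv_set)
  then have "w \<in> words k"
    using gs gen_iff_generate[OF w(1)] tuple_prod_on_blocks[of w]
    by (simp add: nielsen_def words_def alt_group_one)
  then show "gs \<in> map on_blocks ` words k" using w by blast
next
  fix gs assume "gs \<in> map on_blocks ` words k"
  then obtain w where w: "w \<in> words k" "gs = map on_blocks w" by blast
  then have "set gs \<subseteq> C22" using words_subset[of w k] unfolding C22_on_blocks by auto
  then show "gs \<in> Ni k"
    using w gen_iff_generate[of w] words_subset[of w k] tuple_prod_on_blocks[of w]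
    by (simp add: nielsen_def words_def alt_group_one)
qed

lemma normal_sq: "set ss \<subseteq> set normal_involutions \<Longrightarrow> s \<in> set ss \<Longrightarrow> s * s = 1"
  using normalizers normalizers_sq by blast

lemma on_blocks_sym:
  assumes "set ss \<subseteq> set normal_involutions"
  shows "on_blocks (prod_list ss) \<in> carrier (sym_group 6)"
    and "inv\<^bsub>sym_group 6\<^esub> (on_blocks (prod_list ss)) = on_blocks (prod_list (rev ss))"
proof -
  have id: "on_blocks (prod_list u) \<circ> on_blocks (prod_list (rev u)) = id"
    if "set u \<subseteq> set normal_involutions" for u
    using prod_list_rev[of u] normal_sq[OF that] by (metis on_blocks_times on_blocks_one)
  have ids: "on_blocks (prod_list ss) \<circ> on_blocks (prod_list (rev ss)) = id"
    "on_blocks (prod_list (rev ss)) \<circ> on_blocks (prod_list ss) = id"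
    using id[of ss] id[of "rev ss"] assms by simp_all
  show c: "on_blocks (prod_list ss) \<in> carrier (sym_group 6)"
    unfolding sym_group_carrier by (rule permutes_of_inverse[OF ids on_blocks_outside])
  have "on_blocks (prod_list (rev ss)) \<in> carrier (sym_group 6)"
    unfolding sym_group_carrier by (rule permutes_of_inverse[OF ids(2,1) on_blocks_outside])
  then show "inv\<^bsub>sym_group 6\<^esub> (on_blocks (prod_list ss)) = on_blocks (prod_list (rev ss))"
    using c ids by (intro sym_group_inv)
qed

text \<open>The action sends g to s^-1 g s, whereas \<open>cnjs ss\<close> sends x to s x s^-1 for s
  the product of \<open>ss\<close>; hence the reversal.\<close>

lemma conj_action_on_blocks:
  assumes "set ss \<subseteq> set normal_involutions"
  shows "conj_action (sym_group 6) (on_blocks (prod_list ss)) (map on_blocks w)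
    = map on_blocks (map (cnjs (rev ss)) w)"
  unfolding conj_action_def on_blocks_sym(2)[OF assms] sym_group_mult by (simp add: on_blocks_cnjs)

definition orb :: "semi list \<Rightarrow> (nat \<Rightarrow> nat) list set" where
  "orb w = {map on_blocks (map (cnjs ss) w) | ss. set ss \<subseteq> set normal_involutions}"

lemma orbit_orb: "Group_Action.orbit (sym_group 6) (conj_action (sym_group 6)) (map on_blocks w) = orb w"
proof (intro Set.set_eqI iffI)
  fix gs assume "gs \<in> Group_Action.orbit (sym_group 6) (conj_action (sym_group 6)) (map on_blocks w)"
  then obtain s where "s \<in> carrier (sym_group 6)" "gs = conj_action (sym_group 6) s (map on_blocks w)"
    by (auto simp: Group_Action.orbit_def)
  moreover from this(1) obtain ss where "set ss \<subseteq> set normal_involutions" "s = on_blocks (prod_list ss)"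
    by (rule sym_word)
  ultimately have "set (rev ss) \<subseteq> set normal_involutions" "gs = map on_blocks (map (cnjs (rev ss)) w)"
    by (simp_all add: conj_action_on_blocks)
  then show "gs \<in> orb w" unfolding orb_def by blast
next
  fix gs assume "gs \<in> orb w"
  then obtain ss where ss: "set ss \<subseteq> set normal_involutions" "gs = map on_blocks (map (cnjs ss) w)"
    unfolding orb_def by blast
  then have "set (rev ss) \<subseteq> set normal_involutions" by simp
  from on_blocks_sym(1)[OF this] conj_action_on_blocks[OF this, of w] ss(2)
  show "gs \<in> Group_Action.orbit (sym_group 6) (conj_action (sym_group 6)) (map on_blocks w)"
    unfolding Group_Action.orbit_def by (metis (mono_tags, lifting) mem_Collect_eq rev_rev_ident)
qed

lemma hurwitz_space_orb: "hurwitz_space k = orb ` words k"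
  unfolding hurwitz_space_def orbits_def Ni_words using orbit_orb by auto

lemma words_cnjs:
  assumes "w \<in> words k" "set ss \<subseteq> set normal_involutions" shows "map (cnjs ss) w \<in> words k"
proof -
  have n: "set ss \<subseteq> normalizers" using assms(2) normalizers by blast
  have "on_blocks (prod_list ss) \<circ> on_blocks (prod_list (rev ss)) = id"
    using prod_list_rev[of ss] normal_sq[OF assms(2)] by (metis on_blocks_times on_blocks_one)
  then have "on_blocks (cnjs ss (prod_list w)) = id"
    using assms(1) by (simp add: words_def on_blocks_cnjs)
  then show ?thesis
    using assms(1) gen_map_cnjs[OF n, of w] by (simp add: words_def cnjs_prod_list[OF n])
qed

lemma map_on_blocks_inject:
  assumes "set w \<subseteq> set involutions" "set w' \<subseteq> set involutions" "map on_blocks w = map on_blocks w'"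
  shows "w = w'"
  using assms inj_on_blocks by (metis inj_on_map_eq_map inj_on_subset Un_least)

lemma orb_refl: "map on_blocks w \<in> orb w"
  unfolding orb_def by (intro CollectI exI[of _ "[]"]) simp

lemma orb_cnjs:
  assumes ss: "set ss \<subseteq> set normal_involutions" shows "orb (map (cnjs ss) w) = orb w"
proof
  have n: "set ss \<subseteq> normalizers" using ss normalizers by blast
  have sub: "orb (map (cnjs ts) u) \<subseteq> orb u" if ts: "set ts \<subseteq> set normal_involutions" for ts u
  proof
    fix gs assume "gs \<in> orb (map (cnjs ts) u)"
    then obtain us where us: "set us \<subseteq> set normal_involutions"
        "gs = map on_blocks (map (cnjs us) (map (cnjs ts) u))"
      unfolding orb_def by blast
    then have "gs = map on_blocks (map (cnjs (us @ ts)) u)" by (simp add: cnjs_append)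
    moreover have "set (us @ ts) \<subseteq> set normal_involutions" using us ts by simp
    ultimately show "gs \<in> orb u" unfolding orb_def by blast
  qed
  show "orb (map (cnjs ss) w) \<subseteq> orb w" by (rule sub[OF ss])
  have "orb (map (cnjs (rev ss)) (map (cnjs ss) w)) \<subseteq> orb (map (cnjs ss) w)"
    using ss by (intro sub) simp
  then show "orb w \<subseteq> orb (map (cnjs ss) w)" by (simp only: map_cnjs_rev[OF n])
qed

lemma orb_eqD:
  assumes "w \<in> words k" "w' \<in> words k" "orb w = orb w'"
  obtains ss where "set ss \<subseteq> set normal_involutions" "w' = map (cnjs ss) w"
proof -
  have "map on_blocks w' \<in> orb w" using assms(3) orb_refl by simp
  then obtain ss where ss: "set ss \<subseteq> set normal_involutions" "map on_blocks w' = map on_blocks (map (cnjs ss) w)"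
    unfolding orb_def by blast
  then show thesis
    using that map_on_blocks_inject words_subset words_cnjs assms by meson
qed

section \<open>Braid moves on orbits of tuples\<close>

lemma braid_move_nth:
  "Suc i < length w \<Longrightarrow> braid_move i w = w[i := w ! Suc i, Suc i := cnj (w ! Suc i) (w ! i)]"
proof (induction i w rule: braid_move.induct)
  case (1 a b w) then show ?case by simp
next
  case (2 k a w) then show ?case by simp
qed simp_all

text \<open>The inverse braid generator on words of involutions; it serves for surjectivity of the
  generators and for inverses in the braid image.\<close>

definition unbraid_move :: "nat \<Rightarrow> semi list \<Rightarrow> semi list" where
  "unbraid_move i w = w[i := cnj (w ! i) (w ! Suc i), Suc i := w ! i]"

lemma unbraid_move:
  assumes "set w \<subseteq> set involutions" "Suc i < length w"
  shows "unbraid_move i (braid_move i w) = w" "braid_move i (unbraid_move i w) = w"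
proof -
  have "w ! i \<in> set involutions" "w ! Suc i \<in> set involutions" using assms by auto
  then have "cnj (w ! i) (cnj (w ! i) (w ! Suc i)) = w ! Suc i"
    "cnj (w ! Suc i) (cnj (w ! Suc i) (w ! i)) = w ! i"
    using cnj_cnj[OF sq] by blast+
  moreover have "length (unbraid_move i w) = length w" by (simp add: unbraid_move_def)
  ultimately show "unbraid_move i (braid_move i w) = w" "braid_move i (unbraid_move i w) = w"
    using assms(2) by (auto simp: braid_move_nth unbraid_move_def nth_list_update intro!: nth_equalityI)
qed

lemma hurwitz_move_on_blocks:
  assumes "set w \<subseteq> set involutions" "Suc i < length w"
  shows "hurwitz_move (alt_group 6) i (map on_blocks w) = map on_blocks (braid_move i w)"
proof -
  have "w ! Suc i \<in> set involutions" using assms by auto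
  then have "inv\<^bsub>alt_group 6\<^esub> (on_blocks (w ! Suc i)) = on_blocks (w ! Suc i)"
    using C22_inv C22_on_blocks by blast
  then show ?thesis
    using assms(2) by (simp add: hurwitz_move_def braid_move_nth map_update on_blocks_cnj alt_group_mult)
qed

lemma words_braid_eq:
  assumes "w \<sim> w'" "w \<in> words k" shows "w' \<in> words k"
  using assms gen_braid_eq[OF assms(1)] braid_eq_length[OF assms(1)]
    braid_eq_prod_list[OF assms(1) words_subset[OF assms(2)]]
  by (simp add: words_def)

lemma words_unbraid:
  assumes "w \<in> words k" "Suc i < k"
  shows "unbraid_move i w \<in> words k" "unbraid_move i w \<sim> w"
proof -
  have w: "set w \<subseteq> set involutions" "length w = k" using assms words_subset words_length by auto
  show "unbraid_move i w \<sim> w"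
    using braid_move[of "unbraid_move i w" i] unbraid_move(2)[OF w(1), of i] w assms by simp
  then show "unbraid_move i w \<in> words k" using words_braid_eq assms braid_eq.sym by blast
qed

text \<open>Makes a braid move well defined on orbits under simultaneous conjugation.\<close>

lemma braid_move_cnjs:
  assumes "set ss \<subseteq> normalizers"
  shows "braid_move i (map (cnjs ss) w) = map (cnjs ss) (braid_move i w)"
  by (induction i w rule: braid_move.induct) (simp_all add: cnj_def cnjs_mult[OF assms])

lemma braid_gen_orb:
  assumes "w \<in> words k" "Suc i < k" shows "braid_gen k i (orb w) = orb (braid_move i w)"
proof -
  have "hurwitz_move (alt_group 6) i ` orb w = orb (braid_move i w)"
  proof -
    have "hurwitz_move (alt_group 6) i (map on_blocks (map (cnjs ss) w))
        = map on_blocks (map (cnjs ss) (braid_move i w))" if "set ss \<subseteq> set normal_involutions" for ss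
    proof -
      have "map (cnjs ss) w \<in> words k" using words_cnjs assms that by blast
      moreover have "set ss \<subseteq> normalizers" using that normalizers by blast
      ultimately show ?thesis
        using hurwitz_move_on_blocks[of "map (cnjs ss) w" i] words_subset words_length assms braid_move_cnjs
        by metis
    qed
    then show ?thesis unfolding orb_def by (auto simp: image_iff) metis+
  qed
  then show ?thesis using assms by (simp add: braid_gen_def hurwitz_space_orb)
qed

lemma braid_gen_Bij:
  assumes "Suc i < k" shows "braid_gen k i \<in> Bij (hurwitz_space k)"
proof -
  have "bij_betw (braid_gen k i) (hurwitz_space k) (hurwitz_space k)"
    unfolding bij_betw_def
  proof
    show "inj_on (braid_gen k i) (hurwitz_space k)"
      unfolding hurwitz_space_orb
    proof (rule inj_onI, clarify)
      fix w w' assume w: "w \<in> words k" "w' \<in> words k" "braid_gen k i (orb w) = braid_gen k i (orb w')"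
      then have "orb (braid_move i w) = orb (braid_move i w')" using braid_gen_orb assms by simp
      moreover have "braid_move i w \<in> words k" "braid_move i w' \<in> words k"
        using words_braid_eq braid_move w by blast+
      ultimately obtain ss where ss: "set ss \<subseteq> set normal_involutions"
          "braid_move i w' = map (cnjs ss) (braid_move i w)"
        using orb_eqD by blast
      have n: "set ss \<subseteq> normalizers" using ss normalizers by blast
      have "braid_move i w' = braid_move i (map (cnjs ss) w)" using ss braid_move_cnjs[OF n] by simp
      moreover have "map (cnjs ss) w \<in> words k" using words_cnjs w ss by blast
      ultimately have "w' = map (cnjs ss) w"
        using unbraid_move(1) words_subset words_length w(2) assms by metis
      then show "orb w = orb w'" using orb_cnjs ss by simp
    qed
    show "braid_gen k i ` hurwitz_space k = hurwitz_space k"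
    proof
      show "braid_gen k i ` hurwitz_space k \<subseteq> hurwitz_space k"
        unfolding hurwitz_space_orb
      proof clarify
        fix w assume w: "w \<in> words k"
        then have "braid_move i w \<in> words k" using words_braid_eq braid_move by blast
        then show "braid_gen k i (orb w) \<in> orb ` words k" using braid_gen_orb[OF w assms] by simp
      qed
      show "hurwitz_space k \<subseteq> braid_gen k i ` hurwitz_space k"
        unfolding hurwitz_space_orb
      proof clarify
        fix w assume w: "w \<in> words k"
        then have "braid_gen k i (orb (unbraid_move i w)) = orb w"
          using words_unbraid[OF w assms] braid_gen_orb unbraid_move(2) words_subset words_length assms by metis
        then show "orb w \<in> braid_gen k i ` orb ` words k"
          using words_unbraid[OF w assms] by (metis imageI)
      qed
    qed
  qed
  then show ?thesis by (simp add: Bij_def braid_gen_def)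
qed

section \<open>Components as braid classes of words\<close>

lemma braid_image_action: "group_action (braid_image k) (hurwitz_space k) (\<lambda>b. b)"
proof -
  let ?B = "BijGroup (hurwitz_space k)"
  have sub: "{braid_gen k i | i. Suc i < k} \<subseteq> carrier ?B"
    using braid_gen_Bij by (auto simp: BijGroup_def)
  have subgroup: "subgroup (carrier (braid_image k)) ?B"
    using group.generate_is_subgroup[OF group_BijGroup sub] by (simp add: braid_image_def)
  have "group (braid_image k)"
    using group.subgroup_imp_group[OF group_BijGroup subgroup] by (simp add: braid_image_def)
  moreover have "(\<lambda>b. b) \<in> hom (braid_image k) ?B"
    using subgroup.subset[OF subgroup] by (auto simp: hom_def braid_image_def)
  ultimately show ?thesis
    by (simp add: group_action_def group_hom_def group_hom_axioms_def group_BijGroup)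
qed

abbreviation component :: "nat \<Rightarrow> (nat \<Rightarrow> nat) list set \<Rightarrow> (nat \<Rightarrow> nat) list set set" where
  "component k P \<equiv> Group_Action.orbit (braid_image k) (\<lambda>b. b) P"

text \<open>The prefix \<open>u\<close> is generalized because \<open>Cons\<close> puts letters in
  front of a move; a swap behind \<open>u\<close> is the braid generator at position
  \<open>length u\<close>.\<close>

lemma braid_eq_component:
  "w \<sim> w' \<Longrightarrow> u @ w \<in> words k \<Longrightarrow> orb (u @ w') \<in> component k (orb (u @ w))"
proof (induction arbitrary: u rule: braid_eq.induct)
  case (refl w)
  then have "orb (u @ w) \<in> hurwitz_space k" by (simp add: hurwitz_space_orb)
  then show ?case by (rule group_action.orbit_refl[OF braid_image_action])
next
  case (sym w w')
  then have w: "u @ w \<in> words k" by (meson words_braid_eq braid_eq_append1 braid_eq.sym)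
  then have "orb (u @ w) \<in> hurwitz_space k" "orb (u @ w') \<in> hurwitz_space k"
    using sym.prems by (simp_all add: hurwitz_space_orb)
  then show ?case by (rule group_action.orbit_sym[OF braid_image_action _ _ sym.IH[OF w]])
next
  case (trans w w' w'')
  then have w: "u @ w' \<in> words k" "u @ w'' \<in> words k" by (meson words_braid_eq braid_eq_append1)+
  then have "orb (u @ w) \<in> hurwitz_space k" "orb (u @ w') \<in> hurwitz_space k" "orb (u @ w'') \<in> hurwitz_space k"
    using trans.prems by (simp_all add: hurwitz_space_orb)
  then show ?case
    by (rule group_action.orbit_trans[OF braid_image_action _ _ _ trans.IH(1)[OF trans.prems] trans.IH(2)[OF w(1)]])
next
  case (swap a b w)
  then have i: "Suc (length u) < k" using words_length by fastforce
  have "braid_move (length u) (u @ a # b # w) = u @ b # cnj b a # w"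
    by (induction u) simp_all
  then have "braid_gen k (length u) (orb (u @ a # b # w)) = orb (u @ b # cnj b a # w)"
    using braid_gen_orb[OF swap i] by simp
  moreover have "braid_gen k (length u) \<in> carrier (braid_image k)"
    using i by (auto simp: braid_image_def intro: generate.incl)
  ultimately show ?case unfolding Group_Action.orbit_def by blast
next
  case (Cons w w' a)
  then show ?case using Cons.IH[of "u @ [a]"] by simp
qed

text \<open>The braid image acts on orbits, not on words, hence the existential choice of a word in
  the image orbit. Inverses of generators are followed by \<open>unbraid_move\<close>.\<close>

lemma component_braid_eq:
  assumes "b \<in> carrier (braid_image k)"
  shows "w \<in> words k \<Longrightarrow> \<exists>w'\<in>words k. w \<sim> w' \<and> b (orb w) = orb w'"
proof -
  have "b \<in> generate (BijGroup (hurwitz_space k)) {braid_gen k i | i. Suc i < k}"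
    using assms by (simp add: braid_image_def)
  then have "b \<in> Bij (hurwitz_space k) \<and> (\<forall>w\<in>words k. \<exists>w'\<in>words k. w \<sim> w' \<and> b (orb w) = orb w')"
  proof (induction rule: generate.induct)
    case one
    show ?case
      unfolding BijGroup_def
      by (auto simp: id_Bij simp del: restrict_apply) (auto simp: hurwitz_space_orb intro: braid_eq.refl)
  next
    case (incl h)
    then obtain i where i: "h = braid_gen k i" "Suc i < k" by blast
    then show ?case
      using braid_gen_Bij braid_gen_orb words_braid_eq braid_move by metis
  next
    case (inv h)
    then obtain i where i: "h = braid_gen k i" "Suc i < k" by blast
    have B: "h \<in> Bij (hurwitz_space k)" using i braid_gen_Bij by simp
    then have inv: "inv\<^bsub>BijGroup (hurwitz_space k)\<^esub> h = (\<lambda>P\<in>hurwitz_space k. inv_into (hurwitz_space k) h P)"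
      by (rule inv_BijGroup)
    have "\<exists>w'\<in>words k. w \<sim> w' \<and> (inv\<^bsub>BijGroup (hurwitz_space k)\<^esub> h) (orb w) = orb w'"
      if w: "w \<in> words k" for w
    proof (intro bexI conjI)
      have u: "unbraid_move i w \<in> words k" using words_unbraid w i by blast
      then have "h (orb (unbraid_move i w)) = orb w"
        using braid_gen_orb unbraid_move(2) words_subset words_length w i by metis
      moreover have "inj_on h (hurwitz_space k)" using B by (simp add: Bij_def bij_betw_def)
      ultimately have "inv_into (hurwitz_space k) h (orb w) = orb (unbraid_move i w)"
        using u by (metis hurwitz_space_orb imageI inv_into_f_f)
      then show "(inv\<^bsub>BijGroup (hurwitz_space k)\<^esub> h) (orb w) = orb (unbraid_move i w)"
        unfolding inv using w by (simp add: hurwitz_space_orb)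
      show "w \<sim> unbraid_move i w" using words_unbraid w i braid_eq.sym by blast
    qed (use words_unbraid w i in blast)
    then show ?case unfolding inv using B restrict_inv_into_Bij by blast
  next
    case (eng b c)
    have "\<exists>w'\<in>words k. w \<sim> w' \<and> (compose (hurwitz_space k) b c) (orb w) = orb w'" if w: "w \<in> words k" for w
    proof -
      obtain w' where "w' \<in> words k" "w \<sim> w'" "c (orb w) = orb w'" using eng w by blast
      moreover from this obtain w'' where "w'' \<in> words k" "w' \<sim> w''" "b (orb w') = orb w''" using eng by blast
      ultimately show ?thesis
        using w braid_eq.trans by (metis compose_eq hurwitz_space_orb imageI)
    qed
    then show ?case using eng by (simp add: BijGroup_def compose_Bij)
  qed
  then show "w \<in> words k \<Longrightarrow> \<exists>w'\<in>words k. w \<sim> w' \<and> b (orb w) = orb w'" by blast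
qed

lemma component_orb:
  assumes "w \<in> words k" shows "component k (orb w) = orb ` {w' \<in> words k. w \<sim> w'}"
proof (intro Set.set_eqI iffI)
  fix Q assume "Q \<in> component k (orb w)"
  then obtain b where "b \<in> carrier (braid_image k)" "Q = b (orb w)"
    by (auto simp: Group_Action.orbit_def)
  then show "Q \<in> orb ` {w' \<in> words k. w \<sim> w'}" using component_braid_eq assms by blast
next
  fix Q assume "Q \<in> orb ` {w' \<in> words k. w \<sim> w'}"
  then show "Q \<in> component k (orb w)" using braid_eq_component[of w _ "[]" k] assms by auto
qed

section \<open>The lifting invariant on components\<close>

lemma words_prod:
  assumes "w \<in> words k" shows "prod_list w = 1 \<or> prod_list w \<in> {z1, z2}"
  using assms kernel_on_blocks gen_word_group by (auto simp: words_def)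

lemma z_facts: "z1 \<noteq> 1" "z2 \<noteq> 1" "z1 * z1 * z1 = 1" "z2 * z2 * z2 = 1" "on_blocks z1 = id"
  "cnj odd_inv z1 = z2" "cnj odd_inv z2 = z1"
proof -
  show "on_blocks z1 = id"
  proof (rule eq_on_blocks)
    fix b show "on_blocks z1 (block_num b) = id (block_num b)"
      unfolding on_blocks_num by (cases b) (simp_all add: z1_def)
  qed (simp_all add: on_blocks_outside)
qed code_simp+

text \<open>Along an orbit under S6 the lifting invariant varies by conjugation, so a property of it
  is tested on all conjugates.\<close>

lemma orb_lifting_invariant:
  assumes "w \<in> words k"
  shows "(\<forall>gs\<in>orb w. Q (lifting_invariant gs))
    \<longleftrightarrow> (\<forall>ss. set ss \<subseteq> set normal_involutions \<longrightarrow> Q (realize (cnjs ss (prod_list w))))"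
proof -
  have "lifting_invariant (map on_blocks (map (cnjs ss) w)) = realize (cnjs ss (prod_list w))"
    if ss: "set ss \<subseteq> set normal_involutions" for ss
  proof -
    have "set ss \<subseteq> normalizers" using ss normalizers by blast
    then show ?thesis
      using lifting_invariant_on_blocks words_subset words_cnjs[OF assms ss] cnjs_prod_list by metis
  qed
  then show ?thesis unfolding orb_def by (auto simp del: map_map) metis
qed

lemma hurwitz_plus_orb: "hurwitz_plus k = orb ` {w \<in> words k. prod_list w = 1}"
proof -
  have "(\<forall>gs\<in>orb w. lifting_invariant gs = id) \<longleftrightarrow> prod_list w = 1" if w: "w \<in> words k" for w
  proof -
    have "realize (cnjs ss (prod_list w)) = id \<longleftrightarrow> prod_list w = 1"
      if ss: "set ss \<subseteq> set normal_involutions" for ss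
    proof -
      have "set ss \<subseteq> normalizers" using ss normalizers by blast
      then show ?thesis using cnjs_one cnjs_eq_iff by (metis realize_eq_id)
    qed
    then show ?thesis
      unfolding orb_lifting_invariant[OF w, of "\<lambda>v. v = id"] by (metis empty_subsetI list.set(1))
  qed
  then show ?thesis unfolding hurwitz_plus_def hurwitz_space_orb by auto
qed

lemma hurwitz_minus_orb: "hurwitz_minus k = orb ` {w \<in> words k. prod_list w \<in> {z1, z2}}"
proof -
  have "(\<forall>gs\<in>orb w. group.ord valentiner (lifting_invariant gs) = 3) \<longleftrightarrow> prod_list w \<in> {z1, z2}"
    if w: "w \<in> words k" for w
  proof -
    have "group.ord valentiner (realize (cnjs ss (prod_list w))) = 3 \<longleftrightarrow> prod_list w \<in> {z1, z2}"
      if ss: "set ss \<subseteq> set normal_involutions" for ss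
    proof -
      have n: "set ss \<subseteq> normalizers" using ss normalizers by blast
      have w': "map (cnjs ss) w \<in> words k" using words_cnjs w ss by blast
      then have v: "cnjs ss (prod_list w) \<in> word_group"
        using gen_word_group cnjs_prod_list[OF n] by (simp add: words_def)
      have "cnjs ss (prod_list w) = 1 \<or> cnjs ss (prod_list w) \<in> {z1, z2}"
        using words_prod[OF w'] cnjs_prod_list[OF n] by simp
      then show ?thesis
        using ord_realize(2)[OF v] cnjs_z[OF ss, of "prod_list w"] z_facts by auto
    qed
    then show ?thesis
      unfolding orb_lifting_invariant[OF w, of "\<lambda>v. group.ord valentiner v = 3"]
      by (metis empty_subsetI list.set(1))
  qed
  then show ?thesis unfolding hurwitz_minus_def hurwitz_space_orb by auto
qed

lemma braid_eq_words_iff: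
  assumes "k \<ge> 5" "w \<in> words k" "w' \<in> words k" shows "w \<sim> w' \<longleftrightarrow> prod_list w = prod_list w'"
  using determined[OF assms(1)] assms braid_eq_prod_list words_subset
  unfolding determined_def words_def by blast

lemma component_plus:
  assumes "k \<ge> 5" "w \<in> words k" "prod_list w = 1" shows "component k (orb w) = hurwitz_plus k"
  using component_orb[OF assms(2)] braid_eq_words_iff[OF assms(1,2)] assms(3)
  unfolding hurwitz_plus_orb by auto

lemma component_minus:
  assumes "k \<ge> 5" "w \<in> words k" "prod_list w \<in> {z1, z2}" shows "component k (orb w) = hurwitz_minus k"
proof
  show "component k (orb w) \<subseteq> hurwitz_minus k"
    using component_orb[OF assms(2)] braid_eq_words_iff[OF assms(1,2)] assms(3)
    unfolding hurwitz_minus_orb by auto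
  show "hurwitz_minus k \<subseteq> component k (orb w)"
  proof
    fix P assume "P \<in> hurwitz_minus k"
    then obtain w' where w': "w' \<in> words k" "prod_list w' \<in> {z1, z2}" "P = orb w'"
      unfolding hurwitz_minus_orb by blast
    \<comment> \<open>Words with products \<open>z1\<close> and \<open>z2\<close> are not braid
      equivalent, but conjugation by \<open>odd_inv\<close> exchanges the two products without
      leaving the orbit under S6.\<close>
    have s: "set [odd_inv] \<subseteq> set normal_involutions" by simp
    then have n: "set [odd_inv] \<subseteq> normalizers" using normalizers by blast
    define u where "u = map (cnjs [odd_inv]) w'"
    have u: "u \<in> words k" "orb u = P" "prod_list u = cnj odd_inv (prod_list w')"
      using words_cnjs[OF w'(1) s] orb_cnjs[OF s] w'(3) cnjs_prod_list[OF n, of w'] by (simp_all add: u_def)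
    have "prod_list w = prod_list w' \<or> prod_list w = prod_list u"
      using u(3) w'(2) assms(3) z_facts by auto
    then show "P \<in> component k (orb w)"
      using component_orb[OF assms(2)] braid_eq_words_iff[OF assms(1,2)] u w' by blast
  qed
qed

lemma words_ex:
  assumes "gen_prod k v" "on_blocks v = id" shows "\<exists>w\<in>words k. prod_list w = v"
  using assms by (auto simp: gen_prod_def words_def)

text \<open>\<open>lev5\<close> excludes the product 1 at length 5; this is why genus zero has only
  one component.\<close>

lemma words5: "w \<in> words 5 \<Longrightarrow> prod_list w \<in> {z1, z2}"
  using words_prod[of w 5] gen_prod5[OF word_group_one] by (auto simp: gen_prod_def words_def lev5_def)

lemma z1_word_group: "z1 \<in> word_group"
proof -
  \<comment> \<open>Four letters whose images in A6 have product 1 while the lifts do not.\<close>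
  have "z1 = prod_list [i1234, i1235, i2634, i2645]" by code_simp
  then show ?thesis using word_group_prod_list[of "[i1234, i1235, i2634, i2645]"] by (simp add: involutions_def)
qed

lemma words_minus_ex: "k \<ge> 5 \<Longrightarrow> \<exists>w\<in>words k. prod_list w \<in> {z1, z2}"
  using words_ex[of k z1] gen_prod5[OF z1_word_group] gen_prod_ge6[OF _ z1_word_group] z_facts
  by (cases "k = 5") (auto simp: lev5_def)

lemma words_plus_ex: "k \<ge> 6 \<Longrightarrow> \<exists>w\<in>words k. prod_list w = 1"
  using words_ex[of k 1] gen_prod_ge6[OF _ word_group_one] on_blocks_one by auto

lemma components_eq: "hurwitz_components k = (\<lambda>w. component k (orb w)) ` words k"
  unfolding hurwitz_components_def orbits_def hurwitz_space_orb by auto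

lemma components_ge6:
  assumes "k \<ge> 6"
  shows "hurwitz_components k = {hurwitz_plus k, hurwitz_minus k}" "hurwitz_plus k \<noteq> hurwitz_minus k"
proof -
  have k: "k \<ge> 5" using assms by simp
  obtain w1 where w1: "w1 \<in> words k" "prod_list w1 = 1" using words_plus_ex[OF assms] by blast
  obtain w2 where w2: "w2 \<in> words k" "prod_list w2 \<in> {z1, z2}" using words_minus_ex[OF k] by blast
  have c: "component k (orb w) \<in> {hurwitz_plus k, hurwitz_minus k}" if "w \<in> words k" for w
    using words_prod[OF that] component_plus[OF k that] component_minus[OF k that] by blast
  show "hurwitz_components k = {hurwitz_plus k, hurwitz_minus k}"
    unfolding components_eq using c w1 w2 component_plus[OF k w1] component_minus[OF k w2] by blast
  have "orb w1 \<in> hurwitz_plus k" unfolding hurwitz_plus_orb using w1 by blast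
  moreover have "orb w1 \<notin> hurwitz_minus k"
  proof
    assume "orb w1 \<in> hurwitz_minus k"
    then have "group.ord valentiner (lifting_invariant (map on_blocks w1)) = 3"
      using orb_refl by (auto simp: hurwitz_minus_def)
    moreover have "lifting_invariant (map on_blocks w1) = realize 1"
      using lifting_invariant_on_blocks words_subset w1 by metis
    ultimately show False using ord_realize(2)[OF word_group_one] by simp
  qed
  ultimately show "hurwitz_plus k \<noteq> hurwitz_minus k" by blast
qed

lemma components_5: "hurwitz_components 5 = {hurwitz_space 5}"
proof -
  have "hurwitz_minus 5 = hurwitz_space 5"
    unfolding hurwitz_minus_orb hurwitz_space_orb using words5 by blast
  moreover have "component 5 (orb w) = hurwitz_minus 5" if "w \<in> words 5" for w
    using component_minus[OF _ that words5[OF that]] by simp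
  moreover have "words 5 \<noteq> {}" using words_minus_ex[of 5] by auto
  ultimately show ?thesis unfolding components_eq by auto
qed

section \<open>Genus of the coverings\<close>

lemma orbit_involution: "g \<circ> g = id \<Longrightarrow> Orbits.orbit g x = {x, g x}"
proof (intro Set.set_eqI iffI)
  assume g: "g \<circ> g = id"
  then have gg: "g (g y) = y" for y by (metis comp_apply id_apply)
  fix y
  show "y \<in> Orbits.orbit g x \<Longrightarrow> y \<in> {x, g x}"
    by (induction rule: Orbits.orbit.induct) (auto simp: gg)
  \<comment> \<open>Orbits in this sense start at \<open>g x\<close>; the point \<open>x\<close>
    itself enters as \<open>g (g x)\<close>.\<close>
  have "g x \<in> Orbits.orbit g x" "g (g x) \<in> Orbits.orbit g x"
    by (auto intro: Orbits.orbit.intros)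
  then show "y \<in> {x, g x} \<Longrightarrow> y \<in> Orbits.orbit g x" by (auto simp: gg)
qed

lemma ramification_C22:
  assumes "g \<in> C22" shows "ramification g = 2"
proof -
  obtain a b c d where g: "g = transpose a b \<circ> transpose c d" "distinct [a, b, c, d]" "{a, b, c, d} \<subseteq> {1..6}"
    using assms unfolding C22_def by blast
  have "card ({1..6} - {a, b, c, d}) = 2"
    using g(2,3) by (subst card_Diff_subset) auto
  then obtain e f where ef: "{1..6} - {a, b, c, d} = {e, f}" "e \<noteq> f" by (meson card_2_iff)
  have "{1..6} = {a, b, c, d} \<union> {e, f}" unfolding ef(1)[symmetric] using g(3) by blast
  then have r: "{1..6} = {a, b, c, d, e, f}" by (simp add: insert_commute)
  have "e \<notin> {a, b, c, d}" "f \<notin> {a, b, c, d}" using ef(1) by blast+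
  then have d: "distinct [a, b, c, d, e, f]" using g(2) ef(2) by auto
  have "g \<circ> g = id" using g(2) by (auto simp: g(1) fun_eq_iff transpose_def)
  moreover have "g a = b" "g b = a" "g c = d" "g d = c" "g e = e" "g f = f"
    using d by (auto simp: g(1) transpose_def)
  ultimately have "Orbits.orbit g ` {1..6} = {{a, b}, {c, d}, {e}, {f}}"
    unfolding r by (simp add: orbit_involution insert_commute)
  then show ?thesis using d by (simp add: ramification_def card_insert_if doubleton_eq_iff)
qed

text \<open>With ramification 2 at each of the \<open>k\<close> branch points the formula reads 2g -
  2 = -12 + 2k.\<close>

lemma covering_genus_Ni:
  assumes "gs \<in> Ni k" shows "covering_genus gs g \<longleftrightarrow> k = g + 5"
proof -
  have gs: "length gs = k" "set gs \<subseteq> C22" using assms by (simp_all add: nielsen_def)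
  have "map ramification gs = map (\<lambda>_. 2) gs"
    using gs(2) ramification_C22 by (intro map_cong) auto
  then have "(\<Sum>x\<leftarrow>gs. ramification x) = 2 * k"
    using gs(1) by (simp only: sum_list_triv) simp
  then show ?thesis unfolding covering_genus_def by auto
qed

text \<open>A component contains a tuple, so the genus condition on all its members is not vacuous
  and fixes \<open>k\<close>.\<close>

lemma components_of_genus: "hurwitz_components_of_genus g = hurwitz_components (g + 5)"
proof -
  have "(\<forall>P\<in>Z. \<forall>gs\<in>P. covering_genus gs g) \<longleftrightarrow> k = g + 5" if Z: "Z \<in> hurwitz_components k" for Z k
  proof -
    obtain w where w: "w \<in> words k" "Z = component k (orb w)" using Z components_eq by auto
    then have "orb w \<in> Z" using component_orb[OF w(1)] by auto
    moreover have "Z \<subseteq> orb ` words k" using component_orb[OF w(1)] w(2) by auto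
    moreover have "orb w' \<subseteq> Ni k" if "w' \<in> words k" for w'
      unfolding orb_def Ni_words using words_cnjs that by blast
    ultimately have Ni: "\<And>P gs. P \<in> Z \<Longrightarrow> gs \<in> P \<Longrightarrow> gs \<in> Ni k"
      and "\<exists>P\<in>Z. \<exists>gs\<in>P. gs \<in> Ni k"
      using orb_refl[of w] by (auto simp: subset_iff image_iff) metis+
    then show ?thesis using covering_genus_Ni by metis
  qed
  then show ?thesis unfolding hurwitz_components_of_genus_def by auto
qed

theorem theorem2p5:
  shows "(\<forall>k\<ge>6. hurwitz_components k = {hurwitz_plus k, hurwitz_minus k}
                 \<and> hurwitz_plus k \<noteq> hurwitz_minus k)
       \<and> hurwitz_components 5 = {hurwitz_space 5}
       \<and> (\<forall>g. card (hurwitz_components_of_genus g) = (if g = 0 then 1 else 2))"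
proof (intro conjI allI impI)
  fix g show "card (hurwitz_components_of_genus g) = (if g = 0 then 1 else 2)"
    using components_ge6[of "g + 5"] components_5 by (auto simp: components_of_genus card_insert_if)
qed (use components_ge6 components_5 in auto)

end
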